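(* Consider an exponential family model with local energy $V(x^m|\varphi;\theta)=\theta^Tv(x^m|\varphi)$ satisfying condition (Exp) of the context, and let $\Phi\sim P_{\theta^\star}$. Then $$\lambda_{Inn}=D^{-d}\sum_{k\in\mathbb Z^d,|k|\le1}\mathbf E\left(I_{\Delta_0(D)}(\Phi;h,\theta^\star)\,I_{\Delta_k(D)}(\Phi;h,\theta^\star)\right)>0$$ for each of the test functions $h(x^m,\varphi;\theta)=1$ (raw residuals), $h(x^m,\varphi;\theta)=e^{V(x^m|\varphi;\theta)/2}$ (Pearson residuals) and $h(x^m,\varphi;\theta)=e^{V(x^m|\varphi;\theta)}$ (inverse residuals). Here $\Delta_k(D)$ is the cube centered at $kD$ with side-length $D$.
   Context: Notation. $|\cdot|$ is the uniform norm of a vector; $|\varphi_\Lambda|$ is the number of points of $\varphi$ in $\Lambda$. $\mathcal B(x,\rho)=\{y:|y-x|<\rho\}$. $(\mathbb M,\mathcal M,\lambda^{\mathbb m})$ is a probability space (marks), $\mathbb S=\mathbb R^d\times\mathbb M$, $\mu=\lambda\otimes\lambda^{\mathbb m}$ with $\lambda$ Lebesgue measure; $x^m=(x,m)\in\mathbb S$. $\Omega$ is the set of (locally finite) simple point configurations on $\mathbb S$ with its usual $\sigma$-algebra; $\varphi_\Lambda$ is the restriction of $\varphi$ to $\Lambda\times\mathbb M$; $\varphi\cup x^m$ and $\varphi\setminus x^m$ denote adding/removing a point; $\Lambda^c$ is the complement. Exponential family. $\Theta\subset\mathbb R^p$ is compact; for bounded Borel $\Lambda$ the energies $V_\Lambda(\varphi;\theta)=\theta^Tv_\Lambda(\varphi)$,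 $v_\Lambda(\varphi)\in\mathbb R^p$, form for each $\theta\in\Theta$ a compatible (for $\Lambda\subset\Lambda'$, $V_{\Lambda'}(\varphi;\theta)-V_\Lambda(\varphi;\theta)$ is a measurable function of $\varphi_{\Lambda^c}$), translation invariant family; $v(x^m|\varphi)=v_\Lambda(\varphi\cup x^m)-v_\Lambda(\varphi)$ for any $\Lambda\ni x$. $P_\theta$ is an associated stationary Gibbs measure: for every bounded $\Lambda$ and $P_\theta$-a.e. $\varphi_{\Lambda^c}$, the conditional law of $\varphi_\Lambda$ given $\varphi_{\Lambda^c}$ has density proportional to $e^{-V_\Lambda(\varphi;\theta)}$ with respect to the homogeneous marked Poisson process of intensity $1$ (mark law $\lambda^{\mathbb m}$). The true parameter $\theta^\star$ lies in the interior of $\Theta$ and $\mathbf E$ is expectation under $P_{\theta^\star}$. (Exp) There is $D>0$ such that for each $i=1,\dots,p$ there are $\kappa_i^{(\inf)},\kappa_i^{(\sup)}\ge0$, $k_i\in\mathbb N$ such that one of the following holds: either $\theta_i\ge0$ (for all $\theta\in\Theta$) and, for all $(m,\varphi)\in\mathbb M\times\Omega$, $-\kappa_i^{(\inf)}\le v_i(0^m|\varphi)=v_i(0^m|\varphi_{\mathcal B(0,D)})\le\kappa_i^{(\sup)}|\varphi_{\mathcal B(0,D)}|^{k_i}$; or, for all $(m,\varphi)$, $-\kappa_i^{(\inf)}\le v_i(0^m|\varphi)=v_i(0^m|\varphi_{\mathcal B(0,D)})\le\kappa_i^{(\sup)}$. Innovations: $I_\Lambda(\varphi;h,\theta)=\int_{\Lambda\times\mathbb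 M}h(x^m,\varphi;\theta)e^{-V(x^m|\varphi;\theta)}\mu(dx^m)-\sum_{x^m\in\varphi_\Lambda}h(x^m,\varphi\setminus x^m;\theta)$. *)

theory Defs
  imports "HOL-Probability.Probability"
begin

type_synonym ('d, 'm) marked = "(real ^ 'd) \<times> 'm"

definition mu :: "'m measure \<Rightarrow> ('d::finite, 'm) marked measure" where
  "mu M = lborel \<Otimes>\<^sub>M M"

definition bounded_borel :: "(real ^ 'd::finite) set \<Rightarrow> bool" where
  "bounded_borel \<Lambda> \<longleftrightarrow> \<Lambda> \<in> sets borel \<and> bounded \<Lambda>"

definition restr :: "('d, 'm) marked set \<Rightarrow> (real ^ 'd) set \<Rightarrow> ('d, 'm) marked set" where
  "restr \<phi> \<Lambda> = \<phi> \<inter> (\<Lambda> \<times> UNIV)"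

definition translate :: "real ^ 'd \<Rightarrow> ('d::finite, 'm) marked set \<Rightarrow> ('d, 'm) marked set" where
  "translate y \<phi> = (\<lambda>(x, m). (x + y, m)) ` \<phi>"

(* Simple configurations are represented by sets of marked points.  The counting
   events use only sets B over a bounded region: there card is the true count. *)
definition configs :: "'m measure \<Rightarrow> ('d::finite, 'm) marked set measure" where
  "configs M =
     (let \<Omega> = {\<phi>. \<phi> \<subseteq> UNIV \<times> space M \<and> (\<forall>\<Lambda>. bounded \<Lambda> \<longrightarrow> finite (restr \<phi> \<Lambda>))}
      in sigma \<Omega> {{\<phi> \<in> \<Omega>. card (\<phi> \<inter> B) = n} | B n. B \<in> sets (mu M) \<and> bounded (fst ` B)})"

(* The homogeneous marked Poisson process of intensity 1 with mark law M, as the Poisson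
   process on marked points with intensity measure mu M.  The probabilities are written out
   because the library's poisson_pmf excludes the rate 0. *)
definition poisson_process :: "'m measure \<Rightarrow> ('d::finite, 'm) marked set measure \<Rightarrow> bool" where
  "poisson_process M Q \<longleftrightarrow>
     prob_space Q \<and> sets Q = sets (configs M) \<and>
     (\<forall>B \<in> sets (mu M). bounded (fst ` B) \<longrightarrow>
        (\<forall>n. measure Q {\<phi> \<in> space Q. card (\<phi> \<inter> B) = n}
             = exp (- measure (mu M) B) * measure (mu M) B ^ n / fact n)) \<and>
     (\<forall>(B :: nat \<Rightarrow> ('d, 'm) marked set) I. finite I \<longrightarrow> disjoint_family_on B I \<longrightarrow>
        (\<forall>i\<in>I. B i \<in> sets (mu M) \<and> bounded (fst ` B i)) \<longrightarrow>
        prob_space.indep_vars Q (\<lambda>_. count_space UNIV) (\<lambda>i \<phi>. card (\<phi> \<inter> B i)) I)"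

type_synonym ('d, 'm, 'p) stat = "(real ^ 'd) set \<Rightarrow> ('d, 'm) marked set \<Rightarrow> real ^ 'p"

definition energy ::
  "('d, 'm, 'p::finite) stat \<Rightarrow> (real ^ 'd) set \<Rightarrow> ('d, 'm) marked set \<Rightarrow> real ^ 'p \<Rightarrow> real" where
  "energy v \<Lambda> \<phi> \<theta> = \<theta> \<bullet> v \<Lambda> \<phi>"

definition compatible_energy ::
  "'m measure \<Rightarrow> ('d::finite, 'm, 'p::finite) stat \<Rightarrow> real ^ 'p \<Rightarrow> bool" where
  "compatible_energy M v \<theta> \<longleftrightarrow>
     (\<forall>\<Lambda> \<Lambda>'. bounded_borel \<Lambda> \<longrightarrow> bounded_borel \<Lambda>' \<longrightarrow> \<Lambda> \<subseteq> \<Lambda>' \<longrightarrow>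
        (\<exists>f \<in> borel_measurable (configs M). \<forall>\<phi> \<in> space (configs M).
           energy v \<Lambda>' \<phi> \<theta> - energy v \<Lambda> \<phi> \<theta> = f (restr \<phi> (- \<Lambda>))))"

definition translation_invariant_energy ::
  "'m measure \<Rightarrow> ('d::finite, 'm, 'p::finite) stat \<Rightarrow> real ^ 'p \<Rightarrow> bool" where
  "translation_invariant_energy M v \<theta> \<longleftrightarrow>
     (\<forall>\<Lambda> y. bounded_borel \<Lambda> \<longrightarrow> (\<forall>\<phi> \<in> space (configs M).
        energy v ((\<lambda>x. x + y) ` \<Lambda>) (translate y \<phi>) \<theta> = energy v \<Lambda> \<phi> \<theta>))"

definition exponential_family ::
  "'m measure \<Rightarrow> (real ^ 'p) set \<Rightarrow> ('d::finite, 'm, 'p::finite) stat \<Rightarrow> bool" where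
  "exponential_family M \<Theta> v \<longleftrightarrow>
     compact \<Theta> \<and>
     (\<forall>\<Lambda>. bounded_borel \<Lambda> \<longrightarrow> v \<Lambda> \<in> borel_measurable (configs M)) \<and>
     (\<forall>\<theta>\<in>\<Theta>. compatible_energy M v \<theta> \<and> translation_invariant_energy M v \<theta>)"

(* v(x^m | phi), taken with the region {x}; lemma local_stat_eq below shows that every
   bounded Borel region containing x gives the same value. *)
definition local_stat ::
  "('d, 'm, 'p) stat \<Rightarrow> ('d, 'm) marked \<Rightarrow> ('d, 'm) marked set \<Rightarrow> real ^ 'p" where
  "local_stat v z \<phi> = v {fst z} (insert z \<phi>) - v {fst z} \<phi>"

definition local_energy ::
  "('d, 'm, 'p::finite) stat \<Rightarrow> ('d, 'm) marked \<Rightarrow> ('d, 'm) marked set \<Rightarrow> real ^ 'p \<Rightarrow> real" where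
  "local_energy v z \<phi> \<theta> = \<theta> \<bullet> local_stat v z \<phi>"

(* In terms of the Poisson process Q: the unnormalised conditional law of phi_Lambda,
   evaluated at A, given the outside configuration phi restricted to the complement *)
definition gibbs_weight ::
  "('d, 'm) marked set measure \<Rightarrow> ('d::finite, 'm, 'p::finite) stat \<Rightarrow> real ^ 'p \<Rightarrow>
   (real ^ 'd) set \<Rightarrow> ('d, 'm) marked set \<Rightarrow> ('d, 'm) marked set set \<Rightarrow> ennreal" where
  "gibbs_weight Q v \<theta> \<Lambda> \<phi> A =
     (\<integral>\<^sup>+ \<psi>. indicator A (restr \<psi> \<Lambda>) *
        ennreal (exp (- energy v \<Lambda> (restr \<psi> \<Lambda> \<union> restr \<phi> (- \<Lambda>)) \<theta>)) \<partial>Q)"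

definition partition_function ::
  "('d, 'm) marked set measure \<Rightarrow> ('d::finite, 'm, 'p::finite) stat \<Rightarrow> real ^ 'p \<Rightarrow>
   (real ^ 'd) set \<Rightarrow> ('d, 'm) marked set \<Rightarrow> ennreal" where
  "partition_function Q v \<theta> \<Lambda> \<phi> = gibbs_weight Q v \<theta> \<Lambda> \<phi> UNIV"

(* The last clause says that the normalised weight is a regular conditional law of
   phi_Lambda given phi_{Lambda^c}. *)
definition gibbs_measure ::
  "'m measure \<Rightarrow> ('d, 'm) marked set measure \<Rightarrow> ('d::finite, 'm, 'p::finite) stat \<Rightarrow> real ^ 'p \<Rightarrow>
   ('d, 'm) marked set measure \<Rightarrow> bool" where
  "gibbs_measure M Q v \<theta> P \<longleftrightarrow>
     prob_space P \<and> sets P = sets (configs M) \<and>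
     (\<forall>\<Lambda>. bounded_borel \<Lambda> \<longrightarrow>
        (AE \<phi> in P. 0 < partition_function Q v \<theta> \<Lambda> \<phi> \<and> partition_function Q v \<theta> \<Lambda> \<phi> < \<infinity>) \<and>
        (\<forall>A \<in> sets (configs M). \<forall>B \<in> sets (configs M).
           emeasure P {\<phi> \<in> space P. restr \<phi> \<Lambda> \<in> A \<and> restr \<phi> (- \<Lambda>) \<in> B} =
           (\<integral>\<^sup>+ \<phi>. indicator B (restr \<phi> (- \<Lambda>)) *
              (gibbs_weight Q v \<theta> \<Lambda> \<phi> A / partition_function Q v \<theta> \<Lambda> \<phi>) \<partial>P)))"

definition stationary ::
  "'m measure \<Rightarrow> ('d::finite, 'm) marked set measure \<Rightarrow> bool" where
  "stationary M P \<longleftrightarrow> (\<forall>y. distr P (configs M) (translate y) = P)"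

definition unif_ball :: "real ^ 'd::finite \<Rightarrow> real \<Rightarrow> (real ^ 'd) set" where
  "unif_ball x r = {y. infnorm (y - x) < r}"

definition exp_condition ::
  "'m measure \<Rightarrow> (real ^ 'p) set \<Rightarrow> ('d::finite, 'm, 'p::finite) stat \<Rightarrow> real \<Rightarrow> bool" where
  "exp_condition M \<Theta> v D \<longleftrightarrow>
     (\<forall>i. \<exists>\<kappa>inf \<kappa>sup :: real. \<exists>k :: nat. 0 \<le> \<kappa>inf \<and> 0 \<le> \<kappa>sup \<and>
        ((\<forall>\<theta>\<in>\<Theta>. 0 \<le> \<theta> $ i) \<and>
         (\<forall>m \<in> space M. \<forall>\<phi> \<in> space (configs M).
            - \<kappa>inf \<le> local_stat v (0, m) \<phi> $ i \<and>
            local_stat v (0, m) \<phi> $ i = local_stat v (0, m) (restr \<phi> (unif_ball 0 D)) $ i \<and>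
            local_stat v (0, m) \<phi> $ i \<le> \<kappa>sup * real (card (restr \<phi> (unif_ball 0 D))) ^ k)
       \<or>
         (\<forall>m \<in> space M. \<forall>\<phi> \<in> space (configs M).
            - \<kappa>inf \<le> local_stat v (0, m) \<phi> $ i \<and>
            local_stat v (0, m) \<phi> $ i = local_stat v (0, m) (restr \<phi> (unif_ball 0 D)) $ i \<and>
            local_stat v (0, m) \<phi> $ i \<le> \<kappa>sup)))"

type_synonym ('d, 'm, 'p) test_fun =
  "('d, 'm) marked \<Rightarrow> ('d, 'm) marked set \<Rightarrow> real ^ 'p \<Rightarrow> real"

(* The completion matters only for mark spaces that do not separate points: there
   x^m |-> insert x^m phi is measurable only off the null set of locations used by phi. *)
definition innovation ::
  "'m measure \<Rightarrow> ('d::finite, 'm, 'p::finite) stat \<Rightarrow> ('d, 'm, 'p) test_fun \<Rightarrow> real ^ 'p \<Rightarrow>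
   (real ^ 'd) set \<Rightarrow> ('d, 'm) marked set \<Rightarrow> real" where
  "innovation M v h \<theta> \<Lambda> \<phi> =
     (LINT z : \<Lambda> \<times> space M | completion (mu M). h z \<phi> \<theta> * exp (- local_energy v z \<phi> \<theta>))
     - (\<Sum>z \<in> restr \<phi> \<Lambda>. h z (\<phi> - {z}) \<theta>)"

definition raw_test :: "('d, 'm, 'p) test_fun" where
  "raw_test z \<phi> \<theta> = 1"

definition pearson_test :: "('d, 'm, 'p::finite) stat \<Rightarrow> ('d, 'm, 'p) test_fun" where
  "pearson_test v z \<phi> \<theta> = exp (local_energy v z \<phi> \<theta> / 2)"

definition inverse_test :: "('d, 'm, 'p::finite) stat \<Rightarrow> ('d, 'm, 'p) test_fun" where
  "inverse_test v z \<phi> \<theta> = exp (local_energy v z \<phi> \<theta>)"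

definition lattice_vec :: "int ^ 'd \<Rightarrow> real ^ 'd" where
  "lattice_vec k = (\<chi> i. real_of_int (k $ i))"

(* Half-open, so that the cubes tile the space. *)
definition cube :: "real \<Rightarrow> int ^ 'd \<Rightarrow> (real ^ 'd) set" where
  "cube D k = {x. \<forall>i. (D *\<^sub>R lattice_vec k) $ i - D / 2 \<le> x $ i \<and>
                      x $ i < (D *\<^sub>R lattice_vec k) $ i + D / 2}"

definition unit_neighbours :: "(int ^ 'd::finite) set" where
  "unit_neighbours = {k. infnorm (lattice_vec k) \<le> 1}"

(* The expectation of X in the extended reals, meaningful when the negative part of X is
   integrable.  Under (Exp) the local energy may grow like a power of the number of
   neighbours, so the innovations of inverse_test can have infinite variance, which a
   Bochner integral would report as 0. *)
definition ext_expectation :: "'a measure \<Rightarrow> ('a \<Rightarrow> real) \<Rightarrow> ereal" where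
  "ext_expectation P X =
     enn2ereal (\<integral>\<^sup>+ \<omega>. ennreal (X \<omega>) \<partial>P) - enn2ereal (\<integral>\<^sup>+ \<omega>. ennreal (- X \<omega>) \<partial>P)"

definition innovation_product ::
  "'m measure \<Rightarrow> ('d::finite, 'm, 'p::finite) stat \<Rightarrow> real \<Rightarrow> ('d, 'm, 'p) test_fun \<Rightarrow> real ^ 'p \<Rightarrow>
   int ^ 'd \<Rightarrow> ('d, 'm) marked set \<Rightarrow> real" where
  "innovation_product M v D h \<theta> k \<phi> =
     innovation M v h \<theta> (cube D 0) \<phi> * innovation M v h \<theta> (cube D k) \<phi>"

definition lambda_Inn ::
  "'m measure \<Rightarrow> ('d::finite, 'm, 'p::finite) stat \<Rightarrow> real \<Rightarrow> ('d, 'm) marked set measure \<Rightarrow>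
   ('d, 'm, 'p) test_fun \<Rightarrow> real ^ 'p \<Rightarrow> ereal" where
  "lambda_Inn M v D P h \<theta> =
     ereal (1 / D ^ CARD('d)) *
     (\<Sum>k \<in> unit_neighbours. ext_expectation P (innovation_product M v D h \<theta> k))"

lemma ext_expectation_eq_integral:
  assumes "integrable P X"
  shows "ext_expectation P X = ereal (integral\<^sup>L P X)"
proof -
  have fin: "(\<integral>\<^sup>+ \<omega>. ennreal (X \<omega>) \<partial>P) \<noteq> \<infinity>" "(\<integral>\<^sup>+ \<omega>. ennreal (- X \<omega>) \<partial>P) \<noteq> \<infinity>"
    using assms by (auto simp: real_integrable_def)
  have enn: "enn2ereal a = ereal (enn2real a)" if "a \<noteq> \<infinity>" for a
    using that by (cases a) (auto simp: enn2ereal_ennreal)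
  show ?thesis
    unfolding ext_expectation_def real_lebesgue_integral_def[OF assms] enn[OF fin(1)] enn[OF fin(2)]
    by simp
qed

lemma finite_unit_neighbours: "finite (unit_neighbours :: (int ^ 'd::finite) set)"
proof -
  have "unit_neighbours \<subseteq> (\<lambda>f. \<chi> i. f i) ` (UNIV \<rightarrow>\<^sub>E {-1, 0, 1} :: ('d \<Rightarrow> int) set)"
  proof
    fix k :: "int ^ 'd" assume "k \<in> unit_neighbours"
    then have "\<bar>lattice_vec k \<bullet> axis i 1\<bar> \<le> 1" for i
      using Basis_le_infnorm[of "axis i 1" "lattice_vec k"]
      by (fastforce simp: unit_neighbours_def axis_in_Basis_iff)
    then have "\<bar>real_of_int (k $ i)\<bar> \<le> 1" for i
      by (simp add: lattice_vec_def inner_axis)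
    then have "\<bar>k $ i\<bar> \<le> 1" for i
      by (metis of_int_abs of_int_le_1_iff)
    then have "k $ i \<in> {-1, 0, 1}" for i
      by (smt (verit) insertCI)
    then have "(\<lambda>i. k $ i) \<in> (UNIV \<rightarrow>\<^sub>E {-1, 0, 1} :: ('d \<Rightarrow> int) set)"
      by (auto simp: PiE_def extensional_def)
    then show "k \<in> (\<lambda>f. \<chi> i. f i) ` (UNIV \<rightarrow>\<^sub>E {-1, 0, 1} :: ('d \<Rightarrow> int) set)"
      by (rule rev_image_eqI) simp
  qed
  then show ?thesis
    by (rule finite_subset) (intro finite_imageI finite_PiE, auto)
qed

lemma space_configs:
  "space (configs M) =
     {\<phi>. \<phi> \<subseteq> UNIV \<times> space M \<and> (\<forall>\<Lambda>. bounded \<Lambda> \<longrightarrow> finite (restr \<phi> \<Lambda>))}"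
  by (simp add: configs_def Let_def space_measure_of_conv)

lemma local_stat_eq:
  fixes v :: "('d::finite, 'm, 'p::finite) stat"
  assumes fam: "exponential_family M \<Theta> v" and int: "\<theta>s \<in> interior \<Theta>"
    and \<Lambda>: "bounded_borel \<Lambda>" "x \<in> \<Lambda>" and m: "m \<in> space M" and \<phi>: "\<phi> \<in> space (configs M)"
  shows "local_stat v (x, m) \<phi> = v \<Lambda> (insert (x, m) \<phi>) - v \<Lambda> \<phi>"
proof -
  let ?w = "local_stat v (x, m) \<phi> - (v \<Lambda> (insert (x, m) \<phi>) - v \<Lambda> \<phi>)"
  have ins: "insert (x, m) \<phi> \<in> space (configs M)"
    using \<phi> m by (auto simp: space_configs restr_def Int_insert_left)
  have orth: "\<theta> \<bullet> ?w = 0" if \<theta>: "\<theta> \<in> \<Theta>" for \<theta>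
  proof -
    have "bounded_borel {x}" "{x} \<subseteq> \<Lambda>"
      using \<Lambda> by (auto simp: bounded_borel_def)
    then obtain f where f: "\<forall>\<psi> \<in> space (configs M).
        energy v \<Lambda> \<psi> \<theta> - energy v {x} \<psi> \<theta> = f (restr \<psi> (- {x}))"
      using fam \<theta> \<Lambda>(1) unfolding exponential_family_def compatible_energy_def by blast
    have "restr (insert (x, m) \<phi>) (- {x}) = restr \<phi> (- {x})"
      by (auto simp: restr_def)
    then have "energy v \<Lambda> (insert (x, m) \<phi>) \<theta> - energy v {x} (insert (x, m) \<phi>) \<theta>
             = energy v \<Lambda> \<phi> \<theta> - energy v {x} \<phi> \<theta>"
      using f \<phi> ins by simp
    then show ?thesis
      by (simp add: energy_def local_stat_def inner_diff_right)
  qed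
  obtain e where e: "e > 0" "cball \<theta>s e \<subseteq> \<Theta>"
    using int by (auto simp: mem_interior_cball)
  have "?w = 0"
  proof (rule ccontr)
    assume nz: "?w \<noteq> 0"
    define \<theta> where "\<theta> = \<theta>s + (e / norm ?w) *\<^sub>R ?w"
    have "dist \<theta>s \<theta> = e"
      using nz e(1) by (simp add: \<theta>_def dist_norm)
    then have "\<theta> \<in> \<Theta>" "\<theta>s \<in> \<Theta>"
      using e by auto
    then have "\<theta> \<bullet> ?w = 0" "\<theta>s \<bullet> ?w = 0"
      using orth by blast+
    then have "(e / norm ?w) * (?w \<bullet> ?w) = 0"
      by (simp add: \<theta>_def inner_add_left)
    then show False
      using nz e(1) by simp
  qed
  then show ?thesis by simp
qed

end

theory Submission
  imports Defs
begin

text \<open>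
  All three test functions have the form \<open>h = exp (c V)\<close> with \<open>c\<close> in \<open>{0, 1/2, 1}\<close>. Condition (Exp)
  gives \<open>V \<ge> - K\<close> and the finite range \<open>D\<close>. The Mecke formula for the Poisson process and the
  equilibrium equations yield the Georgii--Nguyen--Zessin formula; hence the innovation \<open>I\<close> of a
  cube is orthogonal to every functional of the configuration outside that cube. Consequently
  correlations of \<open>I\<close> and its lattice translates vanish beyond nearest neighbours.

  If \<open>I\<close> is not square integrable, the diagonal term is infinite. Otherwise let \<open>Y\<close> be the functional
  \<open>\<alpha> n\<close> on the event that the cube and the shell around it are empty, \<open>- \<alpha> 0\<close> on the event that the
  shell is empty and the cube has \<open>n\<close> points, and \<open>0\<close> elsewhere. The weights \<open>\<alpha>\<close> make \<open>Y\<close>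
  orthogonal to the exterior as well, so for every real \<open>s\<close> the field generated by \<open>I - s Y\<close> has
  finite range and the lattice sum of its covariances is nonnegative. This sum is
  \<open>\<lambda> - 2 s T + O(s^2)\<close>, where \<open>\<lambda>\<close> is the lattice sum for \<open>I\<close> and \<open>T\<close> is the covariance of \<open>Y\<close>
  with the sum of the innovations of the neighbouring cubes. For large \<open>n\<close> the sum of the
  innovations is negative on the second event (each point contributes at least \<open>exp (- c K)\<close>), and
  it is nonnegative on the first. Hence \<open>T > 0\<close> and \<open>\<lambda> > 0\<close>.
\<close>



section \<open>Configurations\<close>

text \<open>Finite range alone makes the lattice sum, a limit of variances per unit volume,
  nonnegative; it could still vanish. Strictness comes from the perturbation: a polynomial in s that
  is nonnegative for all s and has a nonzero linear coefficient has a positive constant term. So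
  \<open>Y\<close> must be orthogonal to the exterior and yet correlated with the innovations near
  the cube. The shell has thickness D, the interaction range; when it is empty the cube does not
  interact with the exterior, which makes the ratio of \<open>\<alpha> n\<close> to
  \<open>\<alpha> 0\<close> deterministic. The only quantitative input is V \<ge> - K. The
  compensating integrand exp ((c - 1) V) is bounded because c \<le> 1, and each point contributes
  exp (c V), bounded below because c \<ge> 0. V may grow with the configuration, so square
  integrability is proved for c \<le> 1/2 only; hence the case split. The technical obstacle is
  measurability: V uses a region that moves with the point, and inserting a point is measurable only
  at vacant locations. The innovation is therefore replaced by a measurable version
  \<open>J\<close>; the two agree almost surely because almost surely no two points share a
  location.\<close>

lemma space_mu: "space (mu M) = UNIV \<times> space M"
  by (simp add: mu_def space_pair_measure)

lemma sets_mu [measurable_cong]: "sets (mu M) = sets (borel \<Otimes>\<^sub>M M)"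
  unfolding mu_def by (rule sets_pair_measure_cong) simp_all

text \<open>The sets whose counts generate \<open>configs M\<close>. A configuration meets each of
  them in finitely many points, so \<open>card\<close> is the true count.\<close>

definition bdd_sets :: "'m measure \<Rightarrow> ('d::finite, 'm) marked set set" where
  "bdd_sets M = {B \<in> sets (mu M). bounded (fst ` B)}"

lemma bdd_setsD: "B \<in> bdd_sets M \<Longrightarrow> B \<in> sets (mu M)" "B \<in> bdd_sets M \<Longrightarrow> bounded (fst ` B)"
  by (auto simp: bdd_sets_def)

lemma bdd_sets_Int: "B \<in> bdd_sets M \<Longrightarrow> A \<in> sets (mu M) \<Longrightarrow> B \<inter> A \<in> bdd_sets M"
  unfolding bdd_sets_def using bounded_subset[OF _ image_mono[OF Int_lower1]] by blast

lemma bdd_sets_Diff: "B \<in> bdd_sets M \<Longrightarrow> A \<in> sets (mu M) \<Longrightarrow> B - A \<in> bdd_sets M"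
  unfolding bdd_sets_def using bounded_subset[OF _ image_mono[OF Diff_subset]] by blast

lemma bdd_sets_Times: "bounded_borel \<Lambda> \<Longrightarrow> \<Lambda> \<times> space M \<in> bdd_sets M"
  using bounded_subset[of \<Lambda> "fst ` (\<Lambda> \<times> space M)"]
  by (auto simp: bdd_sets_def bounded_borel_def mu_def)

lemma finite_config_Int:
  assumes "\<phi> \<in> space (configs M)" "bounded (fst ` B)"
  shows "finite (\<phi> \<inter> B)"
proof -
  have "finite (restr \<phi> (fst ` B))"
    using assms by (simp add: space_configs)
  moreover have "\<phi> \<inter> B \<subseteq> restr \<phi> (fst ` B)"
    by (auto simp: restr_def image_iff) force
  ultimately show ?thesis
    by (rule finite_subset[rotated])
qed

lemma config_subset: "\<phi> \<in> space (configs M) \<Longrightarrow> \<phi> \<subseteq> UNIV \<times> space M"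
  by (simp add: space_configs)

lemma config_mono: "\<phi> \<in> space (configs M) \<Longrightarrow> \<psi> \<subseteq> \<phi> \<Longrightarrow> \<psi> \<in> space (configs M)"
  by (auto simp: space_configs restr_def elim!: finite_subset[rotated])

lemma config_Un: "\<phi> \<in> space (configs M) \<Longrightarrow> \<psi> \<in> space (configs M) \<Longrightarrow> \<phi> \<union> \<psi> \<in> space (configs M)"
  unfolding space_configs restr_def by (auto simp: Int_Un_distrib2)

lemma config_empty: "{} \<in> space (configs M)"
  by (simp add: space_configs restr_def)

lemma config_insert: "\<phi> \<in> space (configs M) \<Longrightarrow> snd z \<in> space M \<Longrightarrow> insert z \<phi> \<in> space (configs M)"
  by (cases z) (auto simp: space_configs restr_def Int_insert_left)

lemma config_restr: "\<phi> \<in> space (configs M) \<Longrightarrow> restr \<phi> \<Lambda> \<in> space (configs M)"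
  by (erule config_mono) (auto simp: restr_def)

lemma configs_eq_sigma:
  "configs M = sigma (space (configs M))
     {{\<phi> \<in> space (configs M). card (\<phi> \<inter> B) = n} | (B :: ('d::finite, 'm) marked set) n.
        B \<in> sets (mu M) \<and> bounded (fst ` B)}"
  unfolding space_configs by (simp add: configs_def Let_def)

lemma sets_configs:
  "sets (configs M) = sigma_sets (space (configs M))
     {{\<phi> \<in> space (configs M). card (\<phi> \<inter> B) = n} | (B :: ('d::finite, 'm) marked set) n.
        B \<in> sets (mu M) \<and> bounded (fst ` B)}"
  by (subst configs_eq_sigma, rule sets_measure_of) auto

text \<open>Level sets of counts generate the sigma-algebra. Each operation on configurations below
  is therefore shown measurable by computing how it changes the counts.\<close>

lemma measurable_configsI:
  fixes f :: "'a \<Rightarrow> ('d::finite, 'm) marked set"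
  assumes "\<And>x. x \<in> space N \<Longrightarrow> f x \<in> space (configs M)"
    and "\<And>B. B \<in> bdd_sets M \<Longrightarrow> (\<lambda>x. card (f x \<inter> B)) \<in> measurable N (count_space UNIV)"
  shows "f \<in> measurable N (configs M)"
proof -
  let ?G = "{{\<phi> \<in> space (configs M). card (\<phi> \<inter> B) = n} | (B :: ('d, 'm) marked set) n. B \<in> sets (mu M) \<and> bounded (fst ` B)}"
  have "f \<in> measurable N (sigma (space (configs M)) ?G)"
  proof (rule measurable_measure_of)
    fix y assume "y \<in> ?G"
    then obtain B n where B: "B \<in> bdd_sets M" "y = {\<phi> \<in> space (configs M). card (\<phi> \<inter> B) = n}"
      by (auto simp: bdd_sets_def)
    have "f -` y \<inter> space N = (\<lambda>x. card (f x \<inter> B)) -` {n} \<inter> space N"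
      using assms(1) B(2) by auto
    also have "\<dots> \<in> sets N"
      by (rule measurable_sets[OF assms(2)[OF B(1)]]) simp
    finally show "f -` y \<inter> space N \<in> sets N" .
  qed (use assms(1) in auto)
  then show ?thesis by (subst configs_eq_sigma)
qed

lemma measurable_card:
  fixes B :: "('d::finite, 'm) marked set"
  assumes "B \<in> bdd_sets M"
  shows "(\<lambda>\<phi>. card (\<phi> \<inter> B)) \<in> measurable (configs M) (count_space UNIV)"
proof (rule measurable_count_space_eq2_countable[THEN iffD2], intro conjI ballI)
  fix n :: nat
  let ?G = "{{\<phi> \<in> space (configs M). card (\<phi> \<inter> B) = n} | (B :: ('d, 'm) marked set) n. B \<in> sets (mu M) \<and> bounded (fst ` B)}"
  have "{\<phi> \<in> space (configs M). card (\<phi> \<inter> B) = n} \<in> ?G"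
    using assms by (auto simp: bdd_sets_def)
  then have "{\<phi> \<in> space (configs M). card (\<phi> \<inter> B) = n} \<in> sets (configs M)"
    unfolding sets_configs by (rule sigma_sets.Basic)
  then show "(\<lambda>\<phi>. card (\<phi> \<inter> B)) -` {n} \<inter> space (configs M) \<in> sets (configs M)"
    by (simp add: vimage_def Int_def conj_commute)
qed auto

lemma measurable_card' [measurable (raw)]:
  assumes "f \<in> measurable N (configs M)" "B \<in> bdd_sets M"
  shows "(\<lambda>x. card (f x \<inter> B)) \<in> measurable N (count_space UNIV)"
  by (rule measurable_compose[OF assms(1) measurable_card[OF assms(2)]])

lemma Times_UNIV_sets: "\<Lambda> \<in> sets borel \<Longrightarrow> \<Lambda> \<times> space M \<in> sets (mu M)"
  by (simp add: mu_def)

lemma card_restr_Int: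
  assumes "\<phi> \<in> space (configs M)"
  shows "restr \<phi> \<Lambda> \<inter> B = \<phi> \<inter> (B \<inter> \<Lambda> \<times> space M)"
  using config_subset[OF assms] by (auto simp: restr_def)

lemma measurable_restr [measurable]:
  fixes M :: "'m measure" and \<Lambda> :: "(real ^ 'd::finite) set"
  assumes \<Lambda>: "\<Lambda> \<in> sets borel"
  shows "(\<lambda>\<phi>. restr \<phi> \<Lambda>) \<in> measurable (configs M) (configs M)"
proof (rule measurable_configsI)
  fix B :: "('d, 'm) marked set" assume B: "B \<in> bdd_sets M"
  have "(\<lambda>\<phi>. card (\<phi> \<inter> (B \<inter> \<Lambda> \<times> space M))) \<in> measurable (configs M) (count_space UNIV)"
    by (intro measurable_card bdd_sets_Int B Times_UNIV_sets \<Lambda>)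
  then show "(\<lambda>\<phi>. card (restr \<phi> \<Lambda> \<inter> B)) \<in> measurable (configs M) (count_space UNIV)"
    by (subst measurable_cong[OF arg_cong[where f=card, OF card_restr_Int]])
qed (rule config_restr)

text \<open>The two pieces lie over disjoint regions, so their counts add. Both arguments vary at
  once, as they must for conditional laws of the inside given the outside.\<close>

lemma measurable_glue:
  fixes f g :: "'a \<Rightarrow> ('d::finite, 'm) marked set"
  assumes f: "f \<in> measurable N (configs M)" and g: "g \<in> measurable N (configs M)"
    and \<Lambda>: "\<Lambda> \<in> sets borel"
  shows "(\<lambda>x. restr (f x) \<Lambda> \<union> restr (g x) (- \<Lambda>)) \<in> measurable N (configs M)"
proof (rule measurable_configsI)
  fix x assume "x \<in> space N"
  then show "restr (f x) \<Lambda> \<union> restr (g x) (- \<Lambda>) \<in> space (configs M)"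
    by (intro config_Un config_restr measurable_space[OF f] measurable_space[OF g])
next
  fix B :: "('d, 'm) marked set" assume B: "B \<in> bdd_sets M"
  have eq: "card ((restr (f x) \<Lambda> \<union> restr (g x) (- \<Lambda>)) \<inter> B)
      = card (restr (f x) \<Lambda> \<inter> B) + card (restr (g x) (- \<Lambda>) \<inter> B)" if "x \<in> space N" for x
    unfolding Int_Un_distrib2
    using that measurable_space[OF f] measurable_space[OF g]
    by (intro card_Un_disjoint finite_config_Int[where M=M] bdd_setsD(2)[OF B] config_restr)
      (auto simp: restr_def)
  have "(\<lambda>x. card (restr (f x) \<Lambda> \<inter> B) + card (restr (g x) (- \<Lambda>) \<inter> B)) \<in> measurable N (count_space UNIV)"
    using f g B \<Lambda> by measurable
  then show "(\<lambda>x. card ((restr (f x) \<Lambda> \<union> restr (g x) (- \<Lambda>)) \<inter> B)) \<in> measurable N (count_space UNIV)"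
    by (subst measurable_cong[OF eq])
qed

lemma restr_glue: "\<phi> = restr \<phi> \<Lambda> \<union> restr \<phi> (- \<Lambda>)"
  by (auto simp: restr_def)

subsection \<open>Translations\<close>

lemma mem_translate: "(x, m) \<in> translate y \<phi> \<longleftrightarrow> (x - y, m) \<in> \<phi>"
  by (force simp: translate_def image_iff)

lemma translate_translate: "translate x (translate y \<phi>) = translate (x + y) \<phi>"
  by (auto simp: mem_translate algebra_simps)

lemma translate_0 [simp]: "translate 0 \<phi> = \<phi>"
  by (auto simp: mem_translate)

lemma translate_insert: "translate y (insert (x, m) \<phi>) = insert (x + y, m) (translate y \<phi>)"
  by (simp add: translate_def)

lemma restr_translate: "restr (translate y \<phi>) \<Lambda> = translate y (restr \<phi> ((\<lambda>x. x - y) ` \<Lambda>))"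
  by (auto simp: restr_def mem_translate)

lemma card_translate: "card (translate y \<phi>) = card \<phi>"
  unfolding translate_def by (rule card_image) (auto simp: inj_on_def)

lemma translate_Int: "translate y \<phi> \<inter> B = translate y (\<phi> \<inter> translate (- y) B)"
  by (auto simp: mem_translate)

lemma config_translate:
  fixes \<phi> :: "('d::finite, 'm) marked set"
  assumes "\<phi> \<in> space (configs M)" shows "translate y \<phi> \<in> space (configs M)"
  unfolding space_configs
proof (intro CollectI conjI allI impI)
  show "translate y \<phi> \<subseteq> UNIV \<times> space M"
    using config_subset[OF assms] by (auto simp: mem_translate)
  fix \<Lambda> :: "(real ^ 'd) set" assume "bounded \<Lambda>"
  then have "bounded ((\<lambda>x. x - y) ` \<Lambda>)" by (rule bounded_translation_minus)
  then have "finite (restr \<phi> ((\<lambda>x. x - y) ` \<Lambda>))" using assms by (simp add: space_configs)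
  then show "finite (restr (translate y \<phi>) \<Lambda>)"
    unfolding restr_translate by (simp add: translate_def)
qed

lemma translate_sets: assumes "B \<in> sets (mu M)" shows "translate y B \<in> sets (mu M)"
proof -
  have "(\<lambda>z. (fst z - y, snd z)) \<in> measurable (mu M) (mu M)"
    by (measurable; simp add: sets_mu)
  then have "(\<lambda>z. (fst z - y, snd z)) -` B \<inter> space (mu M) \<in> sets (mu M)"
    using assms by (rule measurable_sets)
  also have "(\<lambda>z. (fst z - y, snd z)) -` B \<inter> space (mu M) = translate y B"
    using sets.sets_into_space[OF assms] by (auto simp: mem_translate space_mu)
  finally show ?thesis .
qed

lemma translate_bdd_sets: assumes "B \<in> bdd_sets M" shows "translate y B \<in> bdd_sets M"
proof -
  have "fst ` translate y B = (\<lambda>x. y + x) ` fst ` B"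
    by (force simp: translate_def image_iff)
  then show ?thesis
    using assms bounded_translation[of "fst ` B" y] by (simp add: bdd_sets_def translate_sets)
qed

lemma measurable_translate [measurable]:
  fixes M :: "'m measure"
  shows   "translate (y :: real ^ 'd::finite) \<in> measurable (configs M) (configs M)"
proof (rule measurable_configsI)
  fix B :: "('d, 'm) marked set" assume "B \<in> bdd_sets M"
  then show "(\<lambda>\<phi>. card (translate y \<phi> \<inter> B)) \<in> measurable (configs M) (count_space UNIV)"
    unfolding translate_Int card_translate by (intro measurable_card translate_bdd_sets)
qed (rule config_translate)


section \<open>Adding and removing points\<close>

text \<open>Local finiteness leaves finitely many locations in a unit ball around a vacant x;
  deleting them leaves an open neighbourhood of x, hence a bounded basic set with count zero.
  Occupation of a location thus becomes a condition on counts, without reference to individual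
  marks.\<close>

lemma location_iff:
  fixes \<phi> :: "('d::finite, 'm) marked set"
  assumes \<B>: "topological_basis \<B>" and \<phi>: "\<phi> \<in> space (configs M)"
  shows "x \<in> fst ` \<phi> \<longleftrightarrow> (\<forall>U\<in>{U\<in>\<B>. bounded U}. x \<in> U \<longrightarrow> card (\<phi> \<inter> U \<times> space M) \<noteq> 0)"
proof
  assume "x \<in> fst ` \<phi>"
  then obtain m where xm: "(x, m) \<in> \<phi>" by auto
  show "\<forall>U\<in>{U\<in>\<B>. bounded U}. x \<in> U \<longrightarrow> card (\<phi> \<inter> U \<times> space M) \<noteq> 0"
  proof (intro ballI impI)
    fix U assume U: "U \<in> {U\<in>\<B>. bounded U}" "x \<in> U"
    have "finite (\<phi> \<inter> U \<times> space M)"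
      using U(1) bounded_subset[of U "fst ` (U \<times> space M)"]
      by (intro finite_config_Int[OF \<phi>]) auto
    moreover have "(x, m) \<in> \<phi> \<inter> U \<times> space M"
      using xm U(2) config_subset[OF \<phi>] by auto
    ultimately show "card (\<phi> \<inter> U \<times> space M) \<noteq> 0"
      by (metis card_eq_0_iff empty_iff)
  qed
next
  assume R: "\<forall>U\<in>{U\<in>\<B>. bounded U}. x \<in> U \<longrightarrow> card (\<phi> \<inter> U \<times> space M) \<noteq> 0"
  show "x \<in> fst ` \<phi>"
  proof (rule ccontr)
    assume nx: "x \<notin> fst ` \<phi>"
    have fin: "finite (fst ` restr \<phi> (ball x 1))"
      using \<phi> by (simp add: space_configs)
    have "open (ball x 1 - fst ` restr \<phi> (ball x 1))"
      by (intro open_Diff open_ball finite_imp_closed fin)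
    moreover have "x \<in> ball x 1 - fst ` restr \<phi> (ball x 1)"
      using nx by (auto simp: restr_def)
    ultimately obtain U where U: "U \<in> \<B>" "x \<in> U" "U \<subseteq> ball x 1 - fst ` restr \<phi> (ball x 1)"
      using \<B> by (metis topological_basisE)
    have "bounded U"
      using U(3) bounded_subset[OF bounded_ball] by blast
    moreover have "\<phi> \<inter> U \<times> space M = {}"
      using U(3) by (force simp: restr_def)
    ultimately show False
      using R U by (metis (mono_tags, lifting) card.empty mem_Collect_eq)
  qed
qed

text \<open>With a countable basis the criterion by counts is a countable intersection, and the
  location itself may vary measurably.\<close>

lemma measurable_location:
  fixes f :: "'a \<Rightarrow> ('d::finite, 'm) marked" and g :: "'a \<Rightarrow> ('d, 'm) marked set"
  assumes f: "f \<in> measurable N (mu M)" and g: "g \<in> measurable N (configs M)"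
  shows "Measurable.pred N (\<lambda>x. fst (f x) \<in> fst ` g x)"
proof -
  obtain \<B> :: "(real ^ 'd) set set" where \<B>: "countable \<B>" "topological_basis \<B>"
    using ex_countable_basis by blast
  have [measurable]: "(\<lambda>x. fst (f x)) \<in> borel_measurable N"
    using measurable_compose[OF f, of fst borel] by (simp add: sets_mu cong: measurable_cong_sets)
  have "Measurable.pred N (\<lambda>x. \<forall>U\<in>{U\<in>\<B>. bounded U}. fst (f x) \<in> U \<longrightarrow> card (g x \<inter> U \<times> space M) \<noteq> 0)"
    unfolding pred_def
  proof (rule sets.sets_Collect_countable_All'[rotated])
    show "countable {U \<in> \<B>. bounded U}" using \<B>(1) by auto
    fix U assume U: "U \<in> {U \<in> \<B>. bounded U}"
    then have "open U" using \<B>(2) topological_basis_open by blast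
    then have [measurable]: "U \<in> sets borel" by simp
    have "U \<times> space M \<in> bdd_sets M"
      using U \<open>open U\<close> by (intro bdd_sets_Times) (auto simp: bounded_borel_def)
    from measurable_card'[OF g this]
    have [measurable]: "(\<lambda>x. card (g x \<inter> U \<times> space M)) \<in> measurable N (count_space UNIV)" .
    show "{x \<in> space N. fst (f x) \<in> U \<longrightarrow> card (g x \<inter> U \<times> space M) \<noteq> 0} \<in> sets N"
      by measurable
  qed
  then show ?thesis
    by (subst measurable_cong[OF location_iff[OF \<B>(2) measurable_space[OF g]]])
qed

text \<open>Adding a point at an occupied location is not a measurable operation when the mark space
  does not separate points; there the configuration is left unchanged instead.\<close>

definition add_point :: "('d, 'm) marked \<Rightarrow> ('d, 'm) marked set \<Rightarrow> ('d, 'm) marked set" where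
  "add_point z \<phi> = (if fst z \<in> fst ` \<phi> then \<phi> else insert z \<phi>)"

lemma add_point_eq: "fst z \<notin> fst ` \<phi> \<Longrightarrow> add_point z \<phi> = insert z \<phi>"
  by (simp add: add_point_def)

lemma config_add_point:
  "\<phi> \<in> space (configs M) \<Longrightarrow> z \<in> space (mu M) \<Longrightarrow> add_point z \<phi> \<in> space (configs M)"
  by (auto simp: add_point_def space_mu intro: config_insert)

text \<open>The count of B rises by one exactly when the new point lies in B and its location is
  vacant; both conditions are measurable.\<close>

lemma measurable_add_point:
  fixes f :: "'a \<Rightarrow> ('d::finite, 'm) marked" and g :: "'a \<Rightarrow> ('d, 'm) marked set"
  assumes f: "f \<in> measurable N (mu M)" and g: "g \<in> measurable N (configs M)"
  shows "(\<lambda>x. add_point (f x) (g x)) \<in> measurable N (configs M)"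
proof (rule measurable_configsI)
  fix x assume "x \<in> space N"
  then show "add_point (f x) (g x) \<in> space (configs M)"
    by (intro config_add_point measurable_space[OF f] measurable_space[OF g])
next
  fix B :: "('d, 'm) marked set" assume B: "B \<in> bdd_sets M"
  have eq: "card (add_point (f x) (g x) \<inter> B)
    = card (g x \<inter> B) + (if f x \<in> B \<and> fst (f x) \<notin> fst ` g x then 1 else 0)" if "x \<in> space N" for x
  proof -
    have "finite (g x \<inter> B)"
      using finite_config_Int[OF measurable_space[OF g that] bdd_setsD(2)[OF B]] .
    then show ?thesis
      by (force simp: add_point_def Int_insert_left card_insert_if)
  qed
  note [measurable] = measurable_card'[OF g B] measurable_location[OF f g]
  have [measurable]: "Measurable.pred N (\<lambda>x. f x \<in> B)"
    using measurable_sets[OF f bdd_setsD(1)[OF B]] by (simp add: pred_def vimage_def Int_def conj_commute)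
  have "(\<lambda>x. card (g x \<inter> B) + (if f x \<in> B \<and> fst (f x) \<notin> fst ` g x then 1 else 0)) \<in> measurable N (count_space UNIV)"
    by measurable
  then show "(\<lambda>x. card (add_point (f x) (g x) \<inter> B)) \<in> measurable N (count_space UNIV)"
    by (subst measurable_cong[OF eq])
qed

lemma countable_config:
  assumes "\<phi> \<in> space (configs M)" shows "countable \<phi>"
proof -
  have "\<phi> = (\<Union>n::nat. restr \<phi> (ball 0 (real n)))"
    using reals_Archimedean2 by (force simp: restr_def)
  moreover have "countable (restr \<phi> (ball 0 (real n)))" for n
    using assms by (intro countable_finite) (simp add: space_configs)
  ultimately show ?thesis
    by (metis countable_UN countableI_type)
qed

lemma sigma_finite_mu: assumes "prob_space M" shows "sigma_finite_measure (mu M)"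
proof -
  interpret prob_space M by fact
  interpret pair_sigma_finite lborel M ..
  show ?thesis unfolding mu_def by (rule P.sigma_finite_measure_axioms)
qed

text \<open>A configuration is countable, so its locations are Lebesgue null. For almost every z,
  \<open>add_point z \<phi>\<close> is therefore the true insertion.\<close>

lemma AE_not_location:
  fixes \<phi> :: "('d::finite, 'm) marked set"
  assumes M: "prob_space M" and \<phi>: "\<phi> \<in> space (configs M)"
  shows "AE z in mu M. fst z \<notin> fst ` \<phi>"
proof (rule AE_I')
  interpret M: prob_space M by fact
  have c: "countable (fst ` \<phi>)" using countable_config[OF \<phi>] by simp
  then have "emeasure lborel (fst ` \<phi>) = 0" "fst ` \<phi> \<in> sets lborel"
    by (auto simp: emeasure_lborel_countable intro: sets.countable)
  then show "(fst ` \<phi>) \<times> space M \<in> null_sets (mu M)"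
    by (simp add: mu_def null_sets_def M.emeasure_pair_measure_Times)
qed (force simp: space_mu)

section \<open>Cylinder events and induction over measurable sets of point-configuration
  pairs\<close>

definition cyl :: "'m measure \<Rightarrow> (('d::finite, 'm) marked set \<times> nat) list \<Rightarrow> ('d, 'm) marked set set" where
  "cyl M L = {\<phi> \<in> space (configs M). \<forall>(B, n)\<in>set L. card (\<phi> \<inter> B) = n}"

lemma cyl_Nil [simp]: "cyl M [] = space (configs M)"
  by (simp add: cyl_def)

lemma cyl_Cons: "cyl M ((B, n) # L) = {\<phi> \<in> cyl M L. card (\<phi> \<inter> B) = n}"
  by (auto simp: cyl_def)

lemma cyl_append: "cyl M (L @ L') = cyl M L \<inter> cyl M L'"
  by (auto simp only: cyl_def set_append ball_Un Int_iff mem_Collect_eq)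

lemma sets_cyl:
  assumes "fst ` set L \<subseteq> bdd_sets M" shows "cyl M L \<in> sets (configs M)"
  using assms
proof (induction L)
  case (Cons a L)
  obtain B n where a: "a = (B, n)" by force
  have [measurable]: "cyl M L \<in> sets (configs M)" "(\<lambda>\<phi>. card (\<phi> \<inter> B)) \<in> measurable (configs M) (count_space UNIV)"
    using Cons a by (auto intro: measurable_card)
  have "cyl M (a # L) = {\<phi> \<in> space (configs M). \<phi> \<in> cyl M L \<and> card (\<phi> \<inter> B) = n}"
    unfolding a cyl_Cons by (auto simp: cyl_def)
  also have "\<dots> \<in> sets (configs M)" by measurable
  finally show ?case .
qed simp

definition cyls :: "'m measure \<Rightarrow> ('d::finite, 'm) marked set set set" where
  "cyls M = {cyl M L | L. fst ` set L \<subseteq> bdd_sets M}"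

lemma sets_configs_cyls:
  "sets (configs M) = sigma_sets (space (configs M)) (cyls M :: ('d::finite, 'm) marked set set set)"
proof
  let ?G = "{{\<phi> \<in> space (configs M). card (\<phi> \<inter> B) = n} | (B :: ('d, 'm) marked set) n. B \<in> sets (mu M) \<and> bounded (fst ` B)}"
  have "sets (configs M) = sigma_sets (space (configs M)) ?G"
    by (rule sets_configs)
  also have "\<dots> \<subseteq> sigma_sets (space (configs M)) (cyls M)"
  proof (rule sigma_sets_mono', safe)
    fix B :: "('d, 'm) marked set" and n assume B: "B \<in> sets (mu M)" "bounded (fst ` B)"
    then have "{\<phi> \<in> space (configs M). card (\<phi> \<inter> B) = n} = cyl M [(B, n)]" "B \<in> bdd_sets M"
      by (auto simp: cyl_def bdd_sets_def)
    then show "{\<phi> \<in> space (configs M). card (\<phi> \<inter> B) = n} \<in> cyls M"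
      unfolding cyls_def by fastforce
  qed
  finally show "sets (configs M) \<subseteq> sigma_sets (space (configs M)) (cyls M :: ('d, 'm) marked set set set)" .
  show "sigma_sets (space (configs M)) (cyls M) \<subseteq> sets (configs M)"
    by (rule sets.sigma_sets_subset) (auto simp: cyls_def sets_cyl)
qed

lemma Int_stable_cyls: "Int_stable (cyls M :: ('d::finite, 'm) marked set set set)"
proof (rule Int_stableI)
  fix a b :: "('d, 'm) marked set set" assume "a \<in> cyls M" "b \<in> cyls M"
  then obtain L L' where "a = cyl M L" "b = cyl M L'" "fst ` set L \<subseteq> bdd_sets M" "fst ` set L' \<subseteq> bdd_sets M"
    by (auto simp: cyls_def)
  then have "a \<inter> b = cyl M (L @ L')" "fst ` set (L @ L') \<subseteq> bdd_sets M"
    by (auto simp: cyl_append)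
  then show "a \<inter> b \<in> cyls M" unfolding cyls_def by blast
qed


text \<open>Only the second factor is reduced to cylinders. Rectangles over generators generate the
  product sigma-algebra because each generator contains the whole space.\<close>

lemma sets_mu_configs:
  fixes M :: "'m measure"
  shows "sets (mu M \<Otimes>\<^sub>M configs M) = sigma_sets (space (mu M) \<times> space (configs M))
     {A \<times> F | (A :: ('d::finite, 'm) marked set) F. A \<in> sets (mu M) \<and> F \<in> (cyls M :: ('d, 'm) marked set set set)}" (is "_ = sigma_sets ?\<Omega> ?E")
proof -
  have "sets (mu M \<Otimes>\<^sub>M configs M)
      = sets (sigma (space (mu M)) (sets (mu M)) \<Otimes>\<^sub>M
              sigma (space (configs M)) (cyls M :: ('d, 'm) marked set set set))"
    by (rule sets_pair_measure_cong)
      (use sets.space_closed[of "mu M"] in \<open>auto simp: sets_configs_cyls sets_measure_of_conv sets.sigma_sets_eq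
        cyls_def cyl_def\<close>)
  also have "sigma (space (mu M)) (sets (mu M)) \<Otimes>\<^sub>M sigma (space (configs M)) (cyls M :: ('d, 'm) marked set set set)
      = sigma ?\<Omega> ?E"
  proof (rule sigma_prod)
    show "\<exists>E\<subseteq>sets (mu M). countable E \<and> space (mu M) = \<Union> E"
      by (rule exI[of _ "{space (mu M)}"]) auto
    have "space (configs M) \<in> (cyls M :: ('d, 'm) marked set set set)"
      by (auto simp: cyls_def intro: exI[of _ "[]"])
    then show "\<exists>E\<subseteq>(cyls M :: ('d, 'm) marked set set set). countable E \<and> space (configs M) = \<Union> E"
      by (intro exI[of _ "{space (configs M)}"]) auto
  qed (use sets.space_closed[of "mu M"] in \<open>auto simp: cyls_def cyl_def\<close>)
  also have "sets (sigma ?\<Omega> ?E) = sigma_sets ?\<Omega> ?E"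
    using sets.space_closed[of "mu M"] by (subst sets_measure_of) (auto simp: cyls_def cyl_def)
  finally show ?thesis .
qed

text \<open>Dynkin's theorem for the intersection-stable class of rectangles with a cylinder as
  second side. Both measurability of point sums and the Mecke formula are checked on these
  rectangles.\<close>

lemma mu_configs_induct [consumes 1, case_names rect compl union]:
  fixes S :: "(('d::finite, 'm) marked \<times> ('d, 'm) marked set) set"
  assumes S: "S \<in> sets (mu M \<Otimes>\<^sub>M configs M)"
    and rect: "\<And>A L. A \<in> sets (mu M) \<Longrightarrow> fst ` set L \<subseteq> bdd_sets M \<Longrightarrow> P (A \<times> cyl M L)"
    and compl: "\<And>S. S \<in> sets (mu M \<Otimes>\<^sub>M configs M) \<Longrightarrow> P S \<Longrightarrow> P (space (mu M) \<times> space (configs M) - S)"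
    and un: "\<And>A. disjoint_family A \<Longrightarrow> range A \<subseteq> sets (mu M \<Otimes>\<^sub>M configs M) \<Longrightarrow>
        (\<And>i. P (A i)) \<Longrightarrow> P (\<Union>i::nat. A i)"
  shows "P S"
proof -
  let ?\<Omega> = "space (mu M) \<times> space (configs M) :: (('d, 'm) marked \<times> ('d, 'm) marked set) set"
  let ?E = "{A \<times> F | (A :: ('d, 'm) marked set) F. A \<in> sets (mu M) \<and> F \<in> (cyls M :: ('d, 'm) marked set set set)}"
  have "Int_stable ?E"
  proof (rule Int_stableI)
    fix a b :: "(('d, 'm) marked \<times> ('d, 'm) marked set) set" assume "a \<in> ?E" "b \<in> ?E"
    then obtain A F A' F' where *: "a = A \<times> F" "b = A' \<times> F'" "A \<in> sets (mu M)" "A' \<in> sets (mu M)"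
      "F \<in> cyls M" "F' \<in> cyls M" by blast
    then have "F \<inter> F' \<in> cyls M" using Int_stableD[OF Int_stable_cyls] by blast
    moreover have "a \<inter> b = (A \<inter> A') \<times> (F \<inter> F')" using * by auto
    ultimately show "a \<inter> b \<in> ?E" using * by blast
  qed
  moreover have "?E \<subseteq> Pow ?\<Omega>"
    using sets.space_closed[of "mu M"] by (auto simp: cyls_def cyl_def)
  moreover have "S \<in> sigma_sets ?\<Omega> ?E"
    using S unfolding sets_mu_configs .
  ultimately show ?thesis
  proof (induction rule: sigma_sets_induct_disjoint)
    case empty
    show ?case using rect[of "{}" "[]"] by simp
  next
    case (basic A)
    then show ?case using rect by (auto simp: cyls_def)
  next
    case (compl A)
    then show ?case using assms(3) by (simp add: sets_mu_configs)
  next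
    case (union A)
    then show ?case using un by (simp add: sets_mu_configs)
  qed
qed

subsection \<open>Sums over the points of a configuration\<close>

text \<open>Removing z lowers the count of B' by one if z lies in B' and leaves it alone otherwise.
  Hence a constraint "B' has n points" on the reduced configuration becomes a constraint on \<phi>
  itself: n + 1 points for z in \<open>B \<inter> B'\<close>, n points for z in
  \<open>B - B'\<close>. Cylinders are lists of constraints to allow this induction, and B is
  arbitrary because each step splits it.\<close>

lemma measurable_sum_indicator_cyl:
  assumes "fst ` set L \<subseteq> bdd_sets M" "B \<in> bdd_sets M"
  shows "(\<lambda>\<phi>. \<Sum>z\<in>\<phi> \<inter> B. indicator (cyl M L) (\<phi> - {z}) :: ennreal) \<in> borel_measurable (configs M)"
  using assms
proof (induction L arbitrary: B)
  case Nil
  have "(\<Sum>z\<in>\<phi> \<inter> B. indicator (cyl M []) (\<phi> - {z}) :: ennreal) = of_nat (card (\<phi> \<inter> B))"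
    if "\<phi> \<in> space (configs M)" for \<phi>
  proof -
    have "\<phi> - {z} \<in> space (configs M)" for z using that by (rule config_mono) auto
    then show ?thesis by simp
  qed
  moreover have "(\<lambda>\<phi>. of_nat (card (\<phi> \<inter> B)) :: ennreal) \<in> borel_measurable (configs M)"
    using measurable_card[OF Nil(2)] by measurable
  ultimately show ?case
    by (subst measurable_cong)
next
  case (Cons a L)
  obtain B' n where a: "a = (B', n)" by force
  have B': "B' \<in> bdd_sets M" and L: "fst ` set L \<subseteq> bdd_sets M" using Cons(2) a by auto
  have I: "B \<inter> B' \<in> bdd_sets M" "B - B' \<in> bdd_sets M"
    using Cons(3) B' by (auto intro: bdd_sets_Int bdd_sets_Diff simp: bdd_setsD)
  let ?g = "\<lambda>B \<phi>. \<Sum>z\<in>\<phi> \<inter> B. indicator (cyl M L) (\<phi> - {z}) :: ennreal"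
  have "(\<Sum>z\<in>\<phi> \<inter> B. indicator (cyl M (a # L)) (\<phi> - {z}) :: ennreal) =
      (if card (\<phi> \<inter> B') = Suc n then ?g (B \<inter> B') \<phi> else 0) + (if card (\<phi> \<inter> B') = n then ?g (B - B') \<phi> else 0)"
    if \<phi>: "\<phi> \<in> space (configs M)" for \<phi>
  proof -
    have fin: "finite (\<phi> \<inter> B)" "finite (\<phi> \<inter> B')"
      using \<phi> B' Cons(3) by (auto intro!: finite_config_Int bdd_setsD)
    have fin': "finite (\<phi> \<inter> (B \<inter> B'))" "finite (\<phi> \<inter> (B - B'))"
      by (auto intro!: finite_subset[OF _ fin(1)])
    have disj: "\<phi> \<inter> (B \<inter> B') \<inter> (\<phi> \<inter> (B - B')) = {}" by auto
    have "\<phi> \<inter> B = (\<phi> \<inter> (B \<inter> B')) \<union> (\<phi> \<inter> (B - B'))" by auto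
    then have "(\<Sum>z\<in>\<phi> \<inter> B. indicator (cyl M (a # L)) (\<phi> - {z}) :: ennreal)
      = (\<Sum>z\<in>\<phi> \<inter> (B \<inter> B'). indicator (cyl M (a # L)) (\<phi> - {z})) + (\<Sum>z\<in>\<phi> \<inter> (B - B'). indicator (cyl M (a # L)) (\<phi> - {z}))"
      by (metis (no_types, lifting) sum.union_disjoint[OF fin' disj])
    also have "(\<Sum>z\<in>\<phi> \<inter> (B \<inter> B'). indicator (cyl M (a # L)) (\<phi> - {z}) :: ennreal)
        = (if card (\<phi> \<inter> B') = Suc n then ?g (B \<inter> B') \<phi> else 0)"
    proof -
      have "indicator (cyl M (a # L)) (\<phi> - {z}) =
          (if card (\<phi> \<inter> B') = Suc n then indicator (cyl M L) (\<phi> - {z}) else 0 :: ennreal)" if "z \<in> \<phi> \<inter> (B \<inter> B')" for z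
      proof -
        have "(\<phi> - {z}) \<inter> B' = (\<phi> \<inter> B') - {z}" by auto
        moreover have "z \<in> \<phi> \<inter> B'" using that by simp
        ultimately have "Suc (card ((\<phi> - {z}) \<inter> B')) = card (\<phi> \<inter> B')"
          using card.remove[OF fin(2), of z] by simp
        then have "card ((\<phi> - {z}) \<inter> B') = n \<longleftrightarrow> card (\<phi> \<inter> B') = Suc n" by linarith
        then show ?thesis by (simp add: a cyl_Cons indicator_def)
      qed
      then show ?thesis by simp
    qed
    also have "(\<Sum>z\<in>\<phi> \<inter> (B - B'). indicator (cyl M (a # L)) (\<phi> - {z}) :: ennreal)
        = (if card (\<phi> \<inter> B') = n then ?g (B - B') \<phi> else 0)"
    proof -
      have "indicator (cyl M (a # L)) (\<phi> - {z}) =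
          (if card (\<phi> \<inter> B') = n then indicator (cyl M L) (\<phi> - {z}) else 0 :: ennreal)" if "z \<in> \<phi> \<inter> (B - B')" for z
      proof -
        have "(\<phi> - {z}) \<inter> B' = \<phi> \<inter> B'" using that by auto
        then show ?thesis by (simp add: a cyl_Cons indicator_def)
      qed
      then show ?thesis by simp
    qed
    finally show ?thesis .
  qed
  moreover have "(\<lambda>\<phi>. (if card (\<phi> \<inter> B') = Suc n then ?g (B \<inter> B') \<phi> else 0)
      + (if card (\<phi> \<inter> B') = n then ?g (B - B') \<phi> else 0)) \<in> borel_measurable (configs M)"
    using measurable_card[OF B'] Cons(1)[OF L I(1)] Cons(1)[OF L I(2)] by measurable
  ultimately show ?case by (subst measurable_cong)
qed

text \<open>A monotone class argument from rectangles. Boundedness of B makes the sums of indicators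
  finite, so that the complement step may subtract in \<open>ennreal\<close>.\<close>

lemma measurable_sum_points:
  assumes f: "f \<in> borel_measurable (mu M \<Otimes>\<^sub>M configs M)" and B: "B \<in> bdd_sets M"
  shows "(\<lambda>\<phi>. \<Sum>z\<in>\<phi> \<inter> B. f (z, \<phi> - {z}) :: ennreal) \<in> borel_measurable (configs M)"
proof -
  have sub: "(z, \<phi> - {z}) \<in> space (mu M) \<times> space (configs M)"
    if "\<phi> \<in> space (configs M)" "z \<in> \<phi>" for \<phi> z
    using that config_subset[OF that(1)] config_mono[OF that(1), of "\<phi> - {z}"] by (auto simp: space_mu)
  note fin = finite_config_Int[OF _ bdd_setsD(2)[OF B]]
  show ?thesis
    using f
  proof (induction rule: borel_measurable_induct)
    case (cong f g)
    have "(\<Sum>z\<in>\<phi> \<inter> B. f (z, \<phi> - {z})) = (\<Sum>z\<in>\<phi> \<inter> B. g (z, \<phi> - {z}))"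
      if "\<phi> \<in> space (configs M)" for \<phi>
      using cong(3) sub[OF that] by (intro sum.cong) (auto simp: space_pair_measure)
    with cong(4) show ?case by (subst measurable_cong)
  next
    case (set S)
    then show ?case
    proof (induction rule: mu_configs_induct)
      case (rect A L)
      have "(\<Sum>z\<in>\<phi> \<inter> B. indicator (A \<times> cyl M L) (z, \<phi> - {z}) :: ennreal)
        = (\<Sum>z\<in>\<phi> \<inter> (B \<inter> A). indicator (cyl M L) (\<phi> - {z}))" if "\<phi> \<in> space (configs M)" for \<phi>
        using fin[OF that] by (intro sum.mono_neutral_cong_right) (auto simp: indicator_def)
      with measurable_sum_indicator_cyl[OF rect(2) bdd_sets_Int[OF B rect(1)]]
      show ?case by (subst measurable_cong)
    next
      case (compl S)
      have "(\<Sum>z\<in>\<phi> \<inter> B. indicator (space (mu M) \<times> space (configs M) - S) (z, \<phi> - {z}) :: ennreal)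
        = of_nat (card (\<phi> \<inter> B)) - (\<Sum>z\<in>\<phi> \<inter> B. indicator S (z, \<phi> - {z}))" if \<phi>: "\<phi> \<in> space (configs M)" for \<phi>
      proof -
        have tot: "(\<Sum>z\<in>\<phi> \<inter> B. indicator (space (mu M) \<times> space (configs M) - S) (z, \<phi> - {z}) :: ennreal)
           + (\<Sum>z\<in>\<phi> \<inter> B. indicator S (z, \<phi> - {z})) = (\<Sum>z\<in>\<phi> \<inter> B. 1)"
          unfolding sum.distrib[symmetric] using sub[OF \<phi>] by (intro sum.cong) (auto simp: indicator_def)
        have "(\<Sum>z\<in>\<phi> \<inter> B. indicator S (z, \<phi> - {z}) :: ennreal) \<noteq> \<top>"
          using fin[OF \<phi>] by (auto simp: indicator_def)
        note ennreal_add_diff_cancel_right[OF this, symmetric]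
        also note tot
        finally show ?thesis by simp
      qed
      moreover have "(\<lambda>\<phi>. of_nat (card (\<phi> \<inter> B)) - (\<Sum>z\<in>\<phi> \<inter> B. indicator S (z, \<phi> - {z})) :: ennreal)
          \<in> borel_measurable (configs M)"
        using measurable_card[OF B] compl(2) by measurable
      ultimately show ?case by (subst measurable_cong)
    next
      case (union S)
      have "(\<Sum>z\<in>\<phi> \<inter> B. indicator (\<Union>i. S i) (z, \<phi> - {z}) :: ennreal)
        = (\<Sum>i. \<Sum>z\<in>\<phi> \<inter> B. indicator (S i) (z, \<phi> - {z}))" for \<phi>
        by (subst suminf_sum) (auto simp: suminf_indicator[OF union(1)])
      with union(3) show ?case by simp
    qed
  next
    case (mult u c)
    then show ?case by (simp flip: sum_distrib_left)
  next
    case (add u v)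
    then show ?case by (simp add: sum.distrib)
  next
    case (seq U)
    have inc: "U i x \<le> U j x" if "i \<le> j" for i j x
      using le_funD[OF incseqD[OF \<open>incseq U\<close> that]] .
    have "(\<Sum>z\<in>\<phi> \<inter> B. (SUP i. U i) (z, \<phi> - {z})) = (SUP i. \<Sum>z\<in>\<phi> \<inter> B. U i (z, \<phi> - {z}))" for \<phi>
      by (subst ennreal_SUP_sum) (auto simp: incseq_def image_comp intro: inc)
    with seq.IH show ?case by simp
  qed
qed


section \<open>The Mecke formula\<close>

lemma emeasure_bdd_sets_finite:
  fixes B :: "('d::finite, 'm) marked set"
  assumes M: "prob_space M" and B: "B \<in> bdd_sets M" shows "emeasure (mu M) B < \<infinity>"
proof -
  interpret M: prob_space M by fact
  obtain r where r: "fst ` B \<subseteq> cball 0 r"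
    using bdd_setsD(2)[OF B] by (auto simp: bounded_iff subset_iff)
  have "B \<subseteq> cball 0 r \<times> space M"
    using r sets.sets_into_space[OF bdd_setsD(1)[OF B]] by (force simp: space_mu)
  then have "emeasure (mu M) B \<le> emeasure (mu M) (cball (0 :: real ^ 'd) r \<times> space M)"
    by (intro emeasure_mono Times_UNIV_sets) auto
  also have "\<dots> = emeasure lborel (cball (0 :: real ^ 'd) r)"
    by (simp add: mu_def M.emeasure_pair_measure_Times M.emeasure_space_1)
  also have "\<dots> < \<infinity>"
    by (rule emeasure_lborel_cball_finite)
  finally show ?thesis .
qed

lemma emeasure_bdd_sets:
  fixes B :: "('d::finite, 'm) marked set"
  assumes "prob_space M" "B \<in> bdd_sets M"
  shows "emeasure (mu M) B = ennreal (measure (mu M) B)"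
  using emeasure_bdd_sets_finite[OF assms] by (intro emeasure_eq_ennreal_measure) auto

lemma bdd_sets_Union: "finite S \<Longrightarrow> S \<subseteq> bdd_sets M \<Longrightarrow> \<Union>S \<in> bdd_sets M"
proof (induction S rule: finite_induct)
  case empty then show ?case by (simp add: bdd_sets_def)
next
  case (insert B S)
  then have "B \<in> bdd_sets M" "\<Union>S \<in> bdd_sets M" by auto
  then show ?case by (auto simp: bdd_sets_def image_Un)
qed

text \<open>The atoms of the finite algebra generated by S. They turn overlapping sets into unions
  of disjoint ones, to which independence of Poisson counts applies.\<close>

lemma bdd_sets_atoms:
  fixes S :: "('d::finite, 'm) marked set set"
  assumes S: "finite S" "S \<subseteq> bdd_sets M"
  obtains m :: nat and B J where
    "\<And>i. i < m \<Longrightarrow> B i \<in> bdd_sets M" "disjoint_family_on B {..<m}"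
    "\<And>X. X \<in> S \<Longrightarrow> J X \<subseteq> {..<m}" "\<And>X. X \<in> S \<Longrightarrow> X = \<Union>(B ` J X)"
proof -
  obtain e where e: "bij_betw e {0..<card (Pow S)} (Pow S)"
    using ex_bij_betw_nat_finite[of "Pow S"] S by auto
  define m where "m = card (Pow S)"
  \<comment> \<open>\<open>e i\<close> prescribes which members of S contain the points of the atom.
    Intersecting with \<open>\<Union>S\<close> keeps every atom bounded; the atom with empty pattern
    becomes empty.\<close>
  define B where "B i = \<Union>S \<inter> {z \<in> space (mu M). \<forall>Y\<in>S. z \<in> Y \<longleftrightarrow> Y \<in> e i}" for i
  define J where "J X = {i. i < m \<and> X \<in> e i}" for X
  show ?thesis
  proof
    fix i
    have "{z \<in> space (mu M). \<forall>Y\<in>S. z \<in> Y \<longleftrightarrow> Y \<in> e i} \<in> sets (mu M)"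
    proof (rule sets.sets_Collect_finite_All[OF _ S(1)])
      fix Y assume "Y \<in> S"
      then have [measurable]: "Y \<in> sets (mu M)" using S(2) bdd_setsD(1) by blast
      show "{z \<in> space (mu M). z \<in> Y \<longleftrightarrow> Y \<in> e i} \<in> sets (mu M)" by measurable
    qed
    then show "B i \<in> bdd_sets M"
      unfolding B_def by (intro bdd_sets_Int bdd_sets_Union S)
  next
    show "disjoint_family_on B {..<m}"
      unfolding disjoint_family_on_def
    proof (intro ballI impI)
      fix i j assume ij: "i \<in> {..<m}" "j \<in> {..<m}" "i \<noteq> j"
      have "e i \<noteq> e j"
        using e ij unfolding m_def bij_betw_def inj_on_def by auto
      moreover have "e i \<in> Pow S" "e j \<in> Pow S"
        using ij bij_betwE[OF e] by (auto simp: m_def)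
      ultimately show "B i \<inter> B j = {}"
        by (auto simp: B_def)
    qed
  next
    fix X assume X: "X \<in> S"
    show "J X \<subseteq> {..<m}" by (auto simp: J_def)
    have "z \<in> \<Union>(B ` J X)" if z: "z \<in> X" for z
    proof -
      have "{Y \<in> S. z \<in> Y} \<in> e ` {0..<m}"
        using e by (auto simp: bij_betw_def m_def)
      then obtain i where i: "i < m" "e i = {Y \<in> S. z \<in> Y}" by auto
      moreover have "z \<in> space (mu M)"
        using X S(2) z bdd_setsD(1) sets.sets_into_space by blast
      ultimately show ?thesis
        using X z by (auto simp: B_def J_def)
    qed
    moreover have "B i \<subseteq> X" if "i \<in> J X" for i
      using that X by (auto simp: B_def J_def)
    ultimately show "X = \<Union>(B ` J X)" by blast
  qed
qed

locale poisson =
  fixes M :: "'m measure" and Q :: "('d::finite, 'm) marked set measure"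
  assumes marks: "prob_space M" and poisson: "poisson_process M Q"
begin

sublocale Q: prob_space Q
  using poisson by (simp add: poisson_process_def)

sublocale mu: sigma_finite_measure "mu M :: ('d, 'm) marked measure"
  using sigma_finite_mu[OF marks] .

sublocale muQ: pair_sigma_finite "mu M :: ('d, 'm) marked measure" Q ..

lemma sets_Q [measurable_cong]: "sets Q = sets (configs M)"
  using poisson by (simp add: poisson_process_def)

lemma space_Q: "space Q = space (configs M)"
  using sets_Q by (rule sets_eq_imp_space_eq)

lemma prob_count:
  assumes "B \<in> bdd_sets M"
  shows "measure Q {\<phi> \<in> space Q. card (\<phi> \<inter> B) = n}
    = exp (- measure (mu M) B) * measure (mu M) B ^ n / fact n"
  using poisson assms unfolding poisson_process_def bdd_sets_def by blast

lemma prob_counts: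
  fixes B :: "nat \<Rightarrow> ('d, 'm) marked set"
  assumes I: "finite I" "disjoint_family_on B I" "\<And>i. i \<in> I \<Longrightarrow> B i \<in> bdd_sets M"
  shows "measure Q {\<phi> \<in> space Q. \<forall>i\<in>I. card (\<phi> \<inter> B i) = n i}
    = (\<Prod>i\<in>I. exp (- measure (mu M) (B i)) * measure (mu M) (B i) ^ n i / fact (n i))"
proof (cases "I = {}")
  case True then show ?thesis by (simp add: Q.prob_space)
next
  case False
  have "Q.indep_vars (\<lambda>_. count_space UNIV) (\<lambda>i \<phi>. card (\<phi> \<inter> B i)) I"
    using poisson I unfolding poisson_process_def bdd_sets_def by blast
  from Q.indep_varsD_finite[OF this False I(1), of "\<lambda>i. {n i}"]
  have "measure Q (\<Inter>i\<in>I. (\<lambda>\<phi>. card (\<phi> \<inter> B i)) -` {n i} \<inter> space Q)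
      = (\<Prod>i\<in>I. measure Q ((\<lambda>\<phi>. card (\<phi> \<inter> B i)) -` {n i} \<inter> space Q))" by simp
  also have "(\<Inter>i\<in>I. (\<lambda>\<phi>. card (\<phi> \<inter> B i)) -` {n i} \<inter> space Q) = {\<phi> \<in> space Q. \<forall>i\<in>I. card (\<phi> \<inter> B i) = n i}"
    using False by auto
  also have "(\<Prod>i\<in>I. measure Q ((\<lambda>\<phi>. card (\<phi> \<inter> B i)) -` {n i} \<inter> space Q))
      = (\<Prod>i\<in>I. measure Q {\<phi> \<in> space Q. card (\<phi> \<inter> B i) = n i})"
    by (intro prod.cong refl arg_cong[where f="measure Q"]) auto
  finally show ?thesis using I by (simp add: prob_count)
qed

text \<open>The events of prescribed count vectors form a countable partition, and by independence
  their probabilities are products of Poisson weights.\<close>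

lemma nn_integral_counts:
  fixes B :: "nat \<Rightarrow> ('d, 'm) marked set" and G :: "(nat \<Rightarrow> nat) \<Rightarrow> ennreal"
  assumes I: "finite I" "disjoint_family_on B I" "\<And>i. i \<in> I \<Longrightarrow> B i \<in> bdd_sets M"
  shows "(\<integral>\<^sup>+\<phi>. G (\<lambda>i\<in>I. card (\<phi> \<inter> B i)) \<partial>Q)
    = (\<integral>\<^sup>+n. G n * ennreal (\<Prod>i\<in>I. exp (- measure (mu M) (B i)) * measure (mu M) (B i) ^ n i / fact (n i))
        \<partial>count_space (I \<rightarrow>\<^sub>E UNIV))"
proof -
  let ?N = "I \<rightarrow>\<^sub>E (UNIV :: nat set)"
  let ?E = "\<lambda>n. {\<phi> \<in> space Q. \<forall>i\<in>I. card (\<phi> \<inter> B i) = n i}"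
  have cnt: "countable ?N" using I(1) by (intro countable_PiE) auto
  have E [measurable]: "?E n \<in> sets Q" for n
  proof (rule sets.sets_Collect_finite_All[OF _ I(1)])
    fix i assume "i \<in> I"
    note [measurable] = measurable_card[OF I(3)[OF this]]
    show "{\<phi> \<in> space Q. card (\<phi> \<inter> B i) = n i} \<in> sets Q" by measurable
  qed
  have "G (\<lambda>i\<in>I. card (\<phi> \<inter> B i)) = (\<integral>\<^sup>+n. G n * indicator (?E n) \<phi> \<partial>count_space ?N)"
    if \<phi>: "\<phi> \<in> space Q" for \<phi>
  proof -
    let ?n = "\<lambda>i\<in>I. card (\<phi> \<inter> B i)"
    have "(\<integral>\<^sup>+n. G n * indicator (?E n) \<phi> \<partial>count_space ?N) = (\<Sum>n\<in>{?n}. G n * indicator (?E n) \<phi>)"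
    proof (rule nn_integral_count_space')
      fix n assume n: "n \<in> ?N" "n \<notin> {?n}"
      have "\<phi> \<notin> ?E n"
      proof
        assume "\<phi> \<in> ?E n"
        then have "n = ?n" using n(1) by (auto simp: fun_eq_iff PiE_def extensional_def)
        with n(2) show False by simp
      qed
      then show "G n * indicator (?E n) \<phi> = 0" by simp
    qed auto
    then show ?thesis using \<phi> by simp
  qed
  then have "(\<integral>\<^sup>+\<phi>. G (\<lambda>i\<in>I. card (\<phi> \<inter> B i)) \<partial>Q) = (\<integral>\<^sup>+\<phi>. \<integral>\<^sup>+n. G n * indicator (?E n) \<phi> \<partial>count_space ?N \<partial>Q)"
    by (intro nn_integral_cong) auto
  also have "\<dots> = (\<integral>\<^sup>+n. \<integral>\<^sup>+\<phi>. G n * indicator (?E n) \<phi> \<partial>Q \<partial>count_space ?N)"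
    by (rule nn_integral_count_space_nn_integral[OF cnt]) measurable
  also have "\<dots> = (\<integral>\<^sup>+n. G n * emeasure Q (?E n) \<partial>count_space ?N)"
    by (simp add: nn_integral_cmult_indicator)
  finally show ?thesis
    by (simp add: Q.emeasure_eq_measure prob_counts[OF I])
qed

text \<open>Poisson weights satisfy (k + 1) p (k + 1) = r p k, where r is the rate. Applied to one
  coordinate of the count vector, this is the Mecke formula for a single disjoint set.\<close>

lemma poisson_shift:
  fixes B :: "nat \<Rightarrow> ('d, 'm) marked set" and g :: "(nat \<Rightarrow> nat) \<Rightarrow> ennreal"
  assumes I: "finite I" "disjoint_family_on B I" "\<And>i. i \<in> I \<Longrightarrow> B i \<in> bdd_sets M" and j: "j \<in> I"
  defines "Y \<equiv> \<lambda>\<phi>. \<lambda>i\<in>I. card (\<phi> \<inter> B i)"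
  shows "(\<integral>\<^sup>+\<phi>. of_nat (Y \<phi> j) * g ((Y \<phi>)(j := Y \<phi> j - 1)) \<partial>Q)
    = ennreal (measure (mu M) (B j)) * (\<integral>\<^sup>+\<phi>. g (Y \<phi>) \<partial>Q)"
proof -
  let ?N = "I \<rightarrow>\<^sub>E (UNIV :: nat set)"
  define p where "p i k = exp (- measure (mu M) (B i)) * measure (mu M) (B i) ^ k / fact k" for i k
  have p0: "p i k \<ge> 0" for i k by (simp add: p_def)
  define q where "q n = (\<Prod>i\<in>I. p i (n i))" for n
  have q: "q n = p j (n j) * (\<Prod>i\<in>I - {j}. p i (n i))" for n
    unfolding q_def by (rule prod.remove[OF I(1) j])
  have shift: "of_nat (Suc (n j)) * ennreal (q (n(j := Suc (n j)))) = ennreal (measure (mu M) (B j)) * ennreal (q n)" for n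
  proof -
    have "real (Suc (n j)) * p j (Suc (n j)) = measure (mu M) (B j) * p j (n j)"
      by (simp add: p_def field_simps del: of_nat_Suc)
    then have "real (Suc (n j)) * q (n(j := Suc (n j))) = measure (mu M) (B j) * q n"
      unfolding q by (simp add: mult.assoc[symmetric] del: of_nat_Suc)
    then show ?thesis
      by (metis ennreal_mult'' ennreal_of_nat_eq_real_of_nat p0 q_def prod_nonneg)
  qed
  have "(\<integral>\<^sup>+\<phi>. of_nat (Y \<phi> j) * g ((Y \<phi>)(j := Y \<phi> j - 1)) \<partial>Q)
      = (\<integral>\<^sup>+n. of_nat (n j) * g (n(j := n j - 1)) * ennreal (q n) \<partial>count_space ?N)"
    unfolding Y_def q_def p_def
    using nn_integral_counts[OF I, where G="\<lambda>n. of_nat (n j) * g (n(j := n j - 1))"] by simp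
  \<comment> \<open>Truncated subtraction is harmless: at n j = 0 the factor
    \<open>of_nat (n j)\<close> vanishes. On the remaining vectors lowering coordinate j is a
    bijection onto all count vectors.\<close>
  also have "\<dots> = (\<integral>\<^sup>+n. of_nat (n j) * g (n(j := n j - 1)) * ennreal (q n) \<partial>count_space {n \<in> ?N. n j \<noteq> 0})"
    by (rule nn_integral_count_space_eq) auto
  also have "\<dots> = (\<integral>\<^sup>+n. of_nat (Suc (n j)) * g n * ennreal (q (n(j := Suc (n j)))) \<partial>count_space ?N)"
  proof -
    have "bij_betw (\<lambda>n. n(j := Suc (n j))) ?N {n \<in> ?N. n j \<noteq> 0}"
      by (rule bij_betw_byWitness[where f' = "\<lambda>n. n(j := n j - 1)"])
        (use j in \<open>auto simp: PiE_def extensional_def\<close>)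
    from nn_integral_bij_count_space[OF this, of "\<lambda>n. of_nat (n j) * g (n(j := n j - 1)) * ennreal (q n)", symmetric]
    show ?thesis by (simp del: of_nat_Suc)
  qed
  also have "\<dots> = (\<integral>\<^sup>+n. ennreal (measure (mu M) (B j)) * (g n * ennreal (q n)) \<partial>count_space ?N)"
    by (intro nn_integral_cong) (metis shift mult.assoc mult.commute)
  also have "\<dots> = ennreal (measure (mu M) (B j)) * (\<integral>\<^sup>+n. g n * ennreal (q n) \<partial>count_space ?N)"
    by (rule nn_integral_cmult) simp
  also have "(\<integral>\<^sup>+n. g n * ennreal (q n) \<partial>count_space ?N) = (\<integral>\<^sup>+\<phi>. g (Y \<phi>) \<partial>Q)"
    unfolding Y_def q_def p_def using nn_integral_counts[OF I, where G=g] by simp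
  finally show ?thesis .
qed

text \<open>After passing to atoms, the cylinder indicator depends only on atom counts. All points
  of one atom give the same term, since removing any of them lowers just that count by one; so the
  sum over points becomes a sum over atoms of count times shifted indicator.\<close>

lemma mecke_cyl:
  assumes A: "A \<in> bdd_sets M" and L: "fst ` set L \<subseteq> bdd_sets M"
  shows "(\<integral>\<^sup>+\<phi>. (\<Sum>z\<in>\<phi> \<inter> A. indicator (cyl M L) (\<phi> - {z})) \<partial>Q) = emeasure (mu M) A * emeasure Q (cyl M L)"
proof -
  let ?S = "insert A (fst ` set L)"
  have "finite ?S" "?S \<subseteq> bdd_sets M" using A L by auto
  then obtain m :: nat and B J where B: "\<And>i. i < m \<Longrightarrow> B i \<in> bdd_sets M" "disjoint_family_on B {..<m}"
    and J: "\<And>X. X \<in> ?S \<Longrightarrow> J X \<subseteq> {..<m}" "\<And>X. X \<in> ?S \<Longrightarrow> X = \<Union>(B ` J X)"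
    by (rule bdd_sets_atoms) blast
  define Y where "Y \<phi> = (\<lambda>i\<in>{..<m}. card (\<phi> \<inter> B i))" for \<phi>
  \<comment> \<open>The cylinder constraints rewritten in terms of the atom counts: the count of X
    is the sum of the counts of its atoms.\<close>
  define g :: "(nat \<Rightarrow> nat) \<Rightarrow> ennreal" where "g n = (if \<forall>(X, k)\<in>set L. (\<Sum>i\<in>J X. n i) = k then 1 else 0)" for n
  note I = finite_lessThan[of m] B(2) B(1)[unfolded lessThan_iff[symmetric]]
  have disj: "disjoint_family_on B (J X)" if "X \<in> ?S" for X
    using J(1)[OF that] B(2) by (rule disjoint_family_on_mono)
  have finJ: "finite (J X)" if "X \<in> ?S" for X
    using J(1)[OF that] by (rule finite_subset) simp
  have Jm: "i < m" if "X \<in> ?S" "i \<in> J X" for X i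
    using J(1)[OF that(1)] that(2) by auto
  have finB: "finite (\<phi> \<inter> B i)" if "\<phi> \<in> space Q" "i < m" for \<phi> i
    using that B(1) by (auto simp: space_Q intro!: finite_config_Int[where M=M] bdd_setsD(2)[where M=M])
  have card_X: "card (\<phi> \<inter> X) = (\<Sum>i\<in>J X. Y \<phi> i)" if "\<phi> \<in> space Q" "X \<in> ?S" for \<phi> X
  proof -
    have "\<phi> \<inter> X = (\<Union>i\<in>J X. \<phi> \<inter> B i)"
      using J(2)[OF that(2)] by auto
    also have "card \<dots> = (\<Sum>i\<in>J X. card (\<phi> \<inter> B i))"
      using disj[OF that(2)] finB[OF that(1)] Jm[OF that(2)] finJ[OF that(2)]
      by (subst card_UN_disjoint) (auto simp: disjoint_family_on_def)
    finally show ?thesis using Jm[OF that(2)] by (simp add: Y_def)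
  qed
  have g: "indicator (cyl M L) \<phi> = g (Y \<phi>)" if "\<phi> \<in> space Q" for \<phi>
  proof -
    have "(case x of (X, k) \<Rightarrow> card (\<phi> \<inter> X) = k) \<longleftrightarrow> (case x of (X, k) \<Rightarrow> (\<Sum>i\<in>J X. Y \<phi> i) = k)"
      if "x \<in> set L" for x
      using card_X[OF \<open>\<phi> \<in> space Q\<close>, of "fst x"] that by (cases x) (simp add: rev_image_eqI)
    then have "(\<forall>(X, k)\<in>set L. card (\<phi> \<inter> X) = k) \<longleftrightarrow> (\<forall>(X, k)\<in>set L. (\<Sum>i\<in>J X. Y \<phi> i) = k)"
      by (rule ball_cong[OF refl])
    with that show ?thesis by (simp add: cyl_def g_def indicator_def space_Q)
  qed
  have sub: "\<phi> - {z} \<in> space Q" if "\<phi> \<in> space Q" for \<phi> z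
    using that by (auto simp: space_Q intro: config_mono)
  have sum: "(\<Sum>z\<in>\<phi> \<inter> A. indicator (cyl M L) (\<phi> - {z})) = (\<Sum>j\<in>J A. of_nat (Y \<phi> j) * g ((Y \<phi>)(j := Y \<phi> j - 1)))"
    if \<phi>: "\<phi> \<in> space Q" for \<phi>
  proof -
    have "\<phi> \<inter> A = (\<Union>j\<in>J A. \<phi> \<inter> B j)"
      using J(2)[of A] by auto
    then have "(\<Sum>z\<in>\<phi> \<inter> A. indicator (cyl M L) (\<phi> - {z})) = (\<Sum>z\<in>(\<Union>j\<in>J A. \<phi> \<inter> B j). g (Y (\<phi> - {z})))"
      using g[OF sub[OF \<phi>]] by simp
    also have "\<dots> = (\<Sum>j\<in>J A. \<Sum>z\<in>\<phi> \<inter> B j. g (Y (\<phi> - {z})))"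
      using disj[of A] finB[OF \<phi>] Jm[of A] finJ[of A]
      by (subst sum.UNION_disjoint) (auto simp: disjoint_family_on_def)
    also have "\<dots> = (\<Sum>j\<in>J A. \<Sum>z\<in>\<phi> \<inter> B j. g ((Y \<phi>)(j := Y \<phi> j - 1)))"
    proof (intro sum.cong refl arg_cong[where f=g])
      fix j z assume j: "j \<in> J A" and z: "z \<in> \<phi> \<inter> B j"
      have jm: "j < m" using Jm j by auto
      have "card ((\<phi> - {z}) \<inter> B i) = (if i = j then card (\<phi> \<inter> B j) - 1 else card (\<phi> \<inter> B i))" if "i < m" for i
      proof (cases "i = j")
        case True
        have "(\<phi> - {z}) \<inter> B j = \<phi> \<inter> B j - {z}" by auto
        then show ?thesis using True z finB[OF \<phi> jm] by (simp only: if_True refl card_Diff_singleton)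
      next
        case False
        then have "z \<notin> B i" using z B(2) that jm by (auto simp: disjoint_family_on_def)
        then have "(\<phi> - {z}) \<inter> B i = \<phi> \<inter> B i" by auto
        then show ?thesis using False by simp
      qed
      then show "Y (\<phi> - {z}) = (Y \<phi>)(j := Y \<phi> j - 1)"
        using jm by (auto simp: Y_def fun_eq_iff)
    qed
    finally show ?thesis using Jm[of A] by (simp add: Y_def)
  qed
  have Yj: "(\<lambda>\<phi>. of_nat (Y \<phi> j) * g ((Y \<phi>)(j := Y \<phi> j - 1))) \<in> borel_measurable Q" if "j < m" for j
  proof -
    have Yi: "(\<lambda>\<phi>. card (\<phi> \<inter> B i)) \<in> measurable Q (count_space UNIV)" if "i < m" for i
      using measurable_card[OF B(1)[OF that]] by measurable
    have "(\<lambda>\<phi>. \<lambda>i\<in>{..<m}. card (\<phi> \<inter> B i)) \<in> measurable Q (PiM {..<m} (\<lambda>_. count_space UNIV))"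
      by (rule measurable_restrict) (auto intro: Yi)
    then have "Y \<in> measurable Q (count_space ({..<m} \<rightarrow>\<^sub>E UNIV))"
      unfolding Y_def by (subst (asm) count_space_PiM_finite) (auto simp: Y_def)
    from measurable_compose[OF this, of "\<lambda>n. of_nat (n j) * g (n(j := n j - 1))" borel]
    show ?thesis by simp
  qed
  have "(\<integral>\<^sup>+\<phi>. (\<Sum>z\<in>\<phi> \<inter> A. indicator (cyl M L) (\<phi> - {z})) \<partial>Q)
    = (\<integral>\<^sup>+\<phi>. (\<Sum>j\<in>J A. of_nat (Y \<phi> j) * g ((Y \<phi>)(j := Y \<phi> j - 1))) \<partial>Q)"
    by (intro nn_integral_cong sum)
  also have "\<dots> = (\<Sum>j\<in>J A. \<integral>\<^sup>+\<phi>. of_nat (Y \<phi> j) * g ((Y \<phi>)(j := Y \<phi> j - 1)) \<partial>Q)"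
    by (rule nn_integral_sum[OF Yj[OF Jm]]) auto
  also have "\<dots> = (\<Sum>j\<in>J A. ennreal (measure (mu M) (B j)) * (\<integral>\<^sup>+\<phi>. g (Y \<phi>) \<partial>Q))"
    using Jm[of A] unfolding Y_def by (intro sum.cong refl poisson_shift[OF I]) auto
  also have "\<dots> = (\<Sum>j\<in>J A. ennreal (measure (mu M) (B j))) * (\<integral>\<^sup>+\<phi>. g (Y \<phi>) \<partial>Q)"
    by (rule sum_distrib_right[symmetric])
  also have "(\<Sum>j\<in>J A. ennreal (measure (mu M) (B j))) = (\<Sum>j\<in>J A. emeasure (mu M) (B j))"
    using Jm[of A] B(1) by (intro sum.cong refl emeasure_bdd_sets[OF marks, symmetric]) auto
  also have "\<dots> = emeasure (mu M) (\<Union>(B ` J A))"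
    using Jm[of A] B(1) disj[of A] finJ[of A] by (intro sum_emeasure) (auto intro: bdd_setsD(1))
  also have "(\<Union>(B ` J A)) = A" using J(2)[of A] by simp
  also have "(\<integral>\<^sup>+\<phi>. g (Y \<phi>) \<partial>Q) = (\<integral>\<^sup>+\<phi>. indicator (cyl M L) \<phi> \<partial>Q)"
    by (intro nn_integral_cong) (simp add: g)
  also have "\<dots> = emeasure Q (cyl M L)"
    by (rule nn_integral_indicator) (simp add: sets_Q sets_cyl[OF L])
  finally show ?thesis .
qed

text \<open>Rectangles reduce to cylinders by moving the first side into the summation set; the
  induction over sets and then over functions does the rest.\<close>

lemma mecke:
  fixes f :: "('d, 'm) marked \<times> ('d, 'm) marked set \<Rightarrow> ennreal"
  assumes f: "f \<in> borel_measurable (mu M \<Otimes>\<^sub>M configs M)" and B: "B \<in> bdd_sets M"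
  shows "(\<integral>\<^sup>+\<phi>. (\<Sum>z\<in>\<phi> \<inter> B. f (z, \<phi> - {z})) \<partial>Q) = (\<integral>\<^sup>+\<phi>. \<integral>\<^sup>+z. f (z, \<phi>) * indicator B z \<partial>mu M \<partial>Q)"
proof -
  have sub: "(z, \<phi> - {z}) \<in> space (mu M) \<times> space (configs M)"
    if "\<phi> \<in> space (configs M)" "z \<in> \<phi>" for \<phi> z
    using that config_subset[OF that(1)] config_mono[OF that(1), of "\<phi> - {z}"] by (auto simp: space_mu)
  note fin = finite_config_Int[OF _ bdd_setsD(2)[OF B]]
  have [measurable]: "B \<in> sets (mu M)" using B by (rule bdd_setsD)
  let ?l = "\<lambda>f. \<integral>\<^sup>+\<phi>. (\<Sum>z\<in>\<phi> \<inter> B. f (z, \<phi> - {z})) \<partial>Q"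
  let ?r = "\<lambda>f. \<integral>\<^sup>+\<phi>. \<integral>\<^sup>+z. f (z, \<phi>) * indicator B z \<partial>mu M \<partial>Q"
  have meas: "(\<lambda>\<phi>. \<Sum>z\<in>\<phi> \<inter> B. f (z, \<phi> - {z})) \<in> borel_measurable Q"
    if "f \<in> borel_measurable (mu M \<Otimes>\<^sub>M configs M)" for f :: "('d, 'm) marked \<times> ('d, 'm) marked set \<Rightarrow> ennreal"
    using measurable_sum_points[OF that B] by measurable
  have measr: "(\<lambda>\<phi>. \<integral>\<^sup>+z. f (z, \<phi>) * indicator B z \<partial>mu M) \<in> borel_measurable Q"
    if [measurable]: "f \<in> borel_measurable (mu M \<Otimes>\<^sub>M configs M)" for f :: "('d, 'm) marked \<times> ('d, 'm) marked set \<Rightarrow> ennreal"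
    by measurable
  have one: "?l (\<lambda>_. 1) = emeasure (mu M) B"
  proof -
    have "?l (\<lambda>_. 1) = (\<integral>\<^sup>+\<phi>. (\<Sum>z\<in>\<phi> \<inter> B. indicator (cyl M []) (\<phi> - {z})) \<partial>Q)"
      using sub by (intro nn_integral_cong sum.cong) (auto simp: space_Q indicator_def)
    also have "\<dots> = emeasure (mu M) B"
      using mecke_cyl[OF B, of "[]"] Q.emeasure_space_1 by (simp add: space_Q[symmetric])
    finally show ?thesis .
  qed
  have sec: "(\<lambda>z. f (z, \<phi>) * indicator B z) \<in> borel_measurable (mu M)"
    if "f \<in> borel_measurable (mu M \<Otimes>\<^sub>M configs M)" "\<phi> \<in> space Q" for f :: "_ \<Rightarrow> ennreal" and \<phi>
  proof -
    have [measurable]: "(\<lambda>z. (z, \<phi>)) \<in> measurable (mu M) (mu M \<Otimes>\<^sub>M configs M)"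
      using that by (auto simp: space_Q)
    show ?thesis using that(1) by measurable
  qed
  have set_eq: "?l (indicator S) = ?r (indicator S)" if "S \<in> sets (mu M \<Otimes>\<^sub>M configs M)" for S
    using that
  proof (induction rule: mu_configs_induct)
    case (rect A L)
    have "?l (indicator (A \<times> cyl M L)) = (\<integral>\<^sup>+\<phi>. (\<Sum>z\<in>\<phi> \<inter> (B \<inter> A). indicator (cyl M L) (\<phi> - {z})) \<partial>Q)"
      using fin by (intro nn_integral_cong sum.mono_neutral_cong_right) (auto simp: indicator_def space_Q)
    also have "\<dots> = emeasure (mu M) (B \<inter> A) * emeasure Q (cyl M L)"
      by (rule mecke_cyl[OF bdd_sets_Int[OF B rect(1)] rect(2)])
    also have "\<dots> = (\<integral>\<^sup>+\<phi>. emeasure (mu M) (B \<inter> A) * indicator (cyl M L) \<phi> \<partial>Q)"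
      by (subst nn_integral_cmult_indicator) (auto simp: sets_Q sets_cyl[OF rect(2)])
    also have "\<dots> = (\<integral>\<^sup>+\<phi>. \<integral>\<^sup>+z. indicator (cyl M L) \<phi> * indicator (B \<inter> A) z \<partial>mu M \<partial>Q)"
      using rect(1) by (intro nn_integral_cong) (subst nn_integral_cmult_indicator, auto simp: mult.commute)
    also have "\<dots> = ?r (indicator (A \<times> cyl M L))"
      by (intro nn_integral_cong) (auto simp: indicator_def)
    finally show ?case .
  next
    case (compl S)
    let ?C = "space (mu M) \<times> space (configs M) - S"
    have C: "?C \<in> sets (mu M \<Otimes>\<^sub>M configs M)"
      using sets.compl_sets[OF compl(1)] by (simp add: space_pair_measure)
    have ltot: "?l (indicator S) + ?l (indicator ?C) = emeasure (mu M) B"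
      unfolding one[symmetric]
    proof (subst nn_integral_add[symmetric, OF meas meas])
      show "(\<integral>\<^sup>+ \<phi>. (\<Sum>z\<in>\<phi> \<inter> B. indicator S (z, \<phi> - {z})) + (\<Sum>z\<in>\<phi> \<inter> B. indicator ?C (z, \<phi> - {z})) \<partial>Q)
         = (\<integral>\<^sup>+ \<phi>. (\<Sum>z\<in>\<phi> \<inter> B. 1) \<partial>Q)"
        unfolding sum.distrib[symmetric] using sub
        by (intro nn_integral_cong sum.cong) (auto simp: indicator_def space_Q)
    qed (use compl(1) C in auto)
    have rtot: "?r (indicator S) + ?r (indicator ?C) = emeasure (mu M) B"
    proof -
      have I: "indicator S \<in> borel_measurable (mu M \<Otimes>\<^sub>M configs M)"
        "(indicator ?C :: _ \<Rightarrow> ennreal) \<in> borel_measurable (mu M \<Otimes>\<^sub>M configs M)" using compl(1) C by auto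
      have "?r (indicator S) + ?r (indicator ?C) = (\<integral>\<^sup>+\<phi>. (\<integral>\<^sup>+z. indicator S (z, \<phi>) * indicator B z \<partial>mu M)
          + (\<integral>\<^sup>+z. indicator ?C (z, \<phi>) * indicator B z \<partial>mu M) \<partial>Q)"
        by (rule nn_integral_add[symmetric, OF measr measr]) (rule I)+
      also have "\<dots> = (\<integral>\<^sup>+\<phi>. \<integral>\<^sup>+z. indicator S (z, \<phi>) * indicator B z + indicator ?C (z, \<phi>) * indicator B z \<partial>mu M \<partial>Q)"
        by (intro nn_integral_cong nn_integral_add[symmetric] sec I)
      also have "\<dots> = (\<integral>\<^sup>+\<phi>. \<integral>\<^sup>+z. indicator B z \<partial>mu M \<partial>Q)"
        by (intro nn_integral_cong) (auto simp: indicator_def space_Q)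
      finally have "?r (indicator S) + ?r (indicator ?C) = (\<integral>\<^sup>+\<phi>. \<integral>\<^sup>+z. indicator B z \<partial>mu M \<partial>Q)" .
      then show ?thesis by (simp add: Q.emeasure_space_1)
    qed
    \<comment> \<open>The two sides agree for the constant 1, with the finite value of
      \<open>mu M\<close> at B. Finiteness permits cancelling the contribution of S, which leaves
      the equality for the complement.\<close>
    have "?r (indicator S) \<le> ?r (indicator S) + ?r (indicator ?C)" by simp
    also have "\<dots> < \<top>" unfolding rtot using emeasure_bdd_sets_finite[OF marks B] by simp
    finally have fin: "?r (indicator S) \<noteq> \<top>" by simp
    have "?r (indicator S) + ?l (indicator ?C) = ?r (indicator S) + ?r (indicator ?C)"
      using ltot unfolding compl.IH rtot .
    then show ?case using fin unfolding ennreal_add_left_cancel infinity_ennreal_def by simp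
  next
    case (union S)
    have S: "S i \<in> sets (mu M \<Otimes>\<^sub>M configs M)" for i using union(2) by auto
    have "?l (indicator (\<Union>i. S i)) = (\<integral>\<^sup>+\<phi>. (\<Sum>i. \<Sum>z\<in>\<phi> \<inter> B. indicator (S i) (z, \<phi> - {z})) \<partial>Q)"
      by (subst suminf_sum) (auto simp: suminf_indicator[OF union(1)])
    also have "\<dots> = (\<Sum>i. ?l (indicator (S i)))"
      by (intro nn_integral_suminf meas borel_measurable_indicator S)
    also have "\<dots> = (\<Sum>i. ?r (indicator (S i)))" by (simp add: union(3))
    also have "\<dots> = (\<integral>\<^sup>+\<phi>. (\<Sum>i. \<integral>\<^sup>+z. indicator (S i) (z, \<phi>) * indicator B z \<partial>mu M) \<partial>Q)"
      by (intro nn_integral_suminf[symmetric] measr borel_measurable_indicator S)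
    also have "\<dots> = (\<integral>\<^sup>+\<phi>. \<integral>\<^sup>+z. (\<Sum>i. indicator (S i) (z, \<phi>) * indicator B z) \<partial>mu M \<partial>Q)"
    proof (intro nn_integral_cong nn_integral_suminf[symmetric])
      fix \<phi> i assume "\<phi> \<in> space Q"
      then have [measurable]: "(\<lambda>z. (z, \<phi>)) \<in> measurable (mu M) (mu M \<Otimes>\<^sub>M configs M)"
        by (auto simp: space_Q)
      show "(\<lambda>z. indicator (S i) (z, \<phi>) * indicator B z :: ennreal) \<in> borel_measurable (mu M)"
        using S[of i] by measurable
    qed
    also have "\<dots> = ?r (indicator (\<Union>i. S i))"
      by (simp add: ennreal_suminf_multc suminf_indicator[OF union(1)])
    finally show ?case .
  qed
  show ?thesis
    using f
  proof (induction rule: borel_measurable_induct)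
    case (cong f g)
    have fg: "f x = g x" if "x \<in> space (mu M) \<times> space (configs M)" for x
      using cong.hyps(3) that by (simp add: space_pair_measure)
    have "?l f = ?l g"
      by (intro nn_integral_cong sum.cong refl fg sub) (auto simp: space_Q)
    moreover have "?r f = ?r g"
      by (intro nn_integral_cong arg_cong2[where f=times] refl fg) (auto simp: space_Q)
    ultimately show ?case using cong.IH by simp
  next
    case (set S)
    then show ?case by (rule set_eq)
  next
    case (mult u c)
    have "?l (\<lambda>x. c * u x) = c * ?l u"
      using meas[OF mult.hyps(2)] by (simp flip: sum_distrib_left add: nn_integral_cmult)
    moreover have "?r (\<lambda>x. c * u x) = c * ?r u"
    proof -
      have "?r (\<lambda>x. c * u x) = (\<integral>\<^sup>+\<phi>. c * \<integral>\<^sup>+z. u (z, \<phi>) * indicator B z \<partial>mu M \<partial>Q)"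
        by (intro nn_integral_cong) (simp add: nn_integral_cmult sec[OF mult.hyps(2)] mult.assoc)
      then show ?thesis using measr[OF mult.hyps(2)] by (simp add: nn_integral_cmult)
    qed
    ultimately show ?case using mult.IH by simp
  next
    case (add u v)
    have "?l (\<lambda>x. v x + u x) = ?l v + ?l u"
      using meas[OF add.hyps(1)] meas[OF add.hyps(3)] by (simp add: sum.distrib nn_integral_add)
    moreover have "?r (\<lambda>x. v x + u x) = ?r v + ?r u"
    proof -
      have "?r (\<lambda>x. v x + u x) = (\<integral>\<^sup>+\<phi>. (\<integral>\<^sup>+z. v (z, \<phi>) * indicator B z \<partial>mu M) + (\<integral>\<^sup>+z. u (z, \<phi>) * indicator B z \<partial>mu M) \<partial>Q)"
        by (intro nn_integral_cong) (simp add: nn_integral_add sec[OF add.hyps(1)] sec[OF add.hyps(3)] distrib_right)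
      then show ?thesis using measr[OF add.hyps(1)] measr[OF add.hyps(3)] by (simp add: nn_integral_add)
    qed
    ultimately show ?case using add.IH by simp
  next
    case (seq U)
    have inc: "U i x \<le> U j x" if "i \<le> j" for i j x
      using le_funD[OF incseqD[OF \<open>incseq U\<close> that]] .
    have "?l (SUP i. U i) = (\<integral>\<^sup>+\<phi>. (SUP i. \<Sum>z\<in>\<phi> \<inter> B. U i (z, \<phi> - {z})) \<partial>Q)"
      by (intro nn_integral_cong) (subst ennreal_SUP_sum, auto simp: incseq_def image_comp intro: inc)
    also have "\<dots> = (SUP i. ?l (U i))"
      by (intro nn_integral_monotone_convergence_SUP meas seq.hyps(1)) (auto simp: incseq_def le_fun_def intro!: sum_mono inc)
    also have "\<dots> = (SUP i. ?r (U i))" by (simp add: seq.IH)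
    also have "\<dots> = (\<integral>\<^sup>+\<phi>. (SUP i. \<integral>\<^sup>+z. U i (z, \<phi>) * indicator B z \<partial>mu M) \<partial>Q)"
      by (intro nn_integral_monotone_convergence_SUP[symmetric] measr seq.hyps(1))
        (auto simp: incseq_def le_fun_def intro!: nn_integral_mono mult_right_mono inc)
    also have "\<dots> = (\<integral>\<^sup>+\<phi>. \<integral>\<^sup>+z. (SUP i. U i (z, \<phi>) * indicator B z) \<partial>mu M \<partial>Q)"
      by (intro nn_integral_cong nn_integral_monotone_convergence_SUP[symmetric] sec seq.hyps(1))
        (auto simp: incseq_def le_fun_def intro!: mult_right_mono inc)
    also have "\<dots> = ?r (SUP i. U i)"
      by (simp add: SUP_mult_right_ennreal[symmetric] image_comp)
    finally show ?case .
  qed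
qed

end


section \<open>Gibbs measures\<close>

definition simple_locs :: "('d, 'm) marked set \<Rightarrow> bool" where
  "simple_locs \<phi> \<longleftrightarrow> inj_on fst \<phi>"

lemma simple_locs_remove:
  assumes "simple_locs \<phi>" "z \<in> \<phi>" shows "fst z \<notin> fst ` (\<phi> - {z})"
  using assms by (auto simp: simple_locs_def inj_on_def)

lemma add_point_remove: "simple_locs \<phi> \<Longrightarrow> z \<in> \<phi> \<Longrightarrow> add_point z (\<phi> - {z}) = \<phi>"
  using simple_locs_remove[of \<phi> z] by (simp add: add_point_eq insert_absorb)

text \<open>The number of points over \<Lambda> that share their location with another point, in the
  form of a Mecke sum: the test at z looks only at the configuration without z.\<close>

definition collisions :: "'m measure \<Rightarrow> (real ^ 'd) set \<Rightarrow> ('d::finite, 'm) marked set \<Rightarrow> ennreal" where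
  "collisions M \<Lambda> \<phi> = (\<Sum>z\<in>\<phi> \<inter> \<Lambda> \<times> space M. if fst z \<in> fst ` (\<phi> - {z}) then 1 else 0)"

lemma measurable_hit:
  fixes M :: "'m measure"
  shows "(\<lambda>x. if fst (fst x) \<in> fst ` snd x then 1 else 0 :: ennreal)
    \<in> borel_measurable (mu M \<Otimes>\<^sub>M configs M :: (('d::finite, 'm) marked \<times> ('d, 'm) marked set) measure)"
  using measurable_location[OF measurable_fst measurable_snd] by measurable

lemma measurable_collisions:
  fixes \<Lambda> :: "(real ^ 'd::finite) set"
  assumes "bounded_borel \<Lambda>" shows "collisions M \<Lambda> \<in> borel_measurable (configs M)"
  unfolding collisions_def
  using measurable_sum_points[OF measurable_hit bdd_sets_Times[OF assms, of M]] by simp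

lemma bounded_borel_ball: "bounded_borel (ball (x :: real ^ 'd::finite) r)"
  by (simp add: bounded_borel_def)

text \<open>Two points sharing a location over \<Lambda> both lie over \<Lambda>. This locality lets
  the Poisson statement pass to the Gibbs measure.\<close>

lemma collisions_cong:
  fixes \<phi> \<psi> :: "('d::finite, 'm) marked set"
  assumes "restr \<phi> \<Lambda> = restr \<psi> \<Lambda>" "\<phi> \<in> space (configs M)" "\<psi> \<in> space (configs M)"
  shows "collisions M \<Lambda> \<phi> = collisions M \<Lambda> \<psi>"
proof -
  have mem: "z \<in> \<phi> \<longleftrightarrow> z \<in> \<psi>" if "fst z \<in> \<Lambda>" for z
    using assms(1) that by (cases z) (auto simp: restr_def set_eq_iff)
  then have "\<phi> \<inter> \<Lambda> \<times> space M = \<psi> \<inter> \<Lambda> \<times> space M" by auto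
  moreover have hit: "fst z \<in> fst ` (\<phi> - {z}) \<longleftrightarrow> fst z \<in> fst ` (\<psi> - {z})" if "fst z \<in> \<Lambda>" for z
    using mem that by (fastforce simp: image_iff)
  ultimately show ?thesis
    unfolding collisions_def
  proof (intro sum.cong)
    fix z assume "z \<in> \<psi> \<inter> \<Lambda> \<times> space M"
    then have "fst z \<in> \<Lambda>" by auto
    from hit[OF this] show "(if fst z \<in> fst ` (\<phi> - {z}) then 1 else 0) = (if fst z \<in> fst ` (\<psi> - {z}) then 1 else (0 :: ennreal))"
      by (simp only:)
  qed
qed

lemma simple_locs_iff:
  fixes \<phi> :: "('d::finite, 'm) marked set"
  assumes \<phi>: "\<phi> \<in> space (configs M)"
  shows "simple_locs \<phi> \<longleftrightarrow> (\<forall>n::nat. collisions M (ball 0 (real n)) \<phi> = 0)"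
proof
  assume s: "simple_locs \<phi>"
  show "\<forall>n::nat. collisions M (ball 0 (real n)) \<phi> = 0"
    unfolding collisions_def
  proof (intro allI sum.neutral ballI)
    fix n :: nat and z assume "z \<in> \<phi> \<inter> ball 0 (real n) \<times> space M"
    then have "fst z \<notin> fst ` (\<phi> - {z})" using simple_locs_remove[OF s] by blast
    then show "(if fst z \<in> fst ` (\<phi> - {z}) then 1 else 0) = (0 :: ennreal)" by (simp only: if_False)
  qed
next
  assume R: "\<forall>n::nat. collisions M (ball 0 (real n)) \<phi> = 0"
  show "simple_locs \<phi>"
    unfolding simple_locs_def
  proof (rule inj_onI, rule ccontr)
    fix z z' assume z: "z \<in> \<phi>" "z' \<in> \<phi>" "fst z = fst z'" "z \<noteq> z'"
    obtain n :: nat where "norm (fst z) < n" using reals_Archimedean2 by blast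
    then have zn: "z \<in> \<phi> \<inter> ball 0 (real n) \<times> space M"
      using z(1) config_subset[OF \<phi>] by (cases z) auto
    have fin: "finite (\<phi> \<inter> ball 0 (real n) \<times> space M)"
      using bdd_setsD(2)[OF bdd_sets_Times[OF bounded_borel_ball]] by (rule finite_config_Int[OF \<phi>])
    have sum0: "(\<Sum>z\<in>\<phi> \<inter> ball 0 (real n) \<times> space M. if fst z \<in> fst ` (\<phi> - {z}) then 1 else 0) = (0 :: ennreal)"
      using R unfolding collisions_def by blast
    have "(if fst z \<in> fst ` (\<phi> - {z}) then 1 else 0) = (0 :: ennreal)"
      by (rule bspec[OF iffD1[OF sum_eq_0_iff[OF fin] sum0] zn])
    then have "fst z \<notin> fst ` (\<phi> - {z})" by (metis zero_neq_one)
    then show False using z by (auto simp: image_iff)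
  qed
qed

context poisson
begin

text \<open>By Mecke the expected number of collisions is the expected \<open>mu M\<close> measure
  of the occupied locations in \<Lambda>, which is zero.\<close>

lemma AE_collisions_Q:
  assumes \<Lambda>: "bounded_borel \<Lambda>" shows "AE \<phi> in Q. collisions M \<Lambda> \<phi> = 0"
proof -
  have "(\<integral>\<^sup>+\<phi>. collisions M \<Lambda> \<phi> \<partial>Q)
      = (\<integral>\<^sup>+\<phi>. \<integral>\<^sup>+z. (if fst z \<in> fst ` \<phi> then 1 else 0) * indicator (\<Lambda> \<times> space M) z \<partial>mu M \<partial>Q)"
    using mecke[OF measurable_hit bdd_sets_Times[OF \<Lambda>]] by (simp add: collisions_def)
  also have "\<dots> = (\<integral>\<^sup>+\<phi>. \<integral>\<^sup>+(z :: ('d, 'm) marked). 0 \<partial>mu M \<partial>Q)"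
  proof (rule nn_integral_cong, rule nn_integral_cong_AE)
    fix \<phi> assume "\<phi> \<in> space Q"
    then have "AE z in mu M. fst z \<notin> fst ` \<phi>" by (intro AE_not_location marks) (simp add: space_Q)
    then show "AE z in mu M. (if fst z \<in> fst ` \<phi> then 1 else 0) * indicator (\<Lambda> \<times> space M) z = (0 :: ennreal)"
      by eventually_elim auto
  qed
  finally have "(\<integral>\<^sup>+\<phi>. collisions M \<Lambda> \<phi> \<partial>Q) = 0" by simp
  then show ?thesis
    using measurable_collisions[OF \<Lambda>, of M] by (subst (asm) nn_integral_0_iff_AE) (auto cong: measurable_cong_sets simp: sets_Q)
qed

lemma AE_simple_Q: "AE \<phi> in Q. simple_locs \<phi>"
proof -
  have "AE \<phi> in Q. \<forall>n::nat. collisions M (ball 0 (real n)) \<phi> = 0"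
    unfolding AE_all_countable by (intro allI AE_collisions_Q bounded_borel_ball)
  with AE_space show ?thesis
    by eventually_elim (simp add: simple_locs_iff[of _ M] space_Q)
qed

end

locale gibbs_model = poisson M Q
  for M :: "'m measure" and Q :: "('d::finite, 'm) marked set measure" +
  fixes \<Theta> :: "(real ^ 'p::finite) set" and \<theta>s :: "real ^ 'p"
    and v :: "('d, 'm, 'p) stat"
    and P :: "('d, 'm) marked set measure" and D :: real
  assumes family: "exponential_family M \<Theta> v"
    and true_parameter: "\<theta>s \<in> interior \<Theta>"
    and gibbs: "gibbs_measure M Q v \<theta>s P"
    and stat: "stationary M P"
    and D_pos: "D > 0"
    and Exp: "exp_condition M \<Theta> v D"
begin

abbreviation V :: "('d, 'm) marked \<Rightarrow> ('d, 'm) marked set \<Rightarrow> real" where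
  "V z \<phi> \<equiv> local_energy v z \<phi> \<theta>s"

abbreviation H :: "(real ^ 'd) set \<Rightarrow> ('d, 'm) marked set \<Rightarrow> real" where
  "H \<Lambda> \<phi> \<equiv> energy v \<Lambda> \<phi> \<theta>s"

sublocale P: prob_space P
  using gibbs by (simp add: gibbs_measure_def)

sublocale PQ: pair_sigma_finite P Q ..

lemma sets_P [measurable_cong]: "sets P = sets (configs M)"
  using gibbs by (simp add: gibbs_measure_def)

lemma space_P: "space P = space (configs M)"
  using sets_P by (rule sets_eq_imp_space_eq)

lemma \<theta>s_in: "\<theta>s \<in> \<Theta>"
  using true_parameter interior_subset by blast

subsection \<open>The local energy\<close>

lemma H_measurable:
  assumes \<Lambda>: "bounded_borel \<Lambda>"
  shows "(\<lambda>\<phi>. H \<Lambda> \<phi>) \<in> borel_measurable (configs M)"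
proof -
  have [measurable]: "v \<Lambda> \<in> borel_measurable (configs M)"
    using family \<Lambda> by (simp add: exponential_family_def)
  show ?thesis unfolding energy_def by measurable
qed

lemma H_insert:
  assumes "bounded_borel \<Lambda>" "z \<in> \<Lambda> \<times> space M" "\<phi> \<in> space (configs M)"
  shows "H \<Lambda> (insert z \<phi>) = H \<Lambda> \<phi> + V z \<phi>"
proof -
  obtain x m where z: "z = (x, m)" "x \<in> \<Lambda>" "m \<in> space M" using assms(2) by auto
  show ?thesis
    unfolding local_energy_def z(1) local_stat_eq[OF family true_parameter assms(1) z(2,3) assms(3)] energy_def
    by (simp add: inner_diff_right)
qed

text \<open>A jointly measurable version of the local energy. \<open>V\<close> evaluates the energy
  in the region consisting of the point itself, which moves with the point; a fixed region \<Lambda>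
  gives the same difference, and \<open>add_point\<close> makes the insertion measurable. At an
  occupied location the value is 0.\<close>

definition Vm :: "(real ^ 'd) set \<Rightarrow> ('d, 'm) marked \<times> ('d, 'm) marked set \<Rightarrow> real" where
  "Vm \<Lambda> = (\<lambda>(z, \<phi>). H \<Lambda> (add_point z \<phi>) - H \<Lambda> \<phi>)"

lemma Vm_measurable:
  assumes \<Lambda>: "bounded_borel \<Lambda>" shows "Vm \<Lambda> \<in> borel_measurable (mu M \<Otimes>\<^sub>M configs M)"
proof -
  note [measurable] = H_measurable[OF \<Lambda>] measurable_add_point
  show ?thesis unfolding Vm_def by measurable
qed

lemma Vm_eq:
  assumes "bounded_borel \<Lambda>" "z \<in> \<Lambda> \<times> space M" "\<phi> \<in> space (configs M)" "fst z \<notin> fst ` \<phi>"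
  shows "Vm \<Lambda> (z, \<phi>) = V z \<phi>"
  using H_insert[OF assms(1-3)] by (simp add: Vm_def add_point_eq[OF assms(4)])

lemma Vm_AE_eq:
  assumes "bounded_borel \<Lambda>" "\<phi> \<in> space (configs M)"
  shows "AE z in mu M. z \<in> \<Lambda> \<times> space M \<longrightarrow> Vm \<Lambda> (z, \<phi>) = V z \<phi>"
  using AE_not_location[OF marks assms(2)] by eventually_elim (use Vm_eq[OF assms(1) _ assms(2)] in blast)

lemma V_translate:
  assumes "\<phi> \<in> space (configs M)" "m \<in> space M"
  shows "V (x + y, m) (translate y \<phi>) = V (x, m) \<phi>"
proof -
  have inv: "energy v ((\<lambda>x. x + y) ` {x}) (translate y \<psi>) \<theta>s = energy v {x} \<psi> \<theta>s"
    if "\<psi> \<in> space (configs M)" for \<psi>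
  proof -
    have "bounded_borel {x}" by (simp add: bounded_borel_def)
    with family \<theta>s_in that show ?thesis
      unfolding exponential_family_def translation_invariant_energy_def by blast
  qed
  have "insert (x, m) \<phi> \<in> space (configs M)"
    using assms by (intro config_insert) auto
  from inv[OF this] inv[OF assms(1)] show ?thesis
    by (simp add: local_energy_def local_stat_def energy_def inner_diff_right translate_insert)
qed

lemma V_at_0:
  assumes "\<phi> \<in> space (configs M)" "m \<in> space M"
  shows "V (x, m) \<phi> = V (0, m) (translate (- x) \<phi>)"
  using V_translate[OF assms, of x "- x"] by simp

text \<open>(Exp) speaks about points at the origin; translation invariance of the energy carries
  the range D to every location.\<close>

lemma V_range:
  assumes \<phi>: "\<phi> \<in> space (configs M)" and m: "m \<in> space M"
  shows "V (x, m) \<phi> = V (x, m) (restr \<phi> (unif_ball x D))"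
proof -
  have *: "local_stat v (0, m) \<psi> = local_stat v (0, m) (restr \<psi> (unif_ball 0 D))" if "\<psi> \<in> space (configs M)" for \<psi>
    using Exp m that unfolding exp_condition_def vec_eq_iff by blast
  have "(\<lambda>y. y - (- x)) ` unif_ball 0 D = unif_ball x D"
    by (force simp: unif_ball_def image_iff)
  then have "restr (translate (- x) \<phi>) (unif_ball 0 D) = translate (- x) (restr \<phi> (unif_ball x D))"
    by (simp add: restr_translate)
  then have "V (0, m) (translate (- x) \<phi>) = V (0, m) (translate (- x) (restr \<phi> (unif_ball x D)))"
    using *[OF config_translate[OF \<phi>]] by (simp add: local_energy_def)
  then show ?thesis
    using V_at_0[OF \<phi> m] V_at_0[OF config_restr[OF \<phi>] m] by simp
qed

lemma V_cong:
  assumes "\<phi> \<in> space (configs M)" "\<psi> \<in> space (configs M)" "snd z \<in> space M"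
    and "restr \<phi> (unif_ball (fst z) D) = restr \<psi> (unif_ball (fst z) D)"
  shows "V z \<phi> = V z \<psi>"
  using V_range[OF assms(1,3), of "fst z"] V_range[OF assms(2,3), of "fst z"] assms(4) by simp

text \<open>Coordinate by coordinate, at the true parameter: either \<theta> i is nonnegative and v
  i is bounded below, or v i is bounded on both sides and the sign of \<theta> i does not
  matter.\<close>

lemma V_lower_bound_ex: "\<exists>K\<ge>0. \<forall>z \<phi>. snd z \<in> space M \<longrightarrow> \<phi> \<in> space (configs M) \<longrightarrow> - K \<le> V z \<phi>"
proof -
  have "\<exists>k. \<forall>m\<in>space M. \<forall>\<phi>\<in>space (configs M). - k \<le> \<theta>s $ i * local_stat v (0, m) \<phi> $ i" for i
  proof -
    obtain \<kappa>inf \<kappa>sup where "0 \<le> \<kappa>inf" "0 \<le> \<kappa>sup" and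
      *: "0 \<le> \<theta>s $ i \<and> (\<forall>m\<in>space M. \<forall>\<phi>\<in>space (configs M). - \<kappa>inf \<le> local_stat v (0, m) \<phi> $ i) \<or>
      (\<forall>m\<in>space M. \<forall>\<phi>\<in>space (configs M). - \<kappa>inf \<le> local_stat v (0, m) \<phi> $ i \<and> local_stat v (0, m) \<phi> $ i \<le> \<kappa>sup)"
      using Exp \<theta>s_in unfolding exp_condition_def by metis
    from * show ?thesis
    proof
      assume A: "0 \<le> \<theta>s $ i \<and> (\<forall>m\<in>space M. \<forall>\<phi>\<in>space (configs M). - \<kappa>inf \<le> local_stat v (0, m) \<phi> $ i)"
      then have "\<theta>s $ i * (- \<kappa>inf) \<le> \<theta>s $ i * local_stat v (0, m) \<phi> $ i"
        if "m \<in> space M" "\<phi> \<in> space (configs M)" for m \<phi>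
        using that by (intro mult_left_mono) auto
      then show ?thesis by (intro exI[of _ "\<theta>s $ i * \<kappa>inf"]) auto
    next
      assume A: "\<forall>m\<in>space M. \<forall>\<phi>\<in>space (configs M). - \<kappa>inf \<le> local_stat v (0, m) \<phi> $ i \<and> local_stat v (0, m) \<phi> $ i \<le> \<kappa>sup"
      have "- (\<bar>\<theta>s $ i\<bar> * (\<kappa>inf + \<kappa>sup)) \<le> \<theta>s $ i * local_stat v (0, m) \<phi> $ i"
        if "m \<in> space M" "\<phi> \<in> space (configs M)" for m \<phi>
      proof -
        have "\<bar>local_stat v (0, m) \<phi> $ i\<bar> \<le> \<kappa>inf + \<kappa>sup"
          using A that \<open>0 \<le> \<kappa>inf\<close> \<open>0 \<le> \<kappa>sup\<close> by (force simp: abs_le_iff)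
        then have "\<bar>\<theta>s $ i * local_stat v (0, m) \<phi> $ i\<bar> \<le> \<bar>\<theta>s $ i\<bar> * (\<kappa>inf + \<kappa>sup)"
          unfolding abs_mult by (rule mult_left_mono) simp
        then show ?thesis by linarith
      qed
      then show ?thesis by blast
    qed
  qed
  then obtain k where k: "\<And>i m \<phi>. m \<in> space M \<Longrightarrow> \<phi> \<in> space (configs M) \<Longrightarrow> - k i \<le> \<theta>s $ i * local_stat v (0, m) \<phi> $ i"
    by metis
  let ?K = "\<bar>\<Sum>i\<in>UNIV. k i\<bar>"
  have "- ?K \<le> V z \<phi>" if "snd z \<in> space M" "\<phi> \<in> space (configs M)" for z \<phi>
  proof -
    obtain x m where z: "z = (x, m)" by force
    have "(\<Sum>i\<in>UNIV. - k i) \<le> V (0, m) (translate (- x) \<phi>)"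
      unfolding local_energy_def inner_vec_def inner_real_def
      using that z by (intro sum_mono k config_translate) auto
    then show ?thesis
      using V_at_0[OF that(2), of m x] that(1) unfolding z by (simp add: sum_negf)
  qed
  then show ?thesis by (intro exI[of _ ?K]) auto
qed

definition K :: real where
  "K = (SOME K. K \<ge> 0 \<and> (\<forall>z \<phi>. snd z \<in> space M \<longrightarrow> \<phi> \<in> space (configs M) \<longrightarrow> - K \<le> V z \<phi>))"

lemma K: "K \<ge> 0" "snd z \<in> space M \<Longrightarrow> \<phi> \<in> space (configs M) \<Longrightarrow> - K \<le> V z \<phi>"
  using someI_ex[OF V_lower_bound_ex[unfolded Bex_def]] unfolding K_def by blast+

subsection \<open>The equilibrium equations\<close>

abbreviation glue :: "(real ^ 'd) set \<Rightarrow> ('d, 'm) marked set \<Rightarrow> ('d, 'm) marked set \<Rightarrow> ('d, 'm) marked set" where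
  "glue \<Lambda> \<psi> \<phi> \<equiv> restr \<psi> \<Lambda> \<union> restr \<phi> (- \<Lambda>)"

text \<open>The density with respect to \<open>Q\<close> of the conditional law inside \<Lambda>
  given the exterior of \<phi>; \<psi> is the Poisson sample whose restriction is glued in.\<close>

definition w :: "(real ^ 'd) set \<Rightarrow> ('d, 'm) marked set \<Rightarrow> ('d, 'm) marked set \<Rightarrow> ennreal" where
  "w \<Lambda> \<phi> \<psi> = ennreal (exp (- H \<Lambda> (glue \<Lambda> \<psi> \<phi>))) / partition_function Q v \<theta>s \<Lambda> \<phi>"

lemma config_glue: "\<phi> \<in> space (configs M) \<Longrightarrow> \<psi> \<in> space (configs M) \<Longrightarrow> glue \<Lambda> \<psi> \<phi> \<in> space (configs M)"
  by (intro config_Un config_restr)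

lemma measurable_glue_pair:
  assumes "bounded_borel \<Lambda>"
  shows "(\<lambda>(\<phi>, \<psi>). glue \<Lambda> \<psi> \<phi>) \<in> measurable (P \<Otimes>\<^sub>M Q) (configs M)"
proof -
  have "\<Lambda> \<in> sets borel" using assms by (simp add: bounded_borel_def)
  from measurable_glue[OF _ _ this, of snd "P \<Otimes>\<^sub>M Q" M fst]
  show ?thesis by (simp add: case_prod_beta)
qed

lemma boltzmann_measurable:
  assumes \<Lambda>: "bounded_borel \<Lambda>"
  shows "(\<lambda>(\<phi>, \<psi>). ennreal (exp (- H \<Lambda> (glue \<Lambda> \<psi> \<phi>)))) \<in> borel_measurable (P \<Otimes>\<^sub>M Q)"
  using measurable_compose[OF measurable_glue_pair[OF \<Lambda>] H_measurable[OF \<Lambda>]]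
  by (simp add: case_prod_beta)

lemma partition_function_measurable:
  assumes \<Lambda>: "bounded_borel \<Lambda>"
  shows "(\<lambda>\<phi>. partition_function Q v \<theta>s \<Lambda> \<phi>) \<in> borel_measurable P"
  unfolding partition_function_def gibbs_weight_def
  using Q.borel_measurable_nn_integral_fst[OF boltzmann_measurable[OF \<Lambda>]] by simp

lemma w_measurable:
  assumes \<Lambda>: "bounded_borel \<Lambda>" shows "(\<lambda>(\<phi>, \<psi>). w \<Lambda> \<phi> \<psi>) \<in> borel_measurable (P \<Otimes>\<^sub>M Q)"
proof -
  note [measurable] = boltzmann_measurable[OF \<Lambda>] partition_function_measurable[OF \<Lambda>]
  show ?thesis unfolding w_def by measurable
qed

lemma gibbs_weight_eq:
  assumes \<Lambda>: "bounded_borel \<Lambda>" and A: "A \<in> sets (configs M)" and \<phi>: "\<phi> \<in> space P"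
  shows "gibbs_weight Q v \<theta>s \<Lambda> \<phi> A / partition_function Q v \<theta>s \<Lambda> \<phi> = (\<integral>\<^sup>+\<psi>. indicator A (restr \<psi> \<Lambda>) * w \<Lambda> \<phi> \<psi> \<partial>Q)"
proof -
  have [measurable]: "\<Lambda> \<in> sets borel" using \<Lambda> by (simp add: bounded_borel_def)
  note [measurable] = boltzmann_measurable[OF \<Lambda>] A \<phi>
  have [measurable]: "(\<lambda>\<psi>. ennreal (exp (- H \<Lambda> (glue \<Lambda> \<psi> \<phi>)))) \<in> borel_measurable Q"
    using measurable_compose[OF measurable_Pair1'[OF \<phi>] boltzmann_measurable[OF \<Lambda>]] by simp
  have "(\<lambda>\<psi>. indicator A (restr \<psi> \<Lambda>) * ennreal (exp (- H \<Lambda> (glue \<Lambda> \<psi> \<phi>)))) \<in> borel_measurable Q"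
    by measurable
  from nn_integral_divide[OF this, of "partition_function Q v \<theta>s \<Lambda> \<phi>"]
  show ?thesis
    unfolding gibbs_weight_def w_def by (simp add: ennreal_times_divide)
qed

text \<open>The Gibbs property fixes the joint law of inside and outside on rectangles, an
  intersection-stable generator. The right-hand law resamples the inside from \<open>Q\<close> with
  weight \<open>w\<close>.\<close>

lemma dlr_measure:
  assumes \<Lambda>: "bounded_borel \<Lambda>"
  shows "distr P (configs M \<Otimes>\<^sub>M configs M) (\<lambda>\<phi>. (restr \<phi> \<Lambda>, restr \<phi> (- \<Lambda>))) =
    distr (density (P \<Otimes>\<^sub>M Q) (\<lambda>(\<phi>, \<psi>). w \<Lambda> \<phi> \<psi>)) (configs M \<Otimes>\<^sub>M configs M) (\<lambda>(\<phi>, \<psi>). (restr \<psi> \<Lambda>, restr \<phi> (- \<Lambda>)))"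
    (is "?L = ?R")
proof -
  let ?C = "configs M :: ('d, 'm) marked set measure"
  have b [measurable]: "\<Lambda> \<in> sets borel" using \<Lambda> by (simp add: bounded_borel_def)
  have [measurable]: "- \<Lambda> \<in> sets borel" using b by (rule borel_comp)
  note [measurable] = w_measurable[OF \<Lambda>]
  let ?E = "{a \<times> b |a b. a \<in> sets ?C \<and> b \<in> sets ?C}"
  have rect: "emeasure ?L (A \<times> B) = emeasure ?R (A \<times> B)" if [measurable]: "A \<in> sets ?C" "B \<in> sets ?C" for A B
  proof -
    have "emeasure ?L (A \<times> B) = emeasure P {\<phi> \<in> space P. restr \<phi> \<Lambda> \<in> A \<and> restr \<phi> (- \<Lambda>) \<in> B}"
      by (subst emeasure_distr) (auto intro!: arg_cong[where f="emeasure P"])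
    also have "\<dots> = (\<integral>\<^sup>+ \<phi>. indicator B (restr \<phi> (- \<Lambda>)) *
              (gibbs_weight Q v \<theta>s \<Lambda> \<phi> A / partition_function Q v \<theta>s \<Lambda> \<phi>) \<partial>P)"
      using gibbs \<Lambda> that unfolding gibbs_measure_def by blast
    also have "\<dots> = (\<integral>\<^sup>+ \<phi>. indicator B (restr \<phi> (- \<Lambda>)) * (\<integral>\<^sup>+\<psi>. indicator A (restr \<psi> \<Lambda>) * w \<Lambda> \<phi> \<psi> \<partial>Q) \<partial>P)"
      by (intro nn_integral_cong) (simp add: gibbs_weight_eq[OF \<Lambda>])
    also have "\<dots> = (\<integral>\<^sup>+ \<phi>. \<integral>\<^sup>+\<psi>. w \<Lambda> \<phi> \<psi> * indicator (A \<times> B) (restr \<psi> \<Lambda>, restr \<phi> (- \<Lambda>)) \<partial>Q \<partial>P)"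
    proof (intro nn_integral_cong)
      fix \<phi> assume \<phi>: "\<phi> \<in> space P"
      have [measurable]: "(\<lambda>\<psi>. w \<Lambda> \<phi> \<psi>) \<in> borel_measurable Q"
        using measurable_compose[OF measurable_Pair1'[OF \<phi>] w_measurable[OF \<Lambda>]] by simp
      show "indicator B (restr \<phi> (- \<Lambda>)) * (\<integral>\<^sup>+\<psi>. indicator A (restr \<psi> \<Lambda>) * w \<Lambda> \<phi> \<psi> \<partial>Q) =
         (\<integral>\<^sup>+\<psi>. w \<Lambda> \<phi> \<psi> * indicator (A \<times> B) (restr \<psi> \<Lambda>, restr \<phi> (- \<Lambda>)) \<partial>Q)"
        by (subst nn_integral_cmult[symmetric]) (measurable, auto intro!: nn_integral_cong simp: indicator_def)
    qed
    also have "\<dots> = (\<integral>\<^sup>+ x. (case x of (\<phi>, \<psi>) \<Rightarrow> w \<Lambda> \<phi> \<psi>) * indicator ((\<lambda>(\<phi>, \<psi>). (restr \<psi> \<Lambda>, restr \<phi> (- \<Lambda>))) -` (A \<times> B) \<inter> space (P \<Otimes>\<^sub>M Q)) x \<partial>(P \<Otimes>\<^sub>M Q))"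
      by (subst Q.nn_integral_fst[symmetric])
        (measurable, auto intro!: nn_integral_cong simp: indicator_def space_pair_measure)
    also have "\<dots> = emeasure ?R (A \<times> B)"
      by (subst emeasure_distr, measurable, subst emeasure_density, measurable)
    finally show ?thesis .
  qed
  show ?thesis
  proof (rule measure_eqI_generator_eq[where E="?E" and \<Omega>="space ?C \<times> space ?C" and A="\<lambda>_. space ?C \<times> space ?C"])
    show "Int_stable ?E" by (rule Int_stable_pair_measure_generator)
    show "?E \<subseteq> Pow (space ?C \<times> space ?C)" by (rule pair_measure_closed)
    show "emeasure ?L X = emeasure ?R X" if "X \<in> ?E" for X using that rect by auto
    show "sets ?L = sigma_sets (space ?C \<times> space ?C) ?E" by (simp add: sets_pair_measure)
    show "sets ?R = sigma_sets (space ?C \<times> space ?C) ?E" by (simp add: sets_pair_measure)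
    show "range (\<lambda>_. space ?C \<times> space ?C) \<subseteq> ?E" by auto
    show "(\<Union>i::nat. space ?C \<times> space ?C) = space ?C \<times> space ?C" by auto
    interpret L: prob_space ?L by (rule P.prob_space_distr) measurable
    show "emeasure ?L (space ?C \<times> space ?C) \<noteq> \<infinity>" by simp
  qed
qed

text \<open>A configuration is recovered by gluing its inside and outside, so the equality of joint
  laws integrates every nonnegative functional.\<close>

lemma dlr:
  assumes \<Lambda>: "bounded_borel \<Lambda>" and F: "F \<in> borel_measurable (configs M)"
  shows "(\<integral>\<^sup>+\<phi>. F \<phi> \<partial>P) = (\<integral>\<^sup>+\<phi>. \<integral>\<^sup>+\<psi>. F (glue \<Lambda> \<psi> \<phi>) * w \<Lambda> \<phi> \<psi> \<partial>Q \<partial>P)"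
proof -
  let ?C = "configs M :: ('d, 'm) marked set measure"
  have b [measurable]: "\<Lambda> \<in> sets borel" using \<Lambda> by (simp add: bounded_borel_def)
  have [measurable]: "- \<Lambda> \<in> sets borel" using b by (rule borel_comp)
  note [measurable] = w_measurable[OF \<Lambda>]
  let ?U = "\<lambda>x. F (glue \<Lambda> (fst x) (snd x))"
  have [measurable]: "(\<lambda>x. glue \<Lambda> (fst x) (snd x)) \<in> measurable (?C \<Otimes>\<^sub>M ?C) ?C"
    by (rule measurable_glue[OF _ _ b]) auto
  have U [measurable]: "?U \<in> borel_measurable (?C \<Otimes>\<^sub>M ?C)"
    using measurable_compose[OF \<open>(\<lambda>x. glue \<Lambda> (fst x) (snd x)) \<in> _\<close> F] .
  have gl: "glue \<Lambda> (restr \<psi> \<Lambda>) (restr \<phi> (- \<Lambda>)) = glue \<Lambda> \<psi> \<phi>" for \<phi> \<psi> :: "('d, 'm) marked set"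
    by (auto simp: restr_def)
  have "(\<integral>\<^sup>+\<phi>. F \<phi> \<partial>P) = (\<integral>\<^sup>+\<phi>. ?U (restr \<phi> \<Lambda>, restr \<phi> (- \<Lambda>)) \<partial>P)"
    by (simp only: fst_conv snd_conv gl restr_glue[symmetric])
  also have "\<dots> = (\<integral>\<^sup>+x. ?U x \<partial>distr P (?C \<Otimes>\<^sub>M ?C) (\<lambda>\<phi>. (restr \<phi> \<Lambda>, restr \<phi> (- \<Lambda>))))"
    by (subst nn_integral_distr) measurable
  also have "\<dots> = (\<integral>\<^sup>+x. ?U x \<partial>distr (density (P \<Otimes>\<^sub>M Q) (\<lambda>(\<phi>, \<psi>). w \<Lambda> \<phi> \<psi>)) (?C \<Otimes>\<^sub>M ?C) (\<lambda>(\<phi>, \<psi>). (restr \<psi> \<Lambda>, restr \<phi> (- \<Lambda>))))"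
    unfolding dlr_measure[OF \<Lambda>] ..
  also have "\<dots> = (\<integral>\<^sup>+x. ?U ((\<lambda>(\<phi>, \<psi>). (restr \<psi> \<Lambda>, restr \<phi> (- \<Lambda>))) x) \<partial>density (P \<Otimes>\<^sub>M Q) (\<lambda>(\<phi>, \<psi>). w \<Lambda> \<phi> \<psi>))"
    by (subst nn_integral_distr) measurable
  also have "\<dots> = (\<integral>\<^sup>+x. (\<lambda>(\<phi>, \<psi>). w \<Lambda> \<phi> \<psi>) x * ?U ((\<lambda>(\<phi>, \<psi>). (restr \<psi> \<Lambda>, restr \<phi> (- \<Lambda>))) x) \<partial>(P \<Otimes>\<^sub>M Q))"
    by (subst nn_integral_density) measurable
  also have "\<dots> = (\<integral>\<^sup>+\<phi>. \<integral>\<^sup>+\<psi>. w \<Lambda> \<phi> \<psi> * ?U (restr \<psi> \<Lambda>, restr \<phi> (- \<Lambda>)) \<partial>Q \<partial>P)"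
  proof (subst Q.nn_integral_fst[symmetric])
    have "(\<lambda>(\<phi>, \<psi>). (restr \<psi> \<Lambda>, restr \<phi> (- \<Lambda>))) \<in> measurable (P \<Otimes>\<^sub>M Q) (?C \<Otimes>\<^sub>M ?C)" by measurable
    from measurable_compose[OF this U]
    show "(\<lambda>x. (case x of (\<phi>, \<psi>) \<Rightarrow> w \<Lambda> \<phi> \<psi>) * ?U ((\<lambda>(\<phi>, \<psi>). (restr \<psi> \<Lambda>, restr \<phi> (- \<Lambda>))) x)) \<in> borel_measurable (P \<Otimes>\<^sub>M Q)"
      using w_measurable[OF \<Lambda>] by (intro borel_measurable_times_ennreal) auto
  qed simp
  finally show ?thesis by (simp only: fst_conv snd_conv gl mult.commute)
qed

text \<open>Resampling the interior of a ball replaces its collisions by those of a Poisson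
  configuration, which has none. Countably many balls exhaust the space.\<close>

lemma AE_simple_P: "AE \<phi> in P. simple_locs \<phi>"
proof -
  have "AE \<phi> in P. \<forall>n::nat. collisions M (ball 0 (real n)) \<phi> = 0"
    unfolding AE_all_countable
  proof
    fix n :: nat
    let ?\<Lambda> = "ball (0 :: real ^ 'd) (real n)"
    have \<Lambda>: "bounded_borel ?\<Lambda>" by (rule bounded_borel_ball)
    have "(\<integral>\<^sup>+\<phi>. collisions M ?\<Lambda> \<phi> \<partial>P) = (\<integral>\<^sup>+\<phi>. \<integral>\<^sup>+\<psi>. collisions M ?\<Lambda> (glue ?\<Lambda> \<psi> \<phi>) * w ?\<Lambda> \<phi> \<psi> \<partial>Q \<partial>P)"
      by (rule dlr[OF \<Lambda> measurable_collisions[OF \<Lambda>]])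
    also have "\<dots> = (\<integral>\<^sup>+\<phi>. \<integral>\<^sup>+\<psi>. 0 \<partial>Q \<partial>P)"
    proof (rule nn_integral_cong, rule nn_integral_cong_AE)
      fix \<phi> assume "\<phi> \<in> space P"
      then have eq: "collisions M ?\<Lambda> (glue ?\<Lambda> \<psi> \<phi>) = collisions M ?\<Lambda> \<psi>" if "\<psi> \<in> space Q" for \<psi>
        using that by (intro collisions_cong config_glue) (auto simp: restr_def space_P space_Q)
      show "AE \<psi> in Q. collisions M ?\<Lambda> (glue ?\<Lambda> \<psi> \<phi>) * w ?\<Lambda> \<phi> \<psi> = 0"
        using AE_collisions_Q[OF \<Lambda>] AE_space[of Q] by eventually_elim (simp add: eq)
    qed
    finally have "(\<integral>\<^sup>+\<phi>. collisions M ?\<Lambda> \<phi> \<partial>P) = 0" by simp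
    then show "AE \<phi> in P. collisions M ?\<Lambda> \<phi> = 0"
      using measurable_collisions[OF \<Lambda>, of M] by (subst (asm) nn_integral_0_iff_AE) (auto cong: measurable_cong_sets simp: sets_P)
  qed
  with AE_space show ?thesis
    by eventually_elim (simp add: simple_locs_iff[of _ M] space_P)
qed

section \<open>The Georgii--Nguyen--Zessin formula\<close>

lemma papangelou_measurable:
  assumes f: "f \<in> borel_measurable (mu M \<Otimes>\<^sub>M configs M)" and \<Lambda>: "bounded_borel \<Lambda>"
  shows "(\<lambda>\<phi>. \<integral>\<^sup>+z. f (z, \<phi>) * ennreal (exp (- V z \<phi>)) * indicator (\<Lambda> \<times> space M) z \<partial>mu M) \<in> borel_measurable (configs M)"
proof -
  have [measurable]: "\<Lambda> \<times> space M \<in> sets (mu M)" by (rule bdd_setsD(1)[OF bdd_sets_Times[OF \<Lambda>]])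
  note [measurable] = f Vm_measurable[OF \<Lambda>]
  have eq: "(\<integral>\<^sup>+z. f (z, \<phi>) * ennreal (exp (- V z \<phi>)) * indicator (\<Lambda> \<times> space M) z \<partial>mu M)
      = (\<integral>\<^sup>+z. f (z, \<phi>) * ennreal (exp (- Vm \<Lambda> (z, \<phi>))) * indicator (\<Lambda> \<times> space M) z \<partial>mu M)"
    if "\<phi> \<in> space (configs M)" for \<phi>
    using Vm_AE_eq[OF \<Lambda> that] by (intro nn_integral_cong_AE, eventually_elim) (auto simp: indicator_def)
  have "(\<lambda>\<phi>. \<integral>\<^sup>+z. f (z, \<phi>) * ennreal (exp (- Vm \<Lambda> (z, \<phi>))) * indicator (\<Lambda> \<times> space M) z \<partial>mu M) \<in> borel_measurable (configs M)"
    by measurable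
  then show ?thesis by (subst measurable_cong[OF eq])
qed

text \<open>Resampling inside \<Lambda> replaces the Gibbs measure by the weighted Poisson process,
  to which Mecke applies. The Boltzmann weight with z present is exp (- V) times the weight without
  z, while the partition function depends on the exterior only; undoing the resampling gives the
  right-hand side.\<close>

lemma gnz:
  fixes f :: "('d, 'm) marked \<times> ('d, 'm) marked set \<Rightarrow> ennreal"
  assumes f: "f \<in> borel_measurable (mu M \<Otimes>\<^sub>M configs M)" and \<Lambda>: "bounded_borel \<Lambda>"
  shows "(\<integral>\<^sup>+\<phi>. (\<Sum>z\<in>\<phi> \<inter> \<Lambda> \<times> space M. f (z, \<phi> - {z})) \<partial>P)
    = (\<integral>\<^sup>+\<phi>. \<integral>\<^sup>+z. f (z, \<phi>) * ennreal (exp (- V z \<phi>)) * indicator (\<Lambda> \<times> space M) z \<partial>mu M \<partial>P)"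
proof -
  let ?C = "configs M :: ('d, 'm) marked set measure"
  let ?B = "\<Lambda> \<times> space M"
  have B: "?B \<in> bdd_sets M" by (rule bdd_sets_Times[OF \<Lambda>])
  have b: "\<Lambda> \<in> sets borel" using \<Lambda> by (simp add: bounded_borel_def)
  have "(\<integral>\<^sup>+\<phi>. (\<Sum>z\<in>\<phi> \<inter> ?B. f (z, \<phi> - {z})) \<partial>P)
    = (\<integral>\<^sup>+\<phi>. \<integral>\<^sup>+\<psi>. (\<Sum>z\<in>glue \<Lambda> \<psi> \<phi> \<inter> ?B. f (z, glue \<Lambda> \<psi> \<phi> - {z})) * w \<Lambda> \<phi> \<psi> \<partial>Q \<partial>P)"
    by (rule dlr[OF \<Lambda> measurable_sum_points[OF f B]])
  also have "\<dots> = (\<integral>\<^sup>+\<phi>. \<integral>\<^sup>+\<psi>. (\<integral>\<^sup>+z. f (z, glue \<Lambda> \<psi> \<phi>) * ennreal (exp (- V z (glue \<Lambda> \<psi> \<phi>))) * indicator ?B z \<partial>mu M) * w \<Lambda> \<phi> \<psi> \<partial>Q \<partial>P)"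
  proof (rule nn_integral_cong)
    fix \<phi> assume "\<phi> \<in> space P"
    then have \<phi>: "\<phi> \<in> space ?C" by (simp add: space_P)
    let ?Z = "partition_function Q v \<theta>s \<Lambda> \<phi>"
    \<comment> \<open>The integrand fed to Mecke carries the weight of the configuration with z put
      back. \<open>add_point\<close> keeps it jointly measurable; it returns \<psi> after removal of
      a point when \<psi> is simple, and it is a true insertion for almost every z.\<close>
    define g where "g = (\<lambda>(z, \<psi>). f (z, glue \<Lambda> \<psi> \<phi>) * (ennreal (exp (- H \<Lambda> (glue \<Lambda> (add_point z \<psi>) \<phi>))) / ?Z))"
    have g: "g \<in> borel_measurable (mu M \<Otimes>\<^sub>M ?C)"
    proof -
      note [measurable] = f H_measurable[OF \<Lambda>]
      have [measurable]: "(\<lambda>x. glue \<Lambda> (snd x) \<phi>) \<in> measurable (mu M \<Otimes>\<^sub>M ?C) ?C"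
        using \<phi> by (intro measurable_glue b measurable_const measurable_snd)
      have [measurable]: "(\<lambda>x. glue \<Lambda> (add_point (fst x) (snd x)) \<phi>) \<in> measurable (mu M \<Otimes>\<^sub>M ?C) ?C"
        using \<phi> by (intro measurable_glue b measurable_const measurable_add_point measurable_fst measurable_snd)
      show ?thesis unfolding g_def case_prod_beta by measurable
    qed
    have "(\<integral>\<^sup>+\<psi>. (\<Sum>z\<in>glue \<Lambda> \<psi> \<phi> \<inter> ?B. f (z, glue \<Lambda> \<psi> \<phi> - {z})) * w \<Lambda> \<phi> \<psi> \<partial>Q)
        = (\<integral>\<^sup>+\<psi>. (\<Sum>z\<in>\<psi> \<inter> ?B. g (z, \<psi> - {z})) \<partial>Q)"
    proof (rule nn_integral_cong_AE)
      show "AE \<psi> in Q. (\<Sum>z\<in>glue \<Lambda> \<psi> \<phi> \<inter> ?B. f (z, glue \<Lambda> \<psi> \<phi> - {z})) * w \<Lambda> \<phi> \<psi> = (\<Sum>z\<in>\<psi> \<inter> ?B. g (z, \<psi> - {z}))"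
        using AE_simple_Q
      proof eventually_elim
        case (elim \<psi>)
        have "g (z, \<psi> - {z}) = f (z, glue \<Lambda> \<psi> \<phi> - {z}) * w \<Lambda> \<phi> \<psi>" if "z \<in> \<psi> \<inter> ?B" for z
        proof -
          have "glue \<Lambda> (\<psi> - {z}) \<phi> = glue \<Lambda> \<psi> \<phi> - {z}"
            using that by (auto simp: restr_def)
          then show ?thesis
            using that add_point_remove[OF elim, of z] by (simp add: g_def w_def)
        qed
        moreover have "glue \<Lambda> \<psi> \<phi> \<inter> ?B = \<psi> \<inter> ?B" by (auto simp: restr_def)
        ultimately show ?case by (simp add: sum_distrib_right)
      qed
    qed
    also have "\<dots> = (\<integral>\<^sup>+\<psi>. \<integral>\<^sup>+z. g (z, \<psi>) * indicator ?B z \<partial>mu M \<partial>Q)"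
      by (rule mecke[OF g B])
    also have "\<dots> = (\<integral>\<^sup>+\<psi>. (\<integral>\<^sup>+z. f (z, glue \<Lambda> \<psi> \<phi>) * ennreal (exp (- V z (glue \<Lambda> \<psi> \<phi>))) * indicator ?B z \<partial>mu M) * w \<Lambda> \<phi> \<psi> \<partial>Q)"
    proof (rule nn_integral_cong)
      fix \<psi> assume "\<psi> \<in> space Q"
      then have \<psi>: "\<psi> \<in> space ?C" by (simp add: space_Q)
      let ?\<chi> = "glue \<Lambda> \<psi> \<phi>"
      have \<chi>: "?\<chi> \<in> space ?C" using \<phi> \<psi> by (rule config_glue)
      have "(\<integral>\<^sup>+z. g (z, \<psi>) * indicator ?B z \<partial>mu M)
        = (\<integral>\<^sup>+z. (f (z, ?\<chi>) * ennreal (exp (- Vm \<Lambda> (z, ?\<chi>))) * indicator ?B z) * w \<Lambda> \<phi> \<psi> \<partial>mu M)"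
      proof (rule nn_integral_cong_AE)
        show "AE z in mu M. g (z, \<psi>) * indicator ?B z = (f (z, ?\<chi>) * ennreal (exp (- Vm \<Lambda> (z, ?\<chi>))) * indicator ?B z) * w \<Lambda> \<phi> \<psi>"
          using AE_not_location[OF marks \<psi>] AE_not_location[OF marks \<chi>]
        proof eventually_elim
          case (elim z)
          show ?case
          proof (cases "z \<in> ?B")
            case True
            then have "glue \<Lambda> (add_point z \<psi>) \<phi> = insert z ?\<chi>"
              using elim by (auto simp: add_point_eq restr_def)
            then have "ennreal (exp (- H \<Lambda> (glue \<Lambda> (add_point z \<psi>) \<phi>))) = ennreal (exp (- Vm \<Lambda> (z, ?\<chi>))) * ennreal (exp (- H \<Lambda> ?\<chi>))"
              using elim H_insert[OF \<Lambda> True \<chi>] Vm_eq[OF \<Lambda> True \<chi>]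
              by (simp add: ennreal_mult[symmetric] exp_add[symmetric])
            then show ?thesis using True by (simp add: g_def w_def ennreal_times_divide mult.assoc)
          qed simp
        qed
      qed
      also have "\<dots> = (\<integral>\<^sup>+z. f (z, ?\<chi>) * ennreal (exp (- Vm \<Lambda> (z, ?\<chi>))) * indicator ?B z \<partial>mu M) * w \<Lambda> \<phi> \<psi>"
      proof (rule nn_integral_multc)
        note [measurable] = f Vm_measurable[OF \<Lambda>] bdd_setsD(1)[OF B]
        have [measurable]: "(\<lambda>z. (z, ?\<chi>)) \<in> measurable (mu M) (mu M \<Otimes>\<^sub>M ?C)" using \<chi> by simp
        show "(\<lambda>z. f (z, ?\<chi>) * ennreal (exp (- Vm \<Lambda> (z, ?\<chi>))) * indicator ?B z) \<in> borel_measurable (mu M)"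
          by measurable
      qed
      also have "(\<integral>\<^sup>+z. f (z, ?\<chi>) * ennreal (exp (- Vm \<Lambda> (z, ?\<chi>))) * indicator ?B z \<partial>mu M)
        = (\<integral>\<^sup>+z. f (z, ?\<chi>) * ennreal (exp (- V z ?\<chi>)) * indicator ?B z \<partial>mu M)"
        using Vm_AE_eq[OF \<Lambda> \<chi>] by (intro nn_integral_cong_AE, eventually_elim) (auto simp: indicator_def)
      finally show "(\<integral>\<^sup>+z. g (z, \<psi>) * indicator ?B z \<partial>mu M) =
        (\<integral>\<^sup>+z. f (z, ?\<chi>) * ennreal (exp (- V z ?\<chi>)) * indicator ?B z \<partial>mu M) * w \<Lambda> \<phi> \<psi>" .
    qed
    finally show "(\<integral>\<^sup>+\<psi>. (\<Sum>z\<in>glue \<Lambda> \<psi> \<phi> \<inter> ?B. f (z, glue \<Lambda> \<psi> \<phi> - {z})) * w \<Lambda> \<phi> \<psi> \<partial>Q) =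
      (\<integral>\<^sup>+\<psi>. (\<integral>\<^sup>+z. f (z, glue \<Lambda> \<psi> \<phi>) * ennreal (exp (- V z (glue \<Lambda> \<psi> \<phi>))) * indicator ?B z \<partial>mu M) * w \<Lambda> \<phi> \<psi> \<partial>Q)" .
  qed
  also have "\<dots> = (\<integral>\<^sup>+\<phi>. \<integral>\<^sup>+z. f (z, \<phi>) * ennreal (exp (- V z \<phi>)) * indicator ?B z \<partial>mu M \<partial>P)"
    by (rule dlr[OF \<Lambda> papangelou_measurable[OF f \<Lambda>], symmetric])
  finally show ?thesis .
qed

end


section \<open>Innovations\<close>

text \<open>The set on which the two functions differ, and each of its subsets, is measurable in the
  completion. This covers the integrand of the innovation, which equals a measurable one only off
  occupied locations.\<close>

lemma borel_measurable_completion_AE: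
  fixes f g :: "'a \<Rightarrow> real"
  assumes f: "f \<in> borel_measurable M" and ae: "AE x in M. f x = g x"
  shows "g \<in> borel_measurable (completion M)"
proof (rule borel_measurableI)
  fix S :: "real set" assume "open S"
  then have [measurable]: "S \<in> sets borel" by simp
  have 1: "Measurable.pred (completion M) (\<lambda>x. g x \<in> S \<and> f x \<noteq> g x)"
    and 2: "Measurable.pred (completion M) (\<lambda>x. f x \<noteq> g x)"
    using ae by (auto intro!: sets_completion_AE)
  have "f \<in> borel_measurable (completion M)" using f by (rule measurable_completion)
  then have "Measurable.pred (completion M) (\<lambda>x. (f x \<in> S \<and> \<not> f x \<noteq> g x) \<or> (g x \<in> S \<and> f x \<noteq> g x))"
    using 1 2 by measurable
  moreover have "(\<lambda>x. (f x \<in> S \<and> \<not> f x \<noteq> g x) \<or> (g x \<in> S \<and> f x \<noteq> g x)) = (\<lambda>x. g x \<in> S)"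
    by (auto simp: fun_eq_iff)
  ultimately have "Measurable.pred (completion M) (\<lambda>x. g x \<in> S)" by (simp only:)
  then show "g -` S \<inter> space (completion M) \<in> sets (completion M)"
    by (simp add: pred_def vimage_def Int_def conj_commute)
qed

lemma mu_translation_invariant:
  assumes M: "prob_space M"
  shows "distr (mu M :: ('d::finite, 'm) marked measure) (mu M) (\<lambda>z. (fst z + y, snd z)) = mu M"
proof -
  interpret prob_space M by fact
  have "distr (mu M :: ('d, 'm) marked measure) (mu M) (\<lambda>z. (fst z + y, snd z))
    = distr lborel lborel (\<lambda>x. x + y) \<Otimes>\<^sub>M distr M M (\<lambda>m. m)"
    unfolding mu_def
    by (subst pair_measure_distr) (auto simp: case_prod_unfold distr_id2 sigma_finite_measure_axioms)
  also have "distr lborel lborel (\<lambda>x. x + y) = (lborel :: (real ^ 'd) measure)"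
    using lborel_distr_plus[of y] by (simp add: add.commute cong: distr_cong)
  finally show ?thesis by (simp add: mu_def distr_id2)
qed

lemma cube_bounded_borel: "bounded_borel (cube D k :: (real ^ 'd::finite) set)"
proof -
  have "cube D k = (\<Inter>i. {x. (D *\<^sub>R lattice_vec k) $ i - D / 2 \<le> x $ i} \<inter> {x. x $ i < (D *\<^sub>R lattice_vec k) $ i + D / 2})"
    by (auto simp: cube_def)
  also have "\<dots> \<in> sets (borel :: (real ^ 'd) measure)"
    by (intro sets.finite_INT sets.Int) (auto intro!: borel_closed borel_open simp: closed_halfspace_component_ge_cart open_halfspace_component_lt_cart)
  finally have "cube D k \<in> sets (borel :: (real ^ 'd) measure)" .
  moreover have "bounded (cube D k :: (real ^ 'd) set)"
  proof (rule bounded_subset[OF bounded_cbox])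
    show "cube D k \<subseteq> cbox (D *\<^sub>R lattice_vec k - (\<chi> i. D / 2)) (D *\<^sub>R lattice_vec k + (\<chi> i. D / 2))"
      by (auto simp: cube_def mem_box_cart less_imp_le)
  qed
  ultimately show ?thesis by (simp add: bounded_borel_def)
qed

lemma cube_translate: "cube D k = (\<lambda>x. x + D *\<^sub>R lattice_vec k) ` cube D 0"
proof -
  have "x \<in> cube D k \<longleftrightarrow> x - D *\<^sub>R lattice_vec k \<in> cube D 0" for x :: "real ^ 'a"
  proof -
    have "(D * real_of_int (k $ i) - D / 2 \<le> x $ i \<and> x $ i < D * real_of_int (k $ i) + D / 2) \<longleftrightarrow>
        (0 - D / 2 \<le> x $ i - D * real_of_int (k $ i) \<and> x $ i - D * real_of_int (k $ i) < 0 + D / 2)" for i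
      by linarith
    then show ?thesis by (simp only: cube_def lattice_vec_def) simp
  qed
  moreover have "x \<in> (\<lambda>x. x + y) ` X \<longleftrightarrow> x - y \<in> X" for x y :: "real ^ 'a" and X
    by (metis (no_types, lifting) add_diff_cancel_right' diff_add_cancel image_iff)
  ultimately show ?thesis by blast
qed

section \<open>A common form of the test functions and a measurable version of the
  innovation\<close>

definition power_test :: "('d, 'm, 'p::finite) stat \<Rightarrow> real \<Rightarrow> ('d, 'm, 'p) test_fun" where
  "power_test v c z \<phi> \<theta> = exp (c * local_energy v z \<phi> \<theta>)"

lemma raw_test_eq: "raw_test = power_test v 0"
  by (simp add: fun_eq_iff raw_test_def power_test_def)

lemma pearson_test_eq: "pearson_test v = power_test v (1 / 2)"
  by (simp add: fun_eq_iff pearson_test_def power_test_def)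

lemma inverse_test_eq: "inverse_test v = power_test v 1"
  by (simp add: fun_eq_iff inverse_test_def power_test_def)

context gibbs_model
begin

text \<open>The compensator: the integrand h exp (- V) equals exp ((c - 1) V), written with
  \<open>Vm\<close>. With the point sum \<open>S\<close> it yields \<open>J\<close>, an everywhere
  defined measurable version of the innovation.\<close>

definition A :: "real \<Rightarrow> (real ^ 'd) set \<Rightarrow> ('d, 'm) marked set \<Rightarrow> real" where
  "A c \<Lambda> \<phi> = (LINT z|mu M. indicator (\<Lambda> \<times> space M) z * exp ((c - 1) * Vm \<Lambda> (z, \<phi>)))"

definition S :: "real \<Rightarrow> (real ^ 'd) set \<Rightarrow> ('d, 'm) marked set \<Rightarrow> real" where
  "S c \<Lambda> \<phi> = (\<Sum>z\<in>\<phi> \<inter> \<Lambda> \<times> space M. exp (c * Vm \<Lambda> (z, \<phi> - {z})))"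

definition J :: "real \<Rightarrow> (real ^ 'd) set \<Rightarrow> ('d, 'm) marked set \<Rightarrow> real" where
  "J c \<Lambda> \<phi> = A c \<Lambda> \<phi> - S c \<Lambda> \<phi>"

text \<open>The deterministic bound for \<open>A\<close> obtained from V \<ge> - K: a pointwise
  bound of the integrand times the volume.\<close>

definition a :: "real \<Rightarrow> (real ^ 'd) set \<Rightarrow> real" where
  "a c \<Lambda> = exp ((1 - c) * K) * measure (mu M) (\<Lambda> \<times> space M)"

lemma a_nonneg: "0 \<le> a c \<Lambda>" by (simp add: a_def)

lemma Vm_cases:
  assumes "bounded_borel \<Lambda>" "z \<in> \<Lambda> \<times> space M" "\<phi> \<in> space (configs M)"
  shows "Vm \<Lambda> (z, \<phi>) = (if fst z \<in> fst ` \<phi> then 0 else V z \<phi>)"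
  using Vm_eq[OF assms] by (simp add: Vm_def add_point_def)

text \<open>Since K is nonnegative, the bound also covers the value 0 that \<open>Vm\<close> takes
  at occupied locations.\<close>

lemma Vm_ge:
  assumes "bounded_borel \<Lambda>" "z \<in> \<Lambda> \<times> space M" "\<phi> \<in> space (configs M)"
  shows "- K \<le> Vm \<Lambda> (z, \<phi>)"
  using K(1) K(2)[of z \<phi>] assms by (auto simp: Vm_cases[OF assms])

lemma exp_Vm_le:
  assumes "bounded_borel \<Lambda>" "z \<in> \<Lambda> \<times> space M" "\<phi> \<in> space (configs M)" "c \<le> 1"
  shows "exp ((c - 1) * Vm \<Lambda> (z, \<phi>)) \<le> exp ((1 - c) * K)"
proof -
  have "(1 - c) * (- K) \<le> (1 - c) * Vm \<Lambda> (z, \<phi>)"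
    using Vm_ge[OF assms(1-3)] assms(4) by (intro mult_left_mono) auto
  then show ?thesis by (simp add: algebra_simps)
qed

lemma A_integrand_measurable:
  assumes \<Lambda>: "bounded_borel \<Lambda>"
  shows "(\<lambda>(z, \<phi>). indicator (\<Lambda> \<times> space M) z * exp ((c - 1) * Vm \<Lambda> (z, \<phi>)) :: real)
    \<in> borel_measurable (mu M \<Otimes>\<^sub>M configs M)"
proof -
  note [measurable] = Vm_measurable[OF \<Lambda>] bdd_setsD(1)[OF bdd_sets_Times[OF \<Lambda>]]
  show ?thesis by measurable
qed

lemma A_integrable:
  assumes \<Lambda>: "bounded_borel \<Lambda>" and \<phi>: "\<phi> \<in> space (configs M)" and c: "c \<le> 1"
  shows "integrable (mu M) (\<lambda>z. indicator (\<Lambda> \<times> space M) z * exp ((c - 1) * Vm \<Lambda> (z, \<phi>)))"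
proof -
  have "integrable (mu M) (\<lambda>z. indicator (\<Lambda> \<times> space M) z *\<^sub>R exp ((c - 1) * Vm \<Lambda> (z, \<phi>)))"
  proof (rule integrableI_bounded_set_indicator[where B="exp ((1 - c) * K)"])
  show "\<Lambda> \<times> space M \<in> sets (mu M)" by (rule bdd_setsD(1)[OF bdd_sets_Times[OF \<Lambda>]])
  show "emeasure (mu M) (\<Lambda> \<times> space M) < \<infinity>"
    by (rule emeasure_bdd_sets_finite[OF marks bdd_sets_Times[OF \<Lambda>]])
  note [measurable] = Vm_measurable[OF \<Lambda>]
  have [measurable]: "(\<lambda>z. (z, \<phi>)) \<in> measurable (mu M) (mu M \<Otimes>\<^sub>M configs M)" using \<phi> by simp
  show "(\<lambda>z. exp ((c - 1) * Vm \<Lambda> (z, \<phi>))) \<in> borel_measurable (mu M)" by measurable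
  show "AE x\<in>\<Lambda> \<times> space M in mu M. norm (exp ((c - 1) * Vm \<Lambda> (x, \<phi>))) \<le> exp ((1 - c) * K)"
    using exp_Vm_le[OF \<Lambda> _ \<phi> c] by simp
  qed
  then show ?thesis by simp
qed

lemma A_nonneg: "0 \<le> A c \<Lambda> \<phi>"
  unfolding A_def by (rule integral_nonneg_AE) simp

lemma S_nonneg: "0 \<le> S c \<Lambda> \<phi>"
  unfolding S_def by (rule sum_nonneg) simp

lemma A_le:
  assumes \<Lambda>: "bounded_borel \<Lambda>" and \<phi>: "\<phi> \<in> space (configs M)" and c: "c \<le> 1"
  shows "A c \<Lambda> \<phi> \<le> a c \<Lambda>"
proof -
  have B: "\<Lambda> \<times> space M \<in> sets (mu M)" "emeasure (mu M) (\<Lambda> \<times> space M) < \<infinity>"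
    using bdd_setsD(1)[OF bdd_sets_Times[OF \<Lambda>]] emeasure_bdd_sets_finite[OF marks bdd_sets_Times[OF \<Lambda>]] by auto
  have "A c \<Lambda> \<phi> \<le> (LINT z|mu M. exp ((1 - c) * K) * indicator (\<Lambda> \<times> space M) z)"
    unfolding A_def
    using B exp_Vm_le[OF \<Lambda> _ \<phi> c]
    by (intro integral_mono A_integrable[OF \<Lambda> \<phi> c] integrable_mult_right integrable_real_indicator)
      (auto simp: indicator_def)
  also have "\<dots> = a c \<Lambda>"
    using B sets.sets_into_space[OF B(1)] by (simp add: a_def Int_absorb2)
  finally show ?thesis .
qed

lemma A_measurable:
  assumes \<Lambda>: "bounded_borel \<Lambda>" shows "A c \<Lambda> \<in> borel_measurable (configs M)"
proof -
  note [measurable] = Vm_measurable[OF \<Lambda>] bdd_setsD(1)[OF bdd_sets_Times[OF \<Lambda>]]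
  have "(\<lambda>\<phi>. LINT z|mu M. (\<lambda>(\<phi>, z). indicator (\<Lambda> \<times> space M) z * exp ((c - 1) * Vm \<Lambda> (z, \<phi>))) (\<phi>, z)) \<in> borel_measurable (configs M)"
    by (rule mu.borel_measurable_lebesgue_integral) measurable
  then show ?thesis by (simp add: A_def[abs_def])
qed

lemma S_measurable:
  assumes \<Lambda>: "bounded_borel \<Lambda>" shows "S c \<Lambda> \<in> borel_measurable (configs M)"
proof -
  note [measurable] = Vm_measurable[OF \<Lambda>]
  have "(\<lambda>x. ennreal (exp (c * Vm \<Lambda> x))) \<in> borel_measurable (mu M \<Otimes>\<^sub>M configs M)" by measurable
  from measurable_sum_points[OF this bdd_sets_Times[OF \<Lambda>]]
  have "(\<lambda>\<phi>. enn2real (\<Sum>z\<in>\<phi> \<inter> \<Lambda> \<times> space M. ennreal (exp (c * Vm \<Lambda> (z, \<phi> - {z}))))) \<in> borel_measurable (configs M)"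
    by measurable
  then show ?thesis by (simp add: S_def[abs_def] sum_ennreal enn2real_ennreal sum_nonneg)
qed

lemma J_measurable: "bounded_borel \<Lambda> \<Longrightarrow> J c \<Lambda> \<in> borel_measurable (configs M)"
  unfolding J_def[abs_def] by (intro borel_measurable_diff A_measurable S_measurable)

text \<open>The integrals agree because \<open>Vm\<close> and \<open>V\<close> differ only at the
  null set of occupied locations; the sums agree because in a simple configuration each removed
  point leaves its location vacant.\<close>

lemma innovation_eq_J:
  assumes \<Lambda>: "bounded_borel \<Lambda>" and \<phi>: "\<phi> \<in> space (configs M)" and s: "simple_locs \<phi>"
  shows "innovation M v (power_test v c) \<theta>s \<Lambda> \<phi> = J c \<Lambda> \<phi>"
proof -
  let ?B = "\<Lambda> \<times> space M"
  let ?f = "\<lambda>z. indicator ?B z * exp ((c - 1) * Vm \<Lambda> (z, \<phi>)) :: real"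
  let ?g = "\<lambda>z. indicator ?B z *\<^sub>R (power_test v c z \<phi> \<theta>s * exp (- V z \<phi>)) :: real"
  have f: "?f \<in> borel_measurable (mu M)"
  proof -
    have "(\<lambda>z. (z, \<phi>)) \<in> measurable (mu M) (mu M \<Otimes>\<^sub>M configs M)" using \<phi> by simp
    from measurable_compose[OF this A_integrand_measurable[OF \<Lambda>, of c]] show ?thesis by simp
  qed
  have eq: "AE z in mu M. ?f z = ?g z"
    using Vm_AE_eq[OF \<Lambda> \<phi>]
    by eventually_elim (auto simp: indicator_def power_test_def exp_add[symmetric] algebra_simps)
  have "(LINT z : ?B | completion (mu M). power_test v c z \<phi> \<theta>s * exp (- V z \<phi>)) = (LINT z|completion (mu M). ?f z)"
    unfolding set_lebesgue_integral_def
    using f eq by (intro integral_cong_AE borel_measurable_completion_AE[OF f eq] measurable_completion)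
      (auto intro!: AE_completion)
  also have "\<dots> = A c \<Lambda> \<phi>"
    unfolding A_def by (rule integral_completion[OF f])
  finally have 1: "(LINT z : ?B | completion (mu M). power_test v c z \<phi> \<theta>s * exp (- V z \<phi>)) = A c \<Lambda> \<phi>" .
  have "(\<Sum>z\<in>restr \<phi> \<Lambda>. power_test v c z (\<phi> - {z}) \<theta>s) = S c \<Lambda> \<phi>"
    unfolding S_def
  proof (rule sum.cong)
    show "restr \<phi> \<Lambda> = \<phi> \<inter> ?B" using config_subset[OF \<phi>] by (auto simp: restr_def)
    fix z assume z: "z \<in> \<phi> \<inter> ?B"
    have "\<phi> - {z} \<in> space (configs M)" using \<phi> by (rule config_mono) auto
    then have "Vm \<Lambda> (z, \<phi> - {z}) = V z (\<phi> - {z})"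
      using z simple_locs_remove[OF s, of z] by (intro Vm_eq[OF \<Lambda>]) auto
    then show "power_test v c z (\<phi> - {z}) \<theta>s = exp (c * Vm \<Lambda> (z, \<phi> - {z}))" by (simp add: power_test_def)
  qed
  with 1 show ?thesis by (simp add: innovation_def J_def)
qed

lemma AE_innovation:
  assumes "bounded_borel \<Lambda>"
  shows "AE \<phi> in P. innovation M v (power_test v c) \<theta>s \<Lambda> \<phi> = J c \<Lambda> \<phi>"
  using AE_simple_P AE_space by eventually_elim (use innovation_eq_J[OF assms] space_P in blast)

subsection \<open>Locality and stationarity\<close>

lemma Vm_cong:
  assumes \<Lambda>: "bounded_borel \<Lambda>" and z: "z \<in> \<Lambda> \<times> space M"
    and \<phi>: "\<phi> \<in> space (configs M)" and \<psi>: "\<psi> \<in> space (configs M)"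
    and B: "unif_ball (fst z) D \<subseteq> B" "restr \<phi> B = restr \<psi> B"
  shows "Vm \<Lambda> (z, \<phi>) = Vm \<Lambda> (z, \<psi>)"
proof -
  have mem: "x \<in> \<phi> \<longleftrightarrow> x \<in> \<psi>" if "fst x \<in> B" for x
    using B(2) that by (cases x) (auto simp: restr_def set_eq_iff)
  have "restr \<phi> (unif_ball (fst z) D) = restr \<psi> (unif_ball (fst z) D)"
    using mem B(1) by (auto simp: restr_def subset_iff)
  then have V: "V z \<phi> = V z \<psi>"
    using z by (intro V_cong[OF \<phi> \<psi>]) auto
  have "fst z \<in> B" using B(1) D_pos by (auto simp: unif_ball_def infnorm_0 subset_iff)
  then have "fst z \<in> fst ` \<phi> \<longleftrightarrow> fst z \<in> fst ` \<psi>"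
    using mem by (force simp: image_iff)
  then show ?thesis using V by (simp add: Vm_cases[OF \<Lambda> z] \<phi> \<psi>)
qed

text \<open>A point z of \<Lambda> influences \<open>J\<close> through its local energy, which looks
  no farther than D, and through whether its own location is occupied.\<close>

lemma J_cong:
  assumes \<Lambda>: "bounded_borel \<Lambda>"
    and \<phi>: "\<phi> \<in> space (configs M)" and \<psi>: "\<psi> \<in> space (configs M)"
    and B: "\<And>x. x \<in> \<Lambda> \<Longrightarrow> unif_ball x D \<subseteq> B" "restr \<phi> B = restr \<psi> B"
  shows "J c \<Lambda> \<phi> = J c \<Lambda> \<psi>"
proof -
  have mem: "x \<in> \<phi> \<longleftrightarrow> x \<in> \<psi>" if "fst x \<in> B" for x
    using B(2) that by (cases x) (auto simp: restr_def set_eq_iff)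
  have \<Lambda>B: "x \<in> B" if "x \<in> \<Lambda>" for x
    using B(1)[OF that] D_pos by (auto simp: unif_ball_def infnorm_0 subset_iff)
  have "A c \<Lambda> \<phi> = A c \<Lambda> \<psi>"
    unfolding A_def
  proof (rule Bochner_Integration.integral_cong[OF refl])
    fix z
    show "indicator (\<Lambda> \<times> space M) z * exp ((c - 1) * Vm \<Lambda> (z, \<phi>)) = indicator (\<Lambda> \<times> space M) z * exp ((c - 1) * Vm \<Lambda> (z, \<psi>))"
      using Vm_cong[OF \<Lambda> _ \<phi> \<psi> B(1) B(2), of z] by (auto simp: indicator_def)
  qed
  moreover have "S c \<Lambda> \<phi> = S c \<Lambda> \<psi>"
    unfolding S_def
  proof (rule sum.cong)
    show eq: "\<phi> \<inter> \<Lambda> \<times> space M = \<psi> \<inter> \<Lambda> \<times> space M" using mem \<Lambda>B by auto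
    fix z assume z: "z \<in> \<psi> \<inter> \<Lambda> \<times> space M"
    have "restr (\<phi> - {z}) B = restr (\<psi> - {z}) B" using mem by (auto simp: restr_def)
    then have "Vm \<Lambda> (z, \<phi> - {z}) = Vm \<Lambda> (z, \<psi> - {z})"
      using z by (intro Vm_cong[OF \<Lambda> _ config_mono[OF \<phi>] config_mono[OF \<psi>] B(1)]) auto
    then show "exp (c * Vm \<Lambda> (z, \<phi> - {z})) = exp (c * Vm \<Lambda> (z, \<psi> - {z}))" by simp
  qed
  ultimately show ?thesis by (simp add: J_def)
qed

lemma H_translate:
  assumes "bounded_borel \<Lambda>" "\<phi> \<in> space (configs M)"
  shows "H ((\<lambda>x. x + y) ` \<Lambda>) (translate y \<phi>) = H \<Lambda> \<phi>"
  using family \<theta>s_in assms unfolding exponential_family_def translation_invariant_energy_def by blast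

lemma location_translate:
  fixes \<phi> :: "('d, 'm) marked set"
  shows "x + y \<in> fst ` translate y \<phi> \<longleftrightarrow> x \<in> fst ` \<phi>"
proof -
  have "w \<in> fst ` X \<longleftrightarrow> (\<exists>m. (w, m) \<in> X)" for w and X :: "('d, 'm) marked set"
    by force
  then show ?thesis by (simp only: mem_translate add_diff_cancel_right')
qed

lemma Vm_translate:
  assumes "bounded_borel \<Lambda>" "\<phi> \<in> space (configs M)" "m \<in> space M"
  shows "Vm ((\<lambda>x. x + y) ` \<Lambda>) ((x + y, m), translate y \<phi>) = Vm \<Lambda> ((x, m), \<phi>)"
proof -
  have "add_point (x + y, m) (translate y \<phi>) = translate y (add_point (x, m) \<phi>)"
    by (simp add: add_point_def location_translate translate_insert)
  moreover have "add_point (x, m) \<phi> \<in> space (configs M)"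
    using assms by (intro config_add_point) (auto simp: space_mu)
  ultimately show ?thesis
    unfolding Vm_def using assms by (simp add: H_translate)
qed

lemma bounded_borel_translate:
  assumes "bounded_borel \<Lambda>" shows "bounded_borel ((\<lambda>x. x + y) ` \<Lambda> :: (real ^ 'e::finite) set)"
proof -
  have "(\<lambda>x. x - y) -` \<Lambda> \<inter> space borel \<in> sets borel"
    using assms by (intro measurable_sets[of _ _ borel]) (auto simp: bounded_borel_def)
  moreover have "(\<lambda>x. x - y) -` \<Lambda> \<inter> space borel = (\<lambda>x. x + y) ` \<Lambda>"
    by (force simp: image_iff)
  moreover have "bounded ((\<lambda>x. x + y) ` \<Lambda>)"
    using assms bounded_translation[of \<Lambda> y] by (simp add: bounded_borel_def add.commute)
  ultimately show ?thesis by (simp add: bounded_borel_def)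
qed

text \<open>Translations preserve \<open>mu M\<close>, the energies and the occupation of locations.
  \<open>Vm\<close> therefore commutes with them everywhere, and the identity holds for every
  configuration rather than almost surely.\<close>

lemma J_translate:
  assumes \<Lambda>: "bounded_borel \<Lambda>" and \<phi>: "\<phi> \<in> space (configs M)"
  shows "J c ((\<lambda>x. x + y) ` \<Lambda>) (translate y \<phi>) = J c \<Lambda> \<phi>"
proof -
  let ?\<Lambda> = "(\<lambda>x. x + y) ` \<Lambda>"
  let ?t = "\<lambda>z :: ('d, 'm) marked. (fst z + y, snd z)"
  have \<Lambda>': "bounded_borel ?\<Lambda>" using \<Lambda> by (rule bounded_borel_translate)
  have \<phi>': "translate y \<phi> \<in> space (configs M)" using \<phi> by (rule config_translate)
  have t: "?t \<in> measurable (mu M) (mu M)" by (measurable; simp add: sets_mu)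
  have f: "(\<lambda>z. indicator (?\<Lambda> \<times> space M) z * exp ((c - 1) * Vm ?\<Lambda> (z, translate y \<phi>)) :: real) \<in> borel_measurable (mu M)"
  proof -
    have "(\<lambda>z. (z, translate y \<phi>)) \<in> measurable (mu M) (mu M \<Otimes>\<^sub>M configs M)" using \<phi>' by simp
    from measurable_compose[OF this A_integrand_measurable[OF \<Lambda>', of c]] show ?thesis by simp
  qed
  have "A c ?\<Lambda> (translate y \<phi>) = (LINT z|distr (mu M) (mu M) ?t. indicator (?\<Lambda> \<times> space M) z * exp ((c - 1) * Vm ?\<Lambda> (z, translate y \<phi>)))"
    by (simp add: A_def mu_translation_invariant[OF marks])
  also have "\<dots> = (LINT z|mu M. indicator (?\<Lambda> \<times> space M) (?t z) * exp ((c - 1) * Vm ?\<Lambda> (?t z, translate y \<phi>)))"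
    by (rule integral_distr[OF t f])
  also have "\<dots> = A c \<Lambda> \<phi>"
    unfolding A_def
  proof (rule Bochner_Integration.integral_cong[OF refl])
    fix z :: "('d, 'm) marked" assume "z \<in> space (mu M)"
    then obtain x m where z: "z = (x, m)" "m \<in> space M" by (cases z) (auto simp: space_mu)
    show "indicator (?\<Lambda> \<times> space M) (?t z) * exp ((c - 1) * Vm ?\<Lambda> (?t z, translate y \<phi>)) =
       indicator (\<Lambda> \<times> space M) z * exp ((c - 1) * Vm \<Lambda> (z, \<phi>))"
      using Vm_translate[OF \<Lambda> \<phi> z(2)] z by (auto simp: indicator_def)
  qed
  finally have 1: "A c ?\<Lambda> (translate y \<phi>) = A c \<Lambda> \<phi>" .
  have "S c ?\<Lambda> (translate y \<phi>) = (\<Sum>z\<in>?t ` (\<phi> \<inter> \<Lambda> \<times> space M). exp (c * Vm ?\<Lambda> (z, translate y \<phi> - {z})))"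
    unfolding S_def
  proof (rule sum.cong[OF _ refl])
    show "translate y \<phi> \<inter> ?\<Lambda> \<times> space M = ?t ` (\<phi> \<inter> \<Lambda> \<times> space M)"
      by (force simp: translate_def image_iff)
  qed
  also have "\<dots> = (\<Sum>z\<in>\<phi> \<inter> \<Lambda> \<times> space M. exp (c * Vm ?\<Lambda> (?t z, translate y \<phi> - {?t z})))"
    by (subst sum.reindex) (auto simp: inj_on_def prod_eq_iff)
  also have "\<dots> = S c \<Lambda> \<phi>"
    unfolding S_def
  proof (rule sum.cong[OF refl])
    fix z assume z: "z \<in> \<phi> \<inter> \<Lambda> \<times> space M"
    then obtain x m where zz: "z = (x, m)" "m \<in> space M" by (cases z) auto
    have "translate y \<phi> - {?t z} = translate y (\<phi> - {z})" by (auto simp: mem_translate zz)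
    moreover have "\<phi> - {z} \<in> space (configs M)" using \<phi> by (rule config_mono) auto
    ultimately show "exp (c * Vm ?\<Lambda> (?t z, translate y \<phi> - {?t z})) = exp (c * Vm \<Lambda> (z, \<phi> - {z}))"
      using Vm_translate[OF \<Lambda> _ zz(2)] zz by simp
  qed
  finally show ?thesis using 1 by (simp add: J_def)
qed

subsection \<open>Moments and orthogonality\<close>

text \<open>G is evaluated without the removed point, so after applying the formula it no longer
  depends on z and leaves the inner integral, which is the compensator.\<close>

lemma gnz_A:
  assumes \<Lambda>: "bounded_borel \<Lambda>" and c: "c \<le> 1" and G: "G \<in> borel_measurable (configs M)"
  shows "(\<integral>\<^sup>+\<phi>. (\<Sum>z\<in>\<phi> \<inter> \<Lambda> \<times> space M. ennreal (exp (c * Vm \<Lambda> (z, \<phi> - {z}))) * G (\<phi> - {z})) \<partial>P)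
    = (\<integral>\<^sup>+\<phi>. ennreal (A c \<Lambda> \<phi>) * G \<phi> \<partial>P)"
proof -
  note [measurable] = Vm_measurable[OF \<Lambda>] G bdd_setsD(1)[OF bdd_sets_Times[OF \<Lambda>]]
  have f: "(\<lambda>x. ennreal (exp (c * Vm \<Lambda> x)) * G (snd x)) \<in> borel_measurable (mu M \<Otimes>\<^sub>M configs M)" by measurable
  have "(\<integral>\<^sup>+\<phi>. (\<Sum>z\<in>\<phi> \<inter> \<Lambda> \<times> space M. ennreal (exp (c * Vm \<Lambda> (z, \<phi> - {z}))) * G (\<phi> - {z})) \<partial>P)
    = (\<integral>\<^sup>+\<phi>. \<integral>\<^sup>+z. ennreal (exp (c * Vm \<Lambda> (z, \<phi>))) * G \<phi> * ennreal (exp (- V z \<phi>)) * indicator (\<Lambda> \<times> space M) z \<partial>mu M \<partial>P)"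
    using gnz[OF f \<Lambda>] by simp
  also have "\<dots> = (\<integral>\<^sup>+\<phi>. ennreal (A c \<Lambda> \<phi>) * G \<phi> \<partial>P)"
  proof (rule nn_integral_cong)
    fix \<phi> assume "\<phi> \<in> space P"
    then have \<phi>: "\<phi> \<in> space (configs M)" by (simp add: space_P)
    have [measurable]: "(\<lambda>z. (z, \<phi>)) \<in> measurable (mu M) (mu M \<Otimes>\<^sub>M configs M)" using \<phi> by simp
    have g: "(\<lambda>z. ennreal (indicator (\<Lambda> \<times> space M) z * exp ((c - 1) * Vm \<Lambda> (z, \<phi>)))) \<in> borel_measurable (mu M)"
      by measurable
    have "(\<integral>\<^sup>+z. ennreal (exp (c * Vm \<Lambda> (z, \<phi>))) * G \<phi> * ennreal (exp (- V z \<phi>)) * indicator (\<Lambda> \<times> space M) z \<partial>mu M)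
      = (\<integral>\<^sup>+z. ennreal (indicator (\<Lambda> \<times> space M) z * exp ((c - 1) * Vm \<Lambda> (z, \<phi>))) * G \<phi> \<partial>mu M)"
      using Vm_AE_eq[OF \<Lambda> \<phi>]
      by (intro nn_integral_cong_AE, eventually_elim)
        (auto simp: indicator_def mult.commute mult.left_commute ennreal_mult[symmetric] exp_add[symmetric] algebra_simps)
    also have "\<dots> = (\<integral>\<^sup>+z. ennreal (indicator (\<Lambda> \<times> space M) z * exp ((c - 1) * Vm \<Lambda> (z, \<phi>))) \<partial>mu M) * G \<phi>"
      by (rule nn_integral_multc[OF g])
    also have "(\<integral>\<^sup>+z. ennreal (indicator (\<Lambda> \<times> space M) z * exp ((c - 1) * Vm \<Lambda> (z, \<phi>))) \<partial>mu M) = ennreal (A c \<Lambda> \<phi>)"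
      unfolding A_def by (rule nn_integral_eq_integral[OF A_integrable[OF \<Lambda> \<phi> c]]) simp
    finally show "(\<integral>\<^sup>+z. ennreal (exp (c * Vm \<Lambda> (z, \<phi>))) * G \<phi> * ennreal (exp (- V z \<phi>)) * indicator (\<Lambda> \<times> space M) z \<partial>mu M)
      = ennreal (A c \<Lambda> \<phi>) * G \<phi>" .
  qed
  finally show ?thesis .
qed

lemma ennreal_S: "ennreal (S c \<Lambda> \<phi>) = (\<Sum>z\<in>\<phi> \<inter> \<Lambda> \<times> space M. ennreal (exp (c * Vm \<Lambda> (z, \<phi> - {z}))))"
  unfolding S_def by (rule sum_ennreal[symmetric]) simp

lemma expectation_S:
  assumes \<Lambda>: "bounded_borel \<Lambda>" and c: "c \<le> 1" and G: "G \<in> borel_measurable (configs M)"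
    and inv: "\<And>z \<phi>. \<phi> \<in> space (configs M) \<Longrightarrow> z \<in> \<phi> \<Longrightarrow> z \<in> \<Lambda> \<times> space M \<Longrightarrow> G (\<phi> - {z}) = G \<phi>"
  shows "(\<integral>\<^sup>+\<phi>. ennreal (S c \<Lambda> \<phi>) * G \<phi> \<partial>P) = (\<integral>\<^sup>+\<phi>. ennreal (A c \<Lambda> \<phi>) * G \<phi> \<partial>P)"
proof -
  have "(\<integral>\<^sup>+\<phi>. ennreal (S c \<Lambda> \<phi>) * G \<phi> \<partial>P)
    = (\<integral>\<^sup>+\<phi>. (\<Sum>z\<in>\<phi> \<inter> \<Lambda> \<times> space M. ennreal (exp (c * Vm \<Lambda> (z, \<phi> - {z}))) * G (\<phi> - {z})) \<partial>P)"
    unfolding ennreal_S sum_distrib_right using inv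
    by (intro nn_integral_cong sum.cong) (auto simp: space_P)
  also have "\<dots> = (\<integral>\<^sup>+\<phi>. ennreal (A c \<Lambda> \<phi>) * G \<phi> \<partial>P)"
    by (rule gnz_A[OF \<Lambda> c G])
  finally show ?thesis .
qed

lemma nn_integral_A_le:
  assumes \<Lambda>: "bounded_borel \<Lambda>" and c: "c \<le> 1" and G: "G \<in> borel_measurable (configs M)"
  shows "(\<integral>\<^sup>+\<phi>. ennreal (A c \<Lambda> \<phi>) * G \<phi> \<partial>P) \<le> ennreal (a c \<Lambda>) * (\<integral>\<^sup>+\<phi>. G \<phi> \<partial>P)"
proof -
  have [measurable]: "G \<in> borel_measurable P" using G by (simp cong: measurable_cong_sets add: sets_P)
  have "(\<integral>\<^sup>+\<phi>. ennreal (A c \<Lambda> \<phi>) * G \<phi> \<partial>P) \<le> (\<integral>\<^sup>+\<phi>. ennreal (a c \<Lambda>) * G \<phi> \<partial>P)"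
    using A_le[OF \<Lambda> _ c] by (intro nn_integral_mono mult_right_mono ennreal_leI) (auto simp: space_P)
  then show ?thesis by (simp add: nn_integral_cmult)
qed

lemma nn_integral_S_le:
  assumes \<Lambda>: "bounded_borel \<Lambda>" and c: "c \<le> 1"
  shows "(\<integral>\<^sup>+\<phi>. ennreal (S c \<Lambda> \<phi>) \<partial>P) \<le> ennreal (a c \<Lambda>)"
  using expectation_S[OF \<Lambda> c, of "\<lambda>_. 1"] nn_integral_A_le[OF \<Lambda> c, of "\<lambda>_. 1"] P.emeasure_space_1 by simp

text \<open>F does not notice the removal of a point of \<Lambda>, so \<open>S\<close> and
  \<open>A\<close> have the same expectation against F. Boundedness of \<open>A\<close> makes both
  products integrable as soon as F is, which permits the subtraction.\<close>

lemma J_orthogonal_nonneg: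
  fixes F :: "('d, 'm) marked set \<Rightarrow> real"
  assumes \<Lambda>: "bounded_borel \<Lambda>" and c: "c \<le> 1" and Fm: "F \<in> borel_measurable (configs M)"
    and F: "integrable P F" "\<And>\<phi>. 0 \<le> F \<phi>"
    and inv: "\<And>z \<phi>. \<phi> \<in> space (configs M) \<Longrightarrow> z \<in> \<phi> \<Longrightarrow> z \<in> \<Lambda> \<times> space M \<Longrightarrow> F (\<phi> - {z}) = F \<phi>"
  shows "integrable P (\<lambda>\<phi>. J c \<Lambda> \<phi> * F \<phi>) \<and> (LINT \<phi>|P. J c \<Lambda> \<phi> * F \<phi>) = 0"
proof -
  note [measurable] = A_measurable[OF \<Lambda>] S_measurable[OF \<Lambda>] Fm
  have eq: "(\<integral>\<^sup>+\<phi>. ennreal (S c \<Lambda> \<phi> * F \<phi>) \<partial>P) = (\<integral>\<^sup>+\<phi>. ennreal (A c \<Lambda> \<phi> * F \<phi>) \<partial>P)"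
    using expectation_S[OF \<Lambda> c, of "\<lambda>\<phi>. ennreal (F \<phi>)"] inv
    by (simp add: ennreal_mult A_nonneg S_nonneg F(2))
  have Ffin: "(\<integral>\<^sup>+\<phi>. ennreal (F \<phi>) \<partial>P) < \<infinity>"
    using F by (subst nn_integral_eq_integral) auto
  have "(\<integral>\<^sup>+\<phi>. ennreal (A c \<Lambda> \<phi> * F \<phi>) \<partial>P) \<le> ennreal (a c \<Lambda>) * (\<integral>\<^sup>+\<phi>. ennreal (F \<phi>) \<partial>P)"
    using nn_integral_A_le[OF \<Lambda> c, of "\<lambda>\<phi>. ennreal (F \<phi>)"] by (simp add: ennreal_mult A_nonneg F(2))
  also have "\<dots> < \<infinity>"
    using Ffin by (simp add: ennreal_mult_less_top)
  finally have fin: "(\<integral>\<^sup>+\<phi>. ennreal (A c \<Lambda> \<phi> * F \<phi>) \<partial>P) < \<infinity>" .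
  have iA: "integrable P (\<lambda>\<phi>. A c \<Lambda> \<phi> * F \<phi>)"
    using fin by (intro integrableI_nonneg) (auto simp: A_nonneg F(2))
  have iS: "integrable P (\<lambda>\<phi>. S c \<Lambda> \<phi> * F \<phi>)"
    using fin eq by (intro integrableI_nonneg) (auto simp: S_nonneg F(2))
  have "(LINT \<phi>|P. S c \<Lambda> \<phi> * F \<phi>) = (LINT \<phi>|P. A c \<Lambda> \<phi> * F \<phi>)"
    using eq by (simp add: integral_eq_nn_integral A_nonneg S_nonneg F(2))
  with iA iS show ?thesis by (simp add: J_def left_diff_distrib)
qed

lemma J_orthogonal:
  fixes F :: "('d, 'm) marked set \<Rightarrow> real"
  assumes \<Lambda>: "bounded_borel \<Lambda>" and c: "c \<le> 1" and Fm: "F \<in> borel_measurable (configs M)"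
    and F: "integrable P F"
    and inv: "\<And>z \<phi>. \<phi> \<in> space (configs M) \<Longrightarrow> z \<in> \<phi> \<Longrightarrow> z \<in> \<Lambda> \<times> space M \<Longrightarrow> F (\<phi> - {z}) = F \<phi>"
  shows "integrable P (\<lambda>\<phi>. J c \<Lambda> \<phi> * F \<phi>)" "(LINT \<phi>|P. J c \<Lambda> \<phi> * F \<phi>) = 0"
proof -
  note [measurable] = Fm
  have p: "integrable P (\<lambda>\<phi>. J c \<Lambda> \<phi> * max 0 (F \<phi>)) \<and> (LINT \<phi>|P. J c \<Lambda> \<phi> * max 0 (F \<phi>)) = 0"
    using F inv by (intro J_orthogonal_nonneg[OF \<Lambda> c]) auto
  have n: "integrable P (\<lambda>\<phi>. J c \<Lambda> \<phi> * max 0 (- F \<phi>)) \<and> (LINT \<phi>|P. J c \<Lambda> \<phi> * max 0 (- F \<phi>)) = 0"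
    using F inv by (intro J_orthogonal_nonneg[OF \<Lambda> c]) auto
  have eq: "J c \<Lambda> \<phi> * F \<phi> = J c \<Lambda> \<phi> * max 0 (F \<phi>) - J c \<Lambda> \<phi> * max 0 (- F \<phi>)" for \<phi>
    by (simp add: max_def)
  show "integrable P (\<lambda>\<phi>. J c \<Lambda> \<phi> * F \<phi>)" "(LINT \<phi>|P. J c \<Lambda> \<phi> * F \<phi>) = 0"
    unfolding eq using p n by auto
qed

text \<open>Cauchy-Schwarz bounds the square by N times the sum of exp (2 c V), where N counts the
  points in \<Lambda>. The formula for point sums then applies with exponent 2 c, whose compensator
  is bounded exactly when 2 c \<le> 1 is used; N exceeds the count without z by one and has finite
  mean.\<close>

lemma S_square_integrable:
  assumes \<Lambda>: "bounded_borel \<Lambda>" and c: "c \<le> 1 / 2"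
  shows "(\<integral>\<^sup>+\<phi>. ennreal ((S c \<Lambda> \<phi>)\<^sup>2) \<partial>P) < \<infinity>"
proof -
  let ?B = "\<Lambda> \<times> space M"
  have B: "?B \<in> bdd_sets M" by (rule bdd_sets_Times[OF \<Lambda>])
  let ?N = "\<lambda>\<phi>. card (\<phi> \<inter> ?B)"
  note [measurable] = measurable_card[OF B]
  have S0: "S 0 \<Lambda> \<phi> = real (?N \<phi>)" for \<phi> by (simp add: S_def)
  have le: "ennreal ((S c \<Lambda> \<phi>)\<^sup>2) \<le> (\<Sum>z\<in>\<phi> \<inter> ?B. ennreal (exp ((2 * c) * Vm \<Lambda> (z, \<phi> - {z}))) * ennreal (real (?N (\<phi> - {z})) + 1))"
    if \<phi>: "\<phi> \<in> space P" for \<phi>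
  proof -
    have fin: "finite (\<phi> \<inter> ?B)"
      using \<phi> bdd_setsD(2)[OF B] by (intro finite_config_Int[where M=M]) (auto simp: space_P)
    have N: "real (?N (\<phi> - {z})) + 1 = real (?N \<phi>)" if "z \<in> \<phi> \<inter> ?B" for z
    proof -
      have "(\<phi> - {z}) \<inter> ?B = \<phi> \<inter> ?B - {z}" by auto
      then show ?thesis using card.remove[OF fin that] by simp
    qed
    have sq: "(exp (c * x))\<^sup>2 = exp (2 * c * x)" for x
      by (simp add: power2_eq_square exp_add[symmetric])
    have "(S c \<Lambda> \<phi>)\<^sup>2 \<le> (\<Sum>z\<in>\<phi> \<inter> ?B. (exp (c * Vm \<Lambda> (z, \<phi> - {z})))\<^sup>2) * real (?N \<phi>)"
      unfolding S_def by (rule sum_squared_le_sum_of_squares)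
    also have "\<dots> = (\<Sum>z\<in>\<phi> \<inter> ?B. exp ((2 * c) * Vm \<Lambda> (z, \<phi> - {z})) * (real (?N (\<phi> - {z})) + 1))"
      unfolding sum_distrib_right
      by (intro sum.cong refl) (simp only: N sq)
    finally have "ennreal ((S c \<Lambda> \<phi>)\<^sup>2) \<le> ennreal (\<Sum>z\<in>\<phi> \<inter> ?B. exp ((2 * c) * Vm \<Lambda> (z, \<phi> - {z})) * (real (?N (\<phi> - {z})) + 1))"
      by (rule ennreal_leI)
    also have "\<dots> = (\<Sum>z\<in>\<phi> \<inter> ?B. ennreal (exp ((2 * c) * Vm \<Lambda> (z, \<phi> - {z})) * (real (?N (\<phi> - {z})) + 1)))"
      by (rule sum_ennreal[symmetric]) simp
    also have "\<dots> = (\<Sum>z\<in>\<phi> \<inter> ?B. ennreal (exp ((2 * c) * Vm \<Lambda> (z, \<phi> - {z}))) * ennreal (real (?N (\<phi> - {z})) + 1))"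
      by (intro sum.cong refl ennreal_mult) auto
    finally show ?thesis .
  qed
  have "(\<integral>\<^sup>+\<phi>. ennreal ((S c \<Lambda> \<phi>)\<^sup>2) \<partial>P)
    \<le> (\<integral>\<^sup>+\<phi>. (\<Sum>z\<in>\<phi> \<inter> ?B. ennreal (exp ((2 * c) * Vm \<Lambda> (z, \<phi> - {z}))) * ennreal (real (?N (\<phi> - {z})) + 1)) \<partial>P)"
    by (rule nn_integral_mono[OF le])
  also have "\<dots> = (\<integral>\<^sup>+\<phi>. ennreal (A (2 * c) \<Lambda> \<phi>) * ennreal (real (?N \<phi>) + 1) \<partial>P)"
    using c by (intro gnz_A[OF \<Lambda>]) (simp, measurable)
  also have "\<dots> \<le> ennreal (a (2 * c) \<Lambda>) * (\<integral>\<^sup>+\<phi>. ennreal (real (?N \<phi>) + 1) \<partial>P)"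
    using c by (intro nn_integral_A_le[OF \<Lambda>]) (simp, measurable)
  also have "(\<integral>\<^sup>+\<phi>. ennreal (real (?N \<phi>) + 1) \<partial>P) = (\<integral>\<^sup>+\<phi>. ennreal (S 0 \<Lambda> \<phi>) \<partial>P) + 1"
    by (simp add: S0 nn_integral_add P.emeasure_space_1)
  also have "ennreal (a (2 * c) \<Lambda>) * ((\<integral>\<^sup>+\<phi>. ennreal (S 0 \<Lambda> \<phi>) \<partial>P) + 1) < \<infinity>"
    using nn_integral_S_le[OF \<Lambda>, of 0] by (auto simp: ennreal_mult_less_top intro: le_less_trans)
  finally show ?thesis .
qed

text \<open>\<open>A\<close> and \<open>S\<close> are nonnegative, so the mixed term only lowers the
  square of their difference.\<close>

lemma J_square_integrable:
  assumes \<Lambda>: "bounded_borel \<Lambda>" and c: "c \<le> 1 / 2"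
  shows "integrable P (\<lambda>\<phi>. (J c \<Lambda> \<phi>)\<^sup>2)"
proof (rule integrableI_bounded)
  note [measurable] = J_measurable[OF \<Lambda>] S_measurable[OF \<Lambda>]
  show "(\<lambda>\<phi>. (J c \<Lambda> \<phi>)\<^sup>2) \<in> borel_measurable P" by measurable
  have "(\<integral>\<^sup>+\<phi>. ennreal (norm ((J c \<Lambda> \<phi>)\<^sup>2)) \<partial>P) \<le> (\<integral>\<^sup>+\<phi>. ennreal ((a c \<Lambda>)\<^sup>2) + ennreal ((S c \<Lambda> \<phi>)\<^sup>2) \<partial>P)"
  proof (rule nn_integral_mono)
    fix \<phi> assume "\<phi> \<in> space P"
    then have "A c \<Lambda> \<phi> \<le> a c \<Lambda>" using c by (intro A_le[OF \<Lambda>]) (auto simp: space_P)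
    then have "(A c \<Lambda> \<phi>)\<^sup>2 \<le> (a c \<Lambda>)\<^sup>2" by (rule power_mono) (rule A_nonneg)
    moreover have "0 \<le> A c \<Lambda> \<phi> * S c \<Lambda> \<phi>" by (simp add: A_nonneg S_nonneg)
    ultimately have "(J c \<Lambda> \<phi>)\<^sup>2 \<le> (a c \<Lambda>)\<^sup>2 + (S c \<Lambda> \<phi>)\<^sup>2"
      by (simp add: J_def power2_diff)
    then show "ennreal (norm ((J c \<Lambda> \<phi>)\<^sup>2)) \<le> ennreal ((a c \<Lambda>)\<^sup>2) + ennreal ((S c \<Lambda> \<phi>)\<^sup>2)"
      by (simp add: ennreal_plus[symmetric] ennreal_leI del: ennreal_plus)
  qed
  also have "\<dots> < \<infinity>"
    using S_square_integrable[OF \<Lambda> c] by (simp add: nn_integral_add P.emeasure_space_1)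
  finally show "(\<integral>\<^sup>+\<phi>. ennreal (norm ((J c \<Lambda> \<phi>)\<^sup>2)) \<partial>P) < \<infinity>" .
qed

text \<open>Of the four terms of the product only the mixed ones \<open>A\<close> times
  \<open>S\<close> are negative. There \<open>A\<close> is bounded and \<open>S\<close> has finite
  mean, so the bound holds up to c = 1 without any second moment.\<close>

lemma negative_part:
  assumes \<Lambda>: "bounded_borel \<Lambda>" "bounded_borel \<Lambda>'" and c: "c \<le> 1"
  shows "(\<integral>\<^sup>+\<phi>. ennreal (- (J c \<Lambda> \<phi> * J c \<Lambda>' \<phi>)) \<partial>P) < \<infinity>"
proof -
  note [measurable] = S_measurable[OF \<Lambda>(1)] S_measurable[OF \<Lambda>(2)]
  let ?a = "max (a c \<Lambda>) (a c \<Lambda>')"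
  have a0: "0 \<le> ?a" using a_nonneg[of c \<Lambda>] by simp
  have "(\<integral>\<^sup>+\<phi>. ennreal (- (J c \<Lambda> \<phi> * J c \<Lambda>' \<phi>)) \<partial>P)
    \<le> (\<integral>\<^sup>+\<phi>. ennreal ?a * (ennreal (S c \<Lambda> \<phi>) + ennreal (S c \<Lambda>' \<phi>)) \<partial>P)"
  proof (rule nn_integral_mono)
    fix \<phi> assume "\<phi> \<in> space P"
    then have \<phi>: "\<phi> \<in> space (configs M)" by (simp add: space_P)
    have "A c \<Lambda> \<phi> * S c \<Lambda>' \<phi> \<le> ?a * S c \<Lambda>' \<phi>" "A c \<Lambda>' \<phi> * S c \<Lambda> \<phi> \<le> ?a * S c \<Lambda> \<phi>"
      using A_le[OF \<Lambda>(1) \<phi> c] A_le[OF \<Lambda>(2) \<phi> c] by (auto intro!: mult_right_mono S_nonneg)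
    moreover have "0 \<le> A c \<Lambda> \<phi> * A c \<Lambda>' \<phi>" "0 \<le> S c \<Lambda> \<phi> * S c \<Lambda>' \<phi>"
      by (simp_all add: A_nonneg S_nonneg)
    ultimately have "- (J c \<Lambda> \<phi> * J c \<Lambda>' \<phi>) \<le> ?a * (S c \<Lambda> \<phi> + S c \<Lambda>' \<phi>)"
      by (simp add: J_def algebra_simps)
    then show "ennreal (- (J c \<Lambda> \<phi> * J c \<Lambda>' \<phi>)) \<le> ennreal ?a * (ennreal (S c \<Lambda> \<phi>) + ennreal (S c \<Lambda>' \<phi>))"
      using a0 by (simp add: ennreal_plus[symmetric] ennreal_mult[symmetric] S_nonneg ennreal_leI del: ennreal_plus)
  qed
  also have "\<dots> = ennreal ?a * ((\<integral>\<^sup>+\<phi>. ennreal (S c \<Lambda> \<phi>) \<partial>P) + (\<integral>\<^sup>+\<phi>. ennreal (S c \<Lambda>' \<phi>) \<partial>P))"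
    by (simp add: nn_integral_cmult nn_integral_add)
  also have "\<dots> < \<infinity>"
    using nn_integral_S_le[OF \<Lambda>(1) c] nn_integral_S_le[OF \<Lambda>(2) c]
    by (auto simp: ennreal_mult_less_top intro: le_less_trans)
  finally show ?thesis .
qed

end


section \<open>Stationary fields with finite range of correlation\<close>

lemma card_lattice_cube:
  assumes "finite S"
  shows "finite {k :: int ^ 'd::finite. \<forall>i. k $ i \<in> S}" "card {k :: int ^ 'd. \<forall>i. k $ i \<in> S} = card S ^ CARD('d)"
proof -
  have eq: "{k :: int ^ 'd. \<forall>i. k $ i \<in> S} = vec_lambda ` (UNIV \<rightarrow>\<^sub>E S)"
  proof
    show "{k :: int ^ 'd. \<forall>i. k $ i \<in> S} \<subseteq> vec_lambda ` (UNIV \<rightarrow>\<^sub>E S)"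
    proof
      fix k :: "int ^ 'd" assume "k \<in> {k. \<forall>i. k $ i \<in> S}"
      then show "k \<in> vec_lambda ` (UNIV \<rightarrow>\<^sub>E S)"
        by (intro image_eqI[of _ _ "vec_nth k"]) (auto simp: vec_nth_inverse)
    qed
  qed (auto simp: PiE_def Pi_def)
  have inj: "inj_on (vec_lambda :: ('d \<Rightarrow> int) \<Rightarrow> int ^ 'd) (UNIV \<rightarrow>\<^sub>E S)"
    by (rule inj_onI) (metis vec_lambda_inverse UNIV_I)
  show "finite {k :: int ^ 'd. \<forall>i. k $ i \<in> S}"
    unfolding eq using assms by (intro finite_imageI finite_PiE) auto
  show "card {k :: int ^ 'd. \<forall>i. k $ i \<in> S} = card S ^ CARD('d)"
    unfolding eq card_image[OF inj] by (simp add: card_PiE)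
qed

lemma unit_neighbours_iff: "k \<in> unit_neighbours \<longleftrightarrow> (\<forall>i. \<bar>k $ i\<bar> \<le> 1)"
proof
  assume k: "k \<in> unit_neighbours"
  show "\<forall>i. \<bar>k $ i\<bar> \<le> 1"
  proof
    fix i
    have "\<bar>lattice_vec k $ i\<bar> \<le> infnorm (lattice_vec k)" by (rule component_le_infnorm_cart)
    also have "\<dots> \<le> 1" using k by (simp add: unit_neighbours_def)
    finally show "\<bar>k $ i\<bar> \<le> 1" by (simp add: lattice_vec_def)
  qed
next
  assume "\<forall>i. \<bar>k $ i\<bar> \<le> 1"
  then have "\<bar>real_of_int (k $ i)\<bar> \<le> 1" for i by (metis of_int_abs of_int_le_1_iff)
  then show "k \<in> unit_neighbours"
    unfolding unit_neighbours_def infnorm_cart by (auto simp: lattice_vec_def intro!: cSup_least)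
qed

text \<open>Averaging a positive semidefinite kernel over a large box leaves only its lattice sum:
  the boundary of the box is negligible.\<close>

lemma lattice_sum_nonneg:
  fixes \<rho> :: "int ^ 'd::finite \<Rightarrow> real"
  assumes range: "\<And>k. k \<notin> unit_neighbours \<Longrightarrow> \<rho> k = 0"
    and psd: "\<And>W. finite W \<Longrightarrow> 0 \<le> (\<Sum>j\<in>W. \<Sum>k\<in>W. \<rho> (k - j))"
  shows "0 \<le> (\<Sum>k\<in>unit_neighbours. \<rho> k)"
proof -
  let ?U = "unit_neighbours :: (int ^ 'd) set"
  let ?s = "\<Sum>k\<in>?U. \<rho> k"
  let ?C = "\<Sum>k\<in>?U. \<bar>\<rho> k\<bar>"
  \<comment> \<open>\<open>W n\<close> is a box of side n and \<open>W' n\<close> the sites with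
    coordinates from 1 to n - 2, whose unit neighbours all stay in the box. Such sites see the
    complete lattice sum.\<close>
  define W where "W n = {k :: int ^ 'd. \<forall>i. k $ i \<in> {0..<int n}}" for n
  define W' where "W' n = {k :: int ^ 'd. \<forall>i. k $ i \<in> {1..<int n - 1}}" for n
  have fin: "finite (W n)" "finite (W' n)" for n
    unfolding W_def W'_def by (intro card_lattice_cube; simp)+
  have cW: "card (W n) = n ^ CARD('d)" for n
    unfolding W_def by (subst card_lattice_cube) auto
  have cW': "card (W' n) = (n - 2) ^ CARD('d)" for n
  proof -
    have "nat (int n - 1 - 1) = n - 2" by linarith
    then show ?thesis unfolding W'_def by (subst card_lattice_cube) (simp_all only: finite_atLeastLessThan_int card_atLeastLessThan_int)
  qed
  have sub: "W' n \<subseteq> W n" for n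
  proof
    fix k assume "k \<in> W' n"
    then have b: "1 \<le> k $ i \<and> k $ i < int n - 1" for i by (simp add: W'_def)
    have "0 \<le> k $ i \<and> k $ i < int n" for i using b[of i] by linarith
    then show "k \<in> W n" by (simp add: W_def)
  qed
  have inner: "(\<Sum>k\<in>W n. \<rho> (k - j)) = (\<Sum>k\<in>?U \<inter> (\<lambda>k. k - j) ` W n. \<rho> k)" for n j
  proof -
    have "(\<Sum>k\<in>W n. \<rho> (k - j)) = (\<Sum>k\<in>(\<lambda>k. k - j) ` W n. \<rho> k)"
      by (subst sum.reindex) (auto simp: inj_on_def)
    also have "\<dots> = (\<Sum>k\<in>?U \<inter> (\<lambda>k. k - j) ` W n. \<rho> k)"
      using fin range by (intro sum.mono_neutral_right) auto
    finally show ?thesis .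
  qed
  have in_W': "(\<Sum>k\<in>W n. \<rho> (k - j)) = ?s" if j: "j \<in> W' n" for n j
  proof -
    have "k \<in> (\<lambda>k. k - j) ` W n" if "k \<in> ?U" for k
    proof (rule image_eqI[of _ _ "k + j"])
      have "0 \<le> k $ i + j $ i \<and> k $ i + j $ i < int n" for i
      proof -
        have "\<bar>k $ i\<bar> \<le> 1" "1 \<le> j $ i" "j $ i < int n - 1"
          using that j by (auto simp: unit_neighbours_iff W'_def)
        then show ?thesis by linarith
      qed
      then show "k + j \<in> W n" by (simp add: W_def)
    qed simp
    then have "?U \<inter> (\<lambda>k. k - j) ` W n = ?U" by blast
    then show ?thesis by (simp add: inner)
  qed
  \<comment> \<open>A crude bound for every site, applied to the boundary sites only; their
    proportion in the box tends to zero.\<close>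
  have le: "(\<Sum>k\<in>W n. \<rho> (k - j)) \<le> ?C" for n j
    unfolding inner
    by (rule order_trans[OF sum_mono sum_mono2]) (auto simp: finite_unit_neighbours)
  have main: "0 \<le> real ((n - 2) ^ CARD('d)) * ?s + (real (n ^ CARD('d)) - real ((n - 2) ^ CARD('d))) * ?C" for n
  proof -
    have "0 \<le> (\<Sum>j\<in>W n. \<Sum>k\<in>W n. \<rho> (k - j))" by (rule psd[OF fin(1)])
    also have "\<dots> = (\<Sum>j\<in>W n - W' n. \<Sum>k\<in>W n. \<rho> (k - j)) + (\<Sum>j\<in>W' n. \<Sum>k\<in>W n. \<rho> (k - j))"
      by (rule sum.subset_diff[OF sub fin(1)])
    also have "\<dots> \<le> (\<Sum>j\<in>W n - W' n. ?C) + (\<Sum>j\<in>W' n. ?s)"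
      by (intro add_mono sum_mono le) (simp add: in_W')
    also have "\<dots> = real (card (W n) - card (W' n)) * ?C + real (card (W' n)) * ?s"
      by (simp add: card_Diff_subset[OF fin(2) sub])
    also have "real (card (W n) - card (W' n)) = real (card (W n)) - real (card (W' n))"
      by (intro of_nat_diff card_mono fin sub)
    finally show ?thesis by (simp add: cW cW' algebra_simps)
  qed
  \<comment> \<open>The proportion of interior sites in the box of side n + 2, which turns the
    truncated n - 2 into n. It tends to 1.\<close>
  let ?q = "\<lambda>n. (real n / real (n + 2)) ^ CARD('d)"
  have "(\<lambda>n. 1 - 2 * inverse (real (n + 2))) \<longlonglongrightarrow> 1 - 2 * 0"
    by (intro tendsto_intros LIMSEQ_ignore_initial_segment[OF lim_inverse_n])
  moreover have "1 - 2 * inverse (real (n + 2)) = real n / real (n + 2)" for n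
    by (simp add: field_simps)
  ultimately have "(\<lambda>n. real n / real (n + 2)) \<longlonglongrightarrow> 1"
    by (simp only: mult_zero_right diff_zero)
  then have "(\<lambda>n. ?q n * ?s + (1 - ?q n) * ?C) \<longlonglongrightarrow> 1 ^ CARD('d) * ?s + (1 - 1 ^ CARD('d)) * ?C"
    by (intro tendsto_intros)
  moreover have "0 \<le> ?q n * ?s + (1 - ?q n) * ?C" for n
  proof -
    have "0 \<le> (real n ^ CARD('d) * ?s + (real (n + 2) ^ CARD('d) - real n ^ CARD('d)) * ?C) / real (n + 2) ^ CARD('d)"
      using main[of "n + 2"] by (intro divide_nonneg_nonneg) (simp_all add: of_nat_power)
    also have "\<dots> = ?q n * ?s + (1 - ?q n) * ?C"
      by (simp add: power_divide add_divide_distrib diff_divide_distrib left_diff_distrib)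
    finally show ?thesis .
  qed
  ultimately have "0 \<le> 1 ^ CARD('d) * ?s + (1 - 1 ^ CARD('d)) * ?C"
    by (intro LIMSEQ_le_const) auto
  then show ?thesis by simp
qed

lemma integrable_mult_square:
  fixes f g :: "'a \<Rightarrow> real"
  assumes [measurable]: "f \<in> borel_measurable N" "g \<in> borel_measurable N"
    and "integrable N (\<lambda>x. (f x)\<^sup>2)" "integrable N (\<lambda>x. (g x)\<^sup>2)"
  shows "integrable N (\<lambda>x. f x * g x)"
proof (rule Bochner_Integration.integrable_bound)
  show "integrable N (\<lambda>x. (f x)\<^sup>2 + (g x)\<^sup>2)" using assms by simp
  have "\<bar>f x * g x\<bar> \<le> (f x)\<^sup>2 + (g x)\<^sup>2" for x
  proof -
    have "2 * \<bar>f x * g x\<bar> \<le> (f x)\<^sup>2 + (g x)\<^sup>2"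
      using zero_le_power2[of "\<bar>f x\<bar> - \<bar>g x\<bar>"] by (simp add: power2_diff abs_mult)
    moreover have "0 \<le> \<bar>f x * g x\<bar>" by simp
    ultimately show ?thesis by linarith
  qed
  then show "AE x in N. norm (f x * g x) \<le> norm ((f x)\<^sup>2 + (g x)\<^sup>2)" by simp
qed measurable

context gibbs_model
begin

abbreviation \<Delta> :: "(real ^ 'd) set" where "\<Delta> \<equiv> cube D 0"

text \<open>The cube of side 3 D is tiled by \<Delta> and its neighbouring cubes, and it contains
  every point within the interaction range D of \<Delta>.\<close>

abbreviation B :: "(real ^ 'd) set" where "B \<equiv> cube (3 * D) 0"

text \<open>The minus sign moves the cube with index k onto \<Delta>, so that the innovation of that
  cube is the one of \<Delta> read after the shift.\<close>

definition \<tau> :: "int ^ 'd \<Rightarrow> ('d, 'm) marked set \<Rightarrow> ('d, 'm) marked set" where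
  "\<tau> k = translate (- (D *\<^sub>R lattice_vec k))"

lemma \<tau>_measurable [measurable]: "\<tau> k \<in> measurable (configs M) (configs M)"
  unfolding \<tau>_def by (rule measurable_translate)

lemma config_\<tau>: "\<phi> \<in> space (configs M) \<Longrightarrow> \<tau> k \<phi> \<in> space (configs M)"
  unfolding \<tau>_def by (rule config_translate)

lemma \<tau>_\<tau>: "\<tau> j (\<tau> k \<phi>) = \<tau> (j + k) \<phi>"
proof -
  have "lattice_vec (j + k) = lattice_vec j + lattice_vec k" by (simp add: lattice_vec_def vec_eq_iff)
  then show ?thesis by (simp add: \<tau>_def translate_translate scaleR_add_right)
qed

lemma \<tau>_0 [simp]: "\<tau> 0 \<phi> = \<phi>"
proof -
  have "lattice_vec 0 = (0 :: real ^ 'd)" by (simp add: lattice_vec_def vec_eq_iff)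
  then show ?thesis by (simp add: \<tau>_def)
qed

lemma distr_\<tau>: "distr P (configs M) (\<tau> k) = P"
  using stat unfolding stationary_def \<tau>_def by blast

lemma integral_\<tau>:
  fixes F :: "('d, 'm) marked set \<Rightarrow> real"
  assumes "F \<in> borel_measurable (configs M)"
  shows "(LINT \<phi>|P. F (\<tau> k \<phi>)) = (LINT \<phi>|P. F \<phi>)" "integrable P (\<lambda>\<phi>. F (\<tau> k \<phi>)) \<longleftrightarrow> integrable P F"
proof -
  have [measurable]: "\<tau> k \<in> measurable P (configs M)" by measurable
  show "(LINT \<phi>|P. F (\<tau> k \<phi>)) = (LINT \<phi>|P. F \<phi>)"
    using integral_distr[of "\<tau> k" P "configs M" F] assms by (simp add: distr_\<tau>)
  show "integrable P (\<lambda>\<phi>. F (\<tau> k \<phi>)) \<longleftrightarrow> integrable P F"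
    using integrable_distr_eq[of "\<tau> k" P "configs M" F] assms by (simp add: distr_\<tau>)
qed

text \<open>By stationarity the covariances form a kernel depending on k - j, positive semidefinite
  because its double sums over finite windows are second moments of sums of shifted copies of
  U.\<close>

lemma field_sum_nonneg:
  fixes U :: "('d, 'm) marked set \<Rightarrow> real"
  assumes U: "U \<in> borel_measurable (configs M)" and U2: "integrable P (\<lambda>\<phi>. (U \<phi>)\<^sup>2)"
    and range: "\<And>k. k \<notin> unit_neighbours \<Longrightarrow> (LINT \<phi>|P. U \<phi> * U (\<tau> k \<phi>)) = 0"
  shows "0 \<le> (\<Sum>k\<in>unit_neighbours. LINT \<phi>|P. U \<phi> * U (\<tau> k \<phi>))"
proof (rule lattice_sum_nonneg[OF range])
  note [measurable] = U
  have U2\<tau>: "integrable P (\<lambda>\<phi>. (U (\<tau> k \<phi>))\<^sup>2)" for k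
    using integral_\<tau>(2)[of "\<lambda>\<phi>. (U \<phi>)\<^sup>2" k] U2 by simp
  have int: "integrable P (\<lambda>\<phi>. U (\<tau> j \<phi>) * U (\<tau> k \<phi>))" for j k
    by (rule integrable_mult_square[OF _ _ U2\<tau> U2\<tau>]) measurable
  fix W :: "(int ^ 'd) set" assume W: "finite W"
  have "0 \<le> (LINT \<phi>|P. (\<Sum>j\<in>W. U (\<tau> j \<phi>))\<^sup>2)" by (rule integral_nonneg_AE) simp
  also have "\<dots> = (LINT \<phi>|P. (\<Sum>j\<in>W. \<Sum>k\<in>W. U (\<tau> j \<phi>) * U (\<tau> k \<phi>)))"
    by (simp add: power2_eq_square sum_product)
  also have "\<dots> = (\<Sum>j\<in>W. \<Sum>k\<in>W. LINT \<phi>|P. U (\<tau> j \<phi>) * U (\<tau> k \<phi>))"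
    using int by simp
  also have "\<dots> = (\<Sum>j\<in>W. \<Sum>k\<in>W. LINT \<phi>|P. U \<phi> * U (\<tau> (k - j) \<phi>))"
  proof (intro sum.cong refl)
    fix j k
    have "(\<lambda>\<phi>. U \<phi> * U (\<tau> (k - j) \<phi>)) \<in> borel_measurable (configs M)" by measurable
    from integral_\<tau>(1)[OF this, of j]
    show "(LINT \<phi>|P. U (\<tau> j \<phi>) * U (\<tau> k \<phi>)) = (LINT \<phi>|P. U \<phi> * U (\<tau> (k - j) \<phi>))"
      by (simp add: \<tau>_\<tau>)
  qed
  finally show "0 \<le> (\<Sum>j\<in>W. \<Sum>k\<in>W. LINT \<phi>|P. U \<phi> * U (\<tau> (k - j) \<phi>))" .
qed

subsection \<open>Local and exterior functionals\<close>

text \<open>Locality is expressed by comparing configurations instead of by a sub-sigma-algebra, so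
  it can be combined directly with gluing and removal of points.\<close>

definition local_fun :: "(('d, 'm) marked set \<Rightarrow> real) \<Rightarrow> bool" where
  "local_fun F \<longleftrightarrow> (\<forall>\<phi>\<in>space (configs M). \<forall>\<psi>\<in>space (configs M). restr \<phi> B = restr \<psi> B \<longrightarrow> F \<phi> = F \<psi>)"

definition exterior_fun :: "(('d, 'm) marked set \<Rightarrow> real) \<Rightarrow> bool" where
  "exterior_fun F \<longleftrightarrow> (\<forall>\<phi>\<in>space (configs M). \<forall>\<psi>\<in>space (configs M). restr \<phi> (- \<Delta>) = restr \<psi> (- \<Delta>) \<longrightarrow> F \<phi> = F \<psi>)"

lemma mem_\<Delta>: "x \<in> \<Delta> \<longleftrightarrow> (\<forall>i. - D / 2 \<le> x $ i \<and> x $ i < D / 2)"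
  by (simp add: cube_def lattice_vec_def)

lemma mem_B: "x \<in> B \<longleftrightarrow> (\<forall>i. - 3 * D / 2 \<le> x $ i \<and> x $ i < 3 * D / 2)"
  by (simp add: cube_def lattice_vec_def)

lemma unif_ball_subset_B:
  assumes "x \<in> \<Delta>" shows "unif_ball x D \<subseteq> B"
proof
  fix y assume y: "y \<in> unif_ball x D"
  show "y \<in> B"
    unfolding mem_B
  proof
    fix i
    have "\<bar>(y - x) $ i\<bar> < D"
      using component_le_infnorm_cart[of "y - x" i] y by (simp add: unif_ball_def)
    moreover have "- D / 2 \<le> x $ i \<and> x $ i < D / 2" using assms by (simp add: mem_\<Delta>)
    ultimately show "- 3 * D / 2 \<le> y $ i \<and> y $ i < 3 * D / 2" by (simp add: abs_less_iff)
  qed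
qed

lemma \<Delta>_subset_B: "\<Delta> \<subseteq> B"
proof
  fix x assume x: "x \<in> \<Delta>"
  have "x \<in> unif_ball x D" using D_pos by (simp add: unif_ball_def infnorm_0)
  then show "x \<in> B" using unif_ball_subset_B[OF x] by blast
qed

lemma cube_subset_B:
  assumes "k \<in> unit_neighbours" shows "cube D k \<subseteq> B"
proof
  fix x assume x: "x \<in> cube D k"
  show "x \<in> B"
    unfolding mem_B
  proof
    fix i
    have "\<bar>k $ i\<bar> \<le> 1" using assms by (simp add: unit_neighbours_iff)
    then have "\<bar>real_of_int (k $ i)\<bar> \<le> 1" by (metis of_int_abs of_int_le_1_iff)
    then have "\<bar>D * real_of_int (k $ i)\<bar> \<le> D * 1"
      using D_pos unfolding abs_mult by (intro mult_mono) auto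
    moreover have "D * real_of_int (k $ i) - D / 2 \<le> x $ i" "x $ i < D * real_of_int (k $ i) + D / 2"
      using x by (auto simp: cube_def lattice_vec_def)
    ultimately show "- 3 * D / 2 \<le> x $ i \<and> x $ i < 3 * D / 2" by linarith
  qed
qed

text \<open>Some coordinate of k has modulus at least 2, so the shift moves \<Delta> at least 2 D,
  up to or past a face of the larger cube. Half-openness of both cubes settles the boundary
  case.\<close>

lemma shift_not_in_B:
  assumes k: "k \<notin> unit_neighbours" and x: "x \<in> \<Delta>"
  shows "x - D *\<^sub>R lattice_vec k \<notin> B"
proof
  assume B: "x - D *\<^sub>R lattice_vec k \<in> B"
  obtain i where "\<not> \<bar>k $ i\<bar> \<le> 1" using k by (auto simp: unit_neighbours_iff)
  then have "2 \<le> k $ i \<or> k $ i \<le> - 2" by linarith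
  then have "2 \<le> real_of_int (k $ i) \<or> real_of_int (k $ i) \<le> - 2" by linarith
  then have "D * 2 \<le> D * real_of_int (k $ i) \<or> D * real_of_int (k $ i) \<le> D * (- 2)"
    using D_pos mult_left_mono[of 2 "real_of_int (k $ i)" D] mult_left_mono[of "real_of_int (k $ i)" "- 2" D] by auto
  moreover have "- D / 2 \<le> x $ i \<and> x $ i < D / 2" using x by (simp add: mem_\<Delta>)
  moreover have "- 3 * D / 2 \<le> x $ i - D * real_of_int (k $ i) \<and> x $ i - D * real_of_int (k $ i) < 3 * D / 2"
    using B unfolding mem_B by (auto simp: lattice_vec_def)
  ultimately show False by linarith
qed

text \<open>The shifted functional reads the configuration over a translate of \<open>B\<close> that
  misses \<Delta>. This turns finite range into exact vanishing of correlations.\<close>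

lemma exterior_\<tau>:
  assumes F: "local_fun F" and k: "k \<notin> unit_neighbours"
  shows "exterior_fun (\<lambda>\<phi>. F (\<tau> k \<phi>))"
  unfolding exterior_fun_def
proof (intro ballI impI)
  fix \<phi> \<psi> assume \<phi>: "\<phi> \<in> space (configs M)" and \<psi>: "\<psi> \<in> space (configs M)"
    and eq: "restr \<phi> (- \<Delta>) = restr \<psi> (- \<Delta>)"
  have mem: "(x, m) \<in> \<phi> \<longleftrightarrow> (x, m) \<in> \<psi>" if "x \<notin> \<Delta>" for x m
    using eq that by (auto simp: restr_def set_eq_iff)
  have "restr (\<tau> k \<phi>) B = restr (\<tau> k \<psi>) B"
  proof (rule set_eqI)
    fix z :: "('d, 'm) marked"
    obtain x m where z: "z = (x, m)" by force
    have "x + D *\<^sub>R lattice_vec k \<notin> \<Delta>" if "x \<in> B"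
      using shift_not_in_B[OF k, of "x + D *\<^sub>R lattice_vec k"] that by auto
    then show "z \<in> restr (\<tau> k \<phi>) B \<longleftrightarrow> z \<in> restr (\<tau> k \<psi>) B"
      using mem by (auto simp: z restr_def \<tau>_def mem_translate)
  qed
  then show "F (\<tau> k \<phi>) = F (\<tau> k \<psi>)"
    using F config_\<tau>[OF \<phi>] config_\<tau>[OF \<psi>] unfolding local_fun_def by blast
qed

lemma exterior_glue:
  assumes "exterior_fun F" "\<phi> \<in> space (configs M)" "\<psi> \<in> space (configs M)"
  shows "F (glue \<Delta> \<psi> \<phi>) = F \<phi>"
proof -
  have "restr (glue \<Delta> \<psi> \<phi>) (- \<Delta>) = restr \<phi> (- \<Delta>)" by (auto simp: restr_def)
  then show ?thesis using assms config_glue[OF assms(2,3)] unfolding exterior_fun_def by blast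
qed

lemma J_exterior:
  assumes c: "c \<le> 1" and Fm: "F \<in> borel_measurable (configs M)" and F: "integrable P F" and ext: "exterior_fun F"
  shows "integrable P (\<lambda>\<phi>. J c \<Delta> \<phi> * F \<phi>)" "(LINT \<phi>|P. J c \<Delta> \<phi> * F \<phi>) = 0"
proof -
  have inv: "F (\<phi> - {z}) = F \<phi>" if "\<phi> \<in> space (configs M)" "z \<in> \<phi>" "z \<in> \<Delta> \<times> space M" for \<phi> z
  proof -
    have "restr (\<phi> - {z}) (- \<Delta>) = restr \<phi> (- \<Delta>)" using that by (auto simp: restr_def)
    moreover have "\<phi> - {z} \<in> space (configs M)" using that(1) by (rule config_mono) auto
    ultimately show ?thesis using ext that(1) unfolding exterior_fun_def by blast
  qed
  show "integrable P (\<lambda>\<phi>. J c \<Delta> \<phi> * F \<phi>)" "(LINT \<phi>|P. J c \<Delta> \<phi> * F \<phi>) = 0"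
    using J_orthogonal[OF cube_bounded_borel c Fm F inv] by auto
qed

lemma J_local: "local_fun (J c \<Delta>)"
  unfolding local_fun_def using J_cong[OF cube_bounded_borel _ _ unif_ball_subset_B] by blast

lemma J_cube:
  assumes "\<phi> \<in> space (configs M)" shows "J c (cube D k) \<phi> = J c \<Delta> (\<tau> k \<phi>)"
  using J_translate[OF cube_bounded_borel config_\<tau>[OF assms, of k], where y="D *\<^sub>R lattice_vec k"]
  by (simp add: cube_translate[of D k] \<tau>_def translate_translate)

end


context gibbs_model
begin

subsection \<open>A centred local functional\<close>

abbreviation D0 :: "('d, 'm) marked set" where "D0 \<equiv> \<Delta> \<times> space M"

abbreviation R0 :: "('d, 'm) marked set" where "R0 \<equiv> (B - \<Delta>) \<times> space M"

lemma \<Delta>_borel: "\<Delta> \<in> sets borel"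
proof -
  have "bounded_borel \<Delta>" by (rule cube_bounded_borel)
  then show ?thesis by (simp add: bounded_borel_def)
qed

lemma D0_bdd: "D0 \<in> bdd_sets M"
  by (rule bdd_sets_Times[OF cube_bounded_borel])

lemma R0_bdd: "R0 \<in> bdd_sets M"
proof -
  have "bounded_borel (B - \<Delta>)"
    using cube_bounded_borel[of "3 * D" 0] cube_bounded_borel[of D 0]
    by (auto simp: bounded_borel_def bounded_diff)
  then show ?thesis by (rule bdd_sets_Times)
qed

text \<open>The unnormalised Gibbs weight of having j points in the cube with nothing around it,
  with the energy of the empty configuration set to zero.\<close>

definition \<alpha> :: "nat \<Rightarrow> ennreal" where
  "\<alpha> j = (\<integral>\<^sup>+\<psi>. indicator {\<psi>. card (\<psi> \<inter> D0) = j} \<psi> * ennreal (exp (- (H \<Delta> (restr \<psi> \<Delta>) - H \<Delta> {}))) \<partial>Q)"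

text \<open>Points are inserted one by one; each has its interaction ball inside \<open>B\<close>,
  where \<phi> has no points, so its local energy is the same with and without \<phi>.\<close>

lemma H_isolated:
  assumes X: "finite X" "X \<subseteq> D0" and \<phi>: "\<phi> \<in> space (configs M)" "restr \<phi> B = {}"
  shows "H \<Delta> (X \<union> \<phi>) = H \<Delta> \<phi> + (H \<Delta> X - H \<Delta> {}) \<and> X \<in> space (configs M)"
  using X
proof (induction X rule: finite_induct)
  case empty
  show ?case by (simp add: config_empty)
next
  case (insert z X)
  then have z: "z \<in> D0" and X: "X \<in> space (configs M)" and IH: "H \<Delta> (X \<union> \<phi>) = H \<Delta> \<phi> + (H \<Delta> X - H \<Delta> {})"
    by auto
  have X\<phi>: "X \<union> \<phi> \<in> space (configs M)" using X \<phi>(1) by (rule config_Un)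
  have "unif_ball (fst z) D \<subseteq> B" using z by (intro unif_ball_subset_B) auto
  then have "restr (X \<union> \<phi>) (unif_ball (fst z) D) = restr X (unif_ball (fst z) D)"
    using \<phi>(2) by (auto simp: restr_def)
  then have "V z (X \<union> \<phi>) = V z X"
    using z by (intro V_cong[OF X\<phi> X]) auto
  moreover have "insert z X \<in> space (configs M)" using z by (intro config_insert X) auto
  ultimately show ?case
    using H_insert[OF cube_bounded_borel z X\<phi>] H_insert[OF cube_bounded_borel z X] IH by simp
qed

text \<open>Each inserted point raises the energy by at least - K. This stability bound makes the
  weights \<alpha> finite.\<close>

lemma H_lower:
  assumes X: "finite X" "X \<subseteq> D0"
  shows "- K * real (card X) \<le> H \<Delta> X - H \<Delta> {} \<and> X \<in> space (configs M)"
  using X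
proof (induction X rule: finite_induct)
  case empty
  show ?case by (simp add: config_empty)
next
  case (insert z X)
  then have z: "z \<in> D0" and X: "X \<in> space (configs M)" and IH: "- K * real (card X) \<le> H \<Delta> X - H \<Delta> {}"
    by auto
  have "- K \<le> V z X" using z by (intro K(2) X) auto
  moreover have "insert z X \<in> space (configs M)" using z by (intro config_insert X) auto
  ultimately show ?case
    using H_insert[OF cube_bounded_borel z X] IH insert by (simp add: algebra_simps)
qed

lemma restr_\<Delta>: "\<psi> \<in> space (configs M) \<Longrightarrow> restr \<psi> \<Delta> = \<psi> \<inter> D0"
  using config_subset[of \<psi> M] by (auto simp: restr_def)

lemma finite_D0: "\<psi> \<in> space (configs M) \<Longrightarrow> finite (\<psi> \<inter> D0)"
  by (rule finite_config_Int[OF _ bdd_setsD(2)[OF D0_bdd]])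

lemma \<alpha>_measurable_integrand:
  "(\<lambda>\<psi>. indicator {\<psi>. card (\<psi> \<inter> D0) = j} \<psi> * ennreal (exp (- (H \<Delta> (restr \<psi> \<Delta>) - H \<Delta> {})))) \<in> borel_measurable Q"
proof -
  note [measurable] = \<Delta>_borel measurable_card[OF D0_bdd] H_measurable[OF cube_bounded_borel]
  have [measurable]: "(\<lambda>\<psi>. H \<Delta> (restr \<psi> \<Delta>)) \<in> borel_measurable Q"
    by (rule measurable_compose[OF _ H_measurable[OF cube_bounded_borel]]) measurable
  have "(\<lambda>\<psi>. (if card (\<psi> \<inter> D0) = j then 1 else 0) * ennreal (exp (- (H \<Delta> (restr \<psi> \<Delta>) - H \<Delta> {})))) \<in> borel_measurable Q"
    by measurable
  then show ?thesis by (simp add: indicator_def)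
qed

lemma \<alpha>_finite: "\<alpha> j < \<infinity>"
proof -
  have "\<alpha> j \<le> (\<integral>\<^sup>+\<psi>. ennreal (exp (K * real j)) \<partial>Q)"
    unfolding \<alpha>_def
  proof (rule nn_integral_mono)
    fix \<psi> assume "\<psi> \<in> space Q"
    then have \<psi>: "\<psi> \<in> space (configs M)" by (simp add: space_Q)
    show "indicator {\<psi>. card (\<psi> \<inter> D0) = j} \<psi> * ennreal (exp (- (H \<Delta> (restr \<psi> \<Delta>) - H \<Delta> {}))) \<le> ennreal (exp (K * real j))"
      using H_lower[OF finite_D0[OF \<psi>]] by (auto simp: indicator_def restr_\<Delta>[OF \<psi>] intro!: ennreal_leI)
  qed
  also have "\<dots> < \<infinity>" by (simp add: Q.emeasure_space_1)
  finally show ?thesis .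
qed

text \<open>With no points in the cube the Boltzmann factor is 1, so the weight is at least the
  Poisson void probability.\<close>

lemma \<alpha>_0_pos: "0 < \<alpha> 0"
proof -
  have [measurable]: "{\<psi> \<in> space Q. card (\<psi> \<inter> D0) = 0} \<in> sets Q"
    using measurable_card[OF D0_bdd] by measurable
  have "0 < measure Q {\<psi> \<in> space Q. card (\<psi> \<inter> D0) = 0}"
    by (simp add: prob_count[OF D0_bdd])
  then have "0 < (\<integral>\<^sup>+\<psi>. indicator {\<psi> \<in> space Q. card (\<psi> \<inter> D0) = 0} \<psi> \<partial>Q)"
    by (simp add: Q.emeasure_eq_measure)
  also have "\<dots> \<le> \<alpha> 0"
    unfolding \<alpha>_def
  proof (rule nn_integral_mono)
    fix \<psi> assume "\<psi> \<in> space Q"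
    then have \<psi>: "\<psi> \<in> space (configs M)" by (simp add: space_Q)
    show "indicator {\<psi> \<in> space Q. card (\<psi> \<inter> D0) = 0} \<psi> \<le>
      indicator {\<psi>. card (\<psi> \<inter> D0) = 0} \<psi> * ennreal (exp (- (H \<Delta> (restr \<psi> \<Delta>) - H \<Delta> {})))"
      using finite_D0[OF \<psi>] by (auto simp: indicator_def restr_\<Delta>[OF \<psi>])
  qed
  finally show ?thesis .
qed

definition E :: "nat \<Rightarrow> ('d, 'm) marked set set" where
  "E j = {\<phi> \<in> space (configs M). card (\<phi> \<inter> R0) = 0 \<and> card (\<phi> \<inter> D0) = j}"

lemma E_sets [measurable]: "E j \<in> sets (configs M)"
  unfolding E_def using measurable_card[OF D0_bdd] measurable_card[OF R0_bdd] by measurable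

lemma card_glue:
  assumes \<phi>: "\<phi> \<in> space (configs M)" and \<psi>: "\<psi> \<in> space (configs M)"
  shows "glue \<Delta> \<psi> \<phi> \<in> E j \<longleftrightarrow> card (\<phi> \<inter> R0) = 0 \<and> card (\<psi> \<inter> D0) = j"
proof -
  have "glue \<Delta> \<psi> \<phi> \<inter> R0 = \<phi> \<inter> R0" "glue \<Delta> \<psi> \<phi> \<inter> D0 = \<psi> \<inter> D0"
    by (auto simp: restr_def)
  then show ?thesis using config_glue[OF \<phi> \<psi>] by (simp add: E_def)
qed

text \<open>On the event that the shell around the cube is empty, the conditional law of the points in
  the cube no longer depends on the exterior configuration: the weights \<open>\<alpha> j\<close> are constants.\<close>

lemma expectation_E:
  fixes F :: "('d, 'm) marked set \<Rightarrow> ennreal"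
  assumes F: "F \<in> borel_measurable (configs M)"
    and ext: "\<And>\<phi> \<psi>. \<phi> \<in> space (configs M) \<Longrightarrow> \<psi> \<in> space (configs M) \<Longrightarrow> F (glue \<Delta> \<psi> \<phi>) = F \<phi>"
  shows "\<alpha> i * (\<integral>\<^sup>+\<phi>. F \<phi> * indicator (E j) \<phi> \<partial>P) = \<alpha> j * (\<integral>\<^sup>+\<phi>. F \<phi> * indicator (E i) \<phi> \<partial>P)"
proof -
  \<comment> \<open>All factors that depend on the exterior alone: F, the empty shell, and the
    exterior Boltzmann weight over the partition function. The remaining factor integrates to
    \<open>\<alpha> j\<close>, and the claim is then symmetric in i and j.\<close>
  define \<rho> where "\<rho> \<phi> = F \<phi> * (indicator {\<phi>. card (\<phi> \<inter> R0) = 0} \<phi> *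
    (ennreal (exp (- H \<Delta> (restr \<phi> (- \<Delta>)))) / partition_function Q v \<theta>s \<Delta> \<phi>))" for \<phi>
  have \<rho>m: "\<rho> \<in> borel_measurable P"
  proof -
    note [measurable] = partition_function_measurable[OF cube_bounded_borel] F measurable_card[OF R0_bdd]
    have [measurable]: "- \<Delta> \<in> sets borel" using \<Delta>_borel by (rule borel_comp)
    have [measurable]: "(\<lambda>\<phi>. H \<Delta> (restr \<phi> (- \<Delta>))) \<in> borel_measurable P"
      by (rule measurable_compose[OF _ H_measurable[OF cube_bounded_borel]]) measurable
    have "(\<lambda>\<phi>. F \<phi> * ((if card (\<phi> \<inter> R0) = 0 then 1 else 0) *
      (ennreal (exp (- H \<Delta> (restr \<phi> (- \<Delta>)))) / partition_function Q v \<theta>s \<Delta> \<phi>))) \<in> borel_measurable P"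
      by measurable
    then show ?thesis by (simp add: \<rho>_def[abs_def] indicator_def)
  qed
  have key: "(\<integral>\<^sup>+\<phi>. F \<phi> * indicator (E j) \<phi> \<partial>P) = \<alpha> j * (\<integral>\<^sup>+\<phi>. \<rho> \<phi> \<partial>P)" for j
  proof -
    have "(\<integral>\<^sup>+\<phi>. F \<phi> * indicator (E j) \<phi> \<partial>P)
      = (\<integral>\<^sup>+\<phi>. \<integral>\<^sup>+\<psi>. F (glue \<Delta> \<psi> \<phi>) * indicator (E j) (glue \<Delta> \<psi> \<phi>) * w \<Delta> \<phi> \<psi> \<partial>Q \<partial>P)"
      by (intro dlr[OF cube_bounded_borel] borel_measurable_times_ennreal borel_measurable_indicator E_sets F)
    also have "\<dots> = (\<integral>\<^sup>+\<phi>. \<integral>\<^sup>+\<psi>. \<rho> \<phi> * (indicator {\<psi>. card (\<psi> \<inter> D0) = j} \<psi> * ennreal (exp (- (H \<Delta> (restr \<psi> \<Delta>) - H \<Delta> {})))) \<partial>Q \<partial>P)"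
    proof (intro nn_integral_cong)
      fix \<phi> \<psi> assume "\<phi> \<in> space P" "\<psi> \<in> space Q"
      then have \<phi>: "\<phi> \<in> space (configs M)" and \<psi>: "\<psi> \<in> space (configs M)" by (auto simp: space_P space_Q)
      show "F (glue \<Delta> \<psi> \<phi>) * indicator (E j) (glue \<Delta> \<psi> \<phi>) * w \<Delta> \<phi> \<psi>
        = \<rho> \<phi> * (indicator {\<psi>. card (\<psi> \<inter> D0) = j} \<psi> * ennreal (exp (- (H \<Delta> (restr \<psi> \<Delta>) - H \<Delta> {}))))"
      proof (cases "card (\<phi> \<inter> R0) = 0 \<and> card (\<psi> \<inter> D0) = j")
        case True
        have "finite (\<phi> \<inter> R0)" by (rule finite_config_Int[OF \<phi> bdd_setsD(2)[OF R0_bdd]])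
        with True have "\<phi> \<inter> R0 = {}" by simp
        then have "restr (restr \<phi> (- \<Delta>)) B = {}"
          using config_subset[OF \<phi>] by (auto simp: restr_def)
        then have "H \<Delta> (\<psi> \<inter> D0 \<union> restr \<phi> (- \<Delta>)) = H \<Delta> (restr \<phi> (- \<Delta>)) + (H \<Delta> (\<psi> \<inter> D0) - H \<Delta> {})"
          using H_isolated[OF finite_D0[OF \<psi>] _ config_restr[OF \<phi>]] by blast
        then have "ennreal (exp (- H \<Delta> (glue \<Delta> \<psi> \<phi>)))
          = ennreal (exp (- H \<Delta> (restr \<phi> (- \<Delta>)))) * ennreal (exp (- (H \<Delta> (restr \<psi> \<Delta>) - H \<Delta> {})))"
          by (simp add: restr_\<Delta>[OF \<psi>] ennreal_mult[symmetric] exp_add[symmetric])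
        then show ?thesis
          using True card_glue[OF \<phi> \<psi>, of j]
          by (simp add: w_def \<rho>_def ext[OF \<phi> \<psi>] divide_ennreal_def ac_simps)
      next
        case False
        then show ?thesis using card_glue[OF \<phi> \<psi>, of j] by (auto simp: \<rho>_def)
      qed
    qed
    also have "\<dots> = (\<integral>\<^sup>+\<phi>. \<rho> \<phi> * \<alpha> j \<partial>P)"
      unfolding \<alpha>_def by (intro nn_integral_cong nn_integral_cmult \<alpha>_measurable_integrand)
    also have "\<dots> = \<alpha> j * (\<integral>\<^sup>+\<phi>. \<rho> \<phi> \<partial>P)"
      using \<rho>m by (simp add: nn_integral_multc mult.commute)
    finally show ?thesis .
  qed
  show ?thesis unfolding key by (simp add: ac_simps)
qed

definition Y :: "nat \<Rightarrow> ('d, 'm) marked set \<Rightarrow> real" where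
  "Y n \<phi> = enn2real (\<alpha> n) * indicator (E 0) \<phi> - enn2real (\<alpha> 0) * indicator (E n) \<phi>"

lemma Y_measurable [measurable]: "Y n \<in> borel_measurable (configs M)"
  unfolding Y_def[abs_def] by measurable

lemma Y_bounded: "\<bar>Y n \<phi>\<bar> \<le> enn2real (\<alpha> n) + enn2real (\<alpha> 0)"
  using enn2real_nonneg[of "\<alpha> n"] enn2real_nonneg[of "\<alpha> 0"]
  by (auto simp: Y_def indicator_def abs_le_iff)

lemma Y_square_integrable: "integrable P (\<lambda>\<phi>. (Y n \<phi>)\<^sup>2)"
proof (rule P.integrable_const_bound[where B="(enn2real (\<alpha> n) + enn2real (\<alpha> 0))\<^sup>2"])
  show "AE \<phi> in P. norm ((Y n \<phi>)\<^sup>2) \<le> (enn2real (\<alpha> n) + enn2real (\<alpha> 0))\<^sup>2"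
    using power_mono[OF Y_bounded abs_ge_zero, of _ _ 2] by simp
qed measurable

lemma Y_local: "local_fun (Y n)"
  unfolding local_fun_def
proof (intro ballI impI)
  fix \<phi> \<psi> assume \<phi>: "\<phi> \<in> space (configs M)" and \<psi>: "\<psi> \<in> space (configs M)" and eq: "restr \<phi> B = restr \<psi> B"
  have mem: "(x, m) \<in> \<phi> \<longleftrightarrow> (x, m) \<in> \<psi>" if "x \<in> B" for x m
    using eq that by (auto simp: restr_def set_eq_iff)
  have "\<phi> \<inter> R0 = \<psi> \<inter> R0" "\<phi> \<inter> D0 = \<psi> \<inter> D0"
    using mem \<Delta>_subset_B by (auto simp: subset_iff)
  then have "\<phi> \<in> E j \<longleftrightarrow> \<psi> \<in> E j" for j
    using \<phi> \<psi> by (simp add: E_def)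
  then show "Y n \<phi> = Y n \<psi>" by (simp add: Y_def indicator_def)
qed

text \<open>An exterior F gives the events \<open>E 0\<close> and \<open>E n\<close> masses in the
  ratio of \<open>\<alpha> 0\<close> to \<open>\<alpha> n\<close>; the crossed coefficients in
  \<open>Y\<close> cancel them.\<close>

lemma Y_exterior_nonneg:
  fixes F :: "('d, 'm) marked set \<Rightarrow> real"
  assumes Fm: "F \<in> borel_measurable (configs M)" and F: "integrable P F" "\<And>\<phi>. 0 \<le> F \<phi>" and ext: "exterior_fun F"
  shows "integrable P (\<lambda>\<phi>. Y n \<phi> * F \<phi>) \<and> (LINT \<phi>|P. Y n \<phi> * F \<phi>) = 0"
proof -
  note [measurable] = Fm
  have i: "integrable P (\<lambda>\<phi>. F \<phi> * indicator (E j) \<phi>)" for j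
    using F(1) by (intro integrable_real_mult_indicator) (simp_all add: sets_P)
  have e: "(\<integral>\<^sup>+\<phi>. ennreal (F \<phi>) * indicator (E j) \<phi> \<partial>P) = ennreal (LINT \<phi>|P. F \<phi> * indicator (E j) \<phi>)" for j
    by (subst nn_integral_eq_integral[OF i, symmetric])
      (auto simp: F(2) indicator_def intro!: nn_integral_cong)
  have al: "\<alpha> j = ennreal (enn2real (\<alpha> j))" for j
    using \<alpha>_finite[of j] by simp
  have pos: "0 \<le> (LINT \<phi>|P. F \<phi> * indicator (E j) \<phi>)" for j
    by (intro integral_nonneg_AE) (simp add: F(2))
  have "\<alpha> n * (\<integral>\<^sup>+\<phi>. ennreal (F \<phi>) * indicator (E 0) \<phi> \<partial>P) = \<alpha> 0 * (\<integral>\<^sup>+\<phi>. ennreal (F \<phi>) * indicator (E n) \<phi> \<partial>P)"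
    using exterior_glue[OF ext] by (intro expectation_E) auto
  then have "ennreal (enn2real (\<alpha> n) * (LINT \<phi>|P. F \<phi> * indicator (E 0) \<phi>)) =
    ennreal (enn2real (\<alpha> 0) * (LINT \<phi>|P. F \<phi> * indicator (E n) \<phi>))"
    unfolding e using al[of n] al[of 0] by (simp add: ennreal_mult pos)
  then have eq: "enn2real (\<alpha> n) * (LINT \<phi>|P. F \<phi> * indicator (E 0) \<phi>) = enn2real (\<alpha> 0) * (LINT \<phi>|P. F \<phi> * indicator (E n) \<phi>)"
    by (subst (asm) ennreal_inj) (auto simp: pos)
  have Y: "Y n \<phi> * F \<phi> = enn2real (\<alpha> n) * (F \<phi> * indicator (E 0) \<phi>) - enn2real (\<alpha> 0) * (F \<phi> * indicator (E n) \<phi>)" for \<phi>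
    by (simp add: Y_def algebra_simps)
  show ?thesis
    unfolding Y using i eq by simp
qed

lemma exterior_fun_comp: "exterior_fun F \<Longrightarrow> exterior_fun (\<lambda>\<phi>. g (F \<phi>))"
  unfolding exterior_fun_def by (intro ballI impI arg_cong[where f=g]) blast

lemma Y_exterior:
  fixes F :: "('d, 'm) marked set \<Rightarrow> real"
  assumes Fm: "F \<in> borel_measurable (configs M)" and F: "integrable P F" and ext: "exterior_fun F"
  shows "integrable P (\<lambda>\<phi>. Y n \<phi> * F \<phi>)" "(LINT \<phi>|P. Y n \<phi> * F \<phi>) = 0"
proof -
  note [measurable] = Fm
  have p: "integrable P (\<lambda>\<phi>. Y n \<phi> * max 0 (F \<phi>)) \<and> (LINT \<phi>|P. Y n \<phi> * max 0 (F \<phi>)) = 0"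
    using F by (intro Y_exterior_nonneg exterior_fun_comp[OF ext]) auto
  have m: "integrable P (\<lambda>\<phi>. Y n \<phi> * max 0 (- F \<phi>)) \<and> (LINT \<phi>|P. Y n \<phi> * max 0 (- F \<phi>)) = 0"
    using F by (intro Y_exterior_nonneg exterior_fun_comp[OF ext]) auto
  have eq: "Y n \<phi> * F \<phi> = Y n \<phi> * max 0 (F \<phi>) - Y n \<phi> * max 0 (- F \<phi>)" for \<phi>
    by (simp add: max_def)
  show "integrable P (\<lambda>\<phi>. Y n \<phi> * F \<phi>)" "(LINT \<phi>|P. Y n \<phi> * F \<phi>) = 0"
    unfolding eq using p m by auto
qed

section \<open>Positive probability of an empty shell around n points\<close>

lemma measure_D0_pos: "0 < measure (mu M) D0"
proof -
  interpret M: prob_space M by (rule marks)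
  let ?u = "(\<chi> i. D / 2) :: real ^ 'd"
  have "box (- ?u) ?u \<subseteq> \<Delta>" by (auto simp: mem_box_cart mem_\<Delta> less_imp_le)
  moreover have "\<Delta> \<in> sets lborel" using \<Delta>_borel by simp
  ultimately have "emeasure lborel (box (- ?u) ?u) \<le> emeasure lborel \<Delta>"
    by (rule emeasure_mono)
  moreover have "0 < emeasure lborel (box (- ?u) ?u)"
  proof -
    have ub: "?u \<bullet> b = D / 2" if "b \<in> Basis" for b
      using that by (auto simp: Basis_vec_def inner_axis)
    have "emeasure lborel (box (- ?u) ?u) = ennreal (\<Prod>b\<in>Basis. (?u - - ?u) \<bullet> b)"
      by (rule emeasure_lborel_box) (use D_pos in \<open>simp add: ub\<close>)
    also have "(\<Prod>b\<in>Basis. (?u - - ?u) \<bullet> b) = (\<Prod>b\<in>(Basis :: (real ^ 'd) set). D)"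
    proof (intro prod.cong refl)
      fix b :: "real ^ 'd" assume b: "b \<in> Basis"
      have "(?u - - ?u) \<bullet> b = D / 2 - - (D / 2)"
        unfolding inner_diff_left inner_minus_left ub[OF b] ..
      then show "(?u - - ?u) \<bullet> b = D" by linarith
    qed
    finally show ?thesis using D_pos by simp
  qed
  ultimately have "0 < emeasure lborel \<Delta>" by simp
  moreover have "emeasure (mu M) D0 = emeasure lborel \<Delta>"
    using \<open>\<Delta> \<in> sets lborel\<close> by (simp add: mu_def M.emeasure_pair_measure_Times M.emeasure_space_1)
  ultimately have "0 < emeasure (mu M) D0" by simp
  then show ?thesis unfolding emeasure_bdd_sets[OF marks D0_bdd] by simp
qed

lemma Q_E_pos: "0 < emeasure Q (E n)"
proof -
  \<comment> \<open>Index 0 stands for the cube, required to hold n points, and index 1 for the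
    shell, required to be empty.\<close>
  define C where "C i = (if i = 0 then D0 else R0)" for i :: nat
  define k where "k i = (if i = 0 then n else 0)" for i :: nat
  have "E n = {\<phi> \<in> space Q. \<forall>i\<in>{0, 1}. card (\<phi> \<inter> C i) = k i}"
    by (auto simp: E_def C_def k_def space_Q)
  moreover have "disjoint_family_on C {0, 1}" by (auto simp: disjoint_family_on_def C_def)
  moreover have "C i \<in> bdd_sets M" for i by (simp add: C_def D0_bdd R0_bdd)
  ultimately have "measure Q (E n) = (\<Prod>i\<in>{0, 1}. exp (- measure (mu M) (C i)) * measure (mu M) (C i) ^ k i / fact (k i))"
    using prob_counts[of "{0, 1}" C k] by simp
  also have "\<dots> > 0" using measure_D0_pos by (simp add: C_def k_def)
  finally show ?thesis by (simp add: Q.emeasure_eq_measure)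
qed

text \<open>Conditionally on the exterior of \<open>B\<close>, the density with respect to
  \<open>Q\<close> is nowhere zero, because the partition function is finite. A null event of
  \<open>P\<close> that is determined inside \<open>B\<close> would thus be null for the Poisson
  process as well.\<close>

lemma P_E_pos: "0 < measure P (E n)"
proof -
  have BB: "bounded_borel B" by (rule cube_bounded_borel)
  have "emeasure P (E n) \<noteq> 0"
  proof
    assume 0: "emeasure P (E n) = 0"
    have "(\<integral>\<^sup>+\<phi>. \<integral>\<^sup>+\<psi>. indicator (E n) (glue B \<psi> \<phi>) * w B \<phi> \<psi> \<partial>Q \<partial>P) = (\<integral>\<^sup>+\<phi>. indicator (E n) \<phi> \<partial>P)"
      by (intro dlr[OF BB, symmetric]) measurable
    also have "\<dots> = 0" using 0 by (simp add: sets_P)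
    finally have z: "(\<integral>\<^sup>+\<phi>. \<integral>\<^sup>+\<psi>. indicator (E n) (glue B \<psi> \<phi>) * w B \<phi> \<psi> \<partial>Q \<partial>P) = 0" .
    have m: "(\<lambda>(\<phi>, \<psi>). indicator (E n) (glue B \<psi> \<phi>) * w B \<phi> \<psi>) \<in> borel_measurable (P \<Otimes>\<^sub>M Q)"
      using w_measurable[OF BB] measurable_compose[OF measurable_glue_pair[OF BB] borel_measurable_indicator[OF E_sets[of n]]]
      unfolding case_prod_unfold by (intro borel_measurable_times_ennreal) simp_all
    have "AE \<phi> in P. (\<integral>\<^sup>+\<psi>. indicator (E n) (glue B \<psi> \<phi>) * w B \<phi> \<psi> \<partial>Q) = 0"
      using z Q.borel_measurable_nn_integral_fst[OF m] by (subst (asm) nn_integral_0_iff_AE) auto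
    moreover have "AE \<phi> in P. partition_function Q v \<theta>s B \<phi> < \<infinity>"
    proof -
      have "AE \<phi> in P. 0 < partition_function Q v \<theta>s B \<phi> \<and> partition_function Q v \<theta>s B \<phi> < \<infinity>"
        using gibbs BB unfolding gibbs_measure_def by blast
      then show ?thesis by eventually_elim simp
    qed
    ultimately have "AE \<phi> in P. False"
      using AE_space
    proof eventually_elim
      case (elim \<phi>)
      then have \<phi>: "\<phi> \<in> space (configs M)" by (simp add: space_P)
      have m': "(\<lambda>\<psi>. indicator (E n) (glue B \<psi> \<phi>) * w B \<phi> \<psi>) \<in> borel_measurable Q"
        using measurable_compose[OF measurable_Pair1'[OF elim(3)] m] by simp
      have "AE \<psi> in Q. indicator (E n) (glue B \<psi> \<phi>) * w B \<phi> \<psi> = 0"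
        using elim(1) m' by (subst (asm) nn_integral_0_iff_AE) auto
      then have "AE \<psi> in Q. \<psi> \<notin> E n"
        using AE_space
      proof eventually_elim
        case (elim \<psi>)
        then have \<psi>: "\<psi> \<in> space (configs M)" by (simp add: space_Q)
        have "w B \<phi> \<psi> \<noteq> 0"
          using \<open>partition_function Q v \<theta>s B \<phi> < \<infinity>\<close> by (simp add: w_def ennreal_divide_eq_0_iff)
        then have "glue B \<psi> \<phi> \<notin> E n" using elim(1) by (auto simp: indicator_def split: if_splits)
        moreover have "glue B \<psi> \<phi> \<inter> R0 = \<psi> \<inter> R0" "glue B \<psi> \<phi> \<inter> D0 = \<psi> \<inter> D0"
          using \<Delta>_subset_B by (auto simp: restr_def)
        ultimately show "\<psi> \<notin> E n" using config_glue[OF \<phi> \<psi>, of B] by (auto simp: E_def)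
      qed
      then have "emeasure Q (E n) = 0"
        by (subst (asm) AE_iff_measurable[of "E n"])
          (use E_sets[of n] sets.sets_into_space[of "E n" "configs M"] in \<open>auto simp: sets_Q space_Q\<close>)
      then show False using Q_E_pos[of n] by simp
    qed
    then show False by simp
  qed
  then show ?thesis by (simp add: P.emeasure_eq_measure measure_nonneg less_le)
qed

subsection \<open>Positivity of the lattice sum of covariances\<close>

lemma J_nonneg_on_empty:
  assumes \<phi>: "\<phi> \<in> E 0" and k: "k \<in> unit_neighbours"
  shows "0 \<le> J c (cube D k) \<phi>"
proof -
  have \<phi>': "\<phi> \<in> space (configs M)" using \<phi> by (simp add: E_def)
  have "\<phi> \<inter> R0 = {}" "\<phi> \<inter> D0 = {}"
    using \<phi> finite_D0[OF \<phi>'] finite_config_Int[OF \<phi>' bdd_setsD(2)[OF R0_bdd]] by (auto simp: E_def)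
  then have "\<phi> \<inter> cube D k \<times> space M = {}"
    using cube_subset_B[OF k] by blast
  then show ?thesis by (simp add: J_def S_def A_nonneg)
qed

lemma J_le:
  assumes "\<phi> \<in> space (configs M)" "c \<le> 1"
  shows "J c (cube D k) \<phi> \<le> a c (cube D k)"
  using A_le[OF cube_bounded_borel[of D k] assms] S_nonneg[of c "cube D k" \<phi>] by (simp add: J_def)

lemma S_ge:
  assumes \<phi>: "\<phi> \<in> space (configs M)" and c: "0 \<le> c"
  shows "real (card (\<phi> \<inter> D0)) * exp (- c * K) \<le> S c \<Delta> \<phi>"
proof -
  have "exp (- c * K) \<le> exp (c * Vm \<Delta> (z, \<phi> - {z}))" if "z \<in> \<phi> \<inter> D0" for z
  proof -
    have "\<phi> - {z} \<in> space (configs M)" using \<phi> by (rule config_mono) auto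
    then have "c * (- K) \<le> c * Vm \<Delta> (z, \<phi> - {z})"
      using that c by (intro mult_left_mono Vm_ge[OF cube_bounded_borel]) auto
    then show ?thesis by simp
  qed
  then have "(\<Sum>z\<in>\<phi> \<inter> D0. exp (- c * K)) \<le> S c \<Delta> \<phi>"
    unfolding S_def by (rule sum_mono)
  then show ?thesis by simp
qed

lemma sum_correlation_pos:
  assumes c: "0 \<le> c" "c \<le> 1" and J2: "integrable P (\<lambda>\<phi>. (J c \<Delta> \<phi>)\<^sup>2)"
  shows "0 < (\<Sum>k\<in>unit_neighbours. LINT \<phi>|P. J c \<Delta> \<phi> * J c \<Delta> (\<tau> k \<phi>))"
proof -
  let ?U = "unit_neighbours :: (int ^ 'd) set"
  let ?X = "J c \<Delta>"
  have Xm [measurable]: "?X \<in> borel_measurable (configs M)" by (rule J_measurable[OF cube_bounded_borel])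
  \<comment> \<open>Bounds the total of the compensators over \<Delta> and its neighbours. With n
    points in the cube, each contributing at least exp (- c K), the innovation sum falls to -1 or
    below.\<close>
  define b where "b = (\<Sum>k\<in>?U. a c (cube D k))"
  obtain n0 :: nat where n0: "(b + 1) / exp (- c * K) \<le> real n0"
    using real_arch_simple by blast
  \<comment> \<open>The successor guarantees n \<noteq> 0, which keeps \<open>E 0\<close> and
    \<open>E n\<close> disjoint.\<close>
  define n where "n = Suc n0"
  have n: "b + 1 \<le> real n * exp (- c * K)" "n \<noteq> 0"
  proof -
    have "b + 1 \<le> real n0 * exp (- c * K)" using n0 by (simp only: pos_divide_le_eq exp_gt_zero)
    also have "\<dots> \<le> real n * exp (- c * K)" by (intro mult_right_mono) (auto simp: n_def)
    finally show "b + 1 \<le> real n * exp (- c * K)" .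
  qed (simp add: n_def)
  let ?Y = "Y n"
  define e where "e F G = (\<Sum>k\<in>?U. LINT \<phi>|P. F \<phi> * G (\<tau> k \<phi>))" for F G :: "('d, 'm) marked set \<Rightarrow> real"
  have sq\<tau>: "integrable P (\<lambda>\<phi>. (F (\<tau> k \<phi>))\<^sup>2)"
    if "integrable P (\<lambda>\<phi>. (F \<phi>)\<^sup>2)" "F \<in> borel_measurable (configs M)" for F :: "('d, 'm) marked set \<Rightarrow> real" and k
    using integral_\<tau>(2)[of "\<lambda>\<phi>. (F \<phi>)\<^sup>2" k] that by simp
  have int: "integrable P (\<lambda>\<phi>. F \<phi> * G (\<tau> k \<phi>))"
    if "integrable P (\<lambda>\<phi>. (F \<phi>)\<^sup>2)" "F \<in> borel_measurable (configs M)"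
      "integrable P (\<lambda>\<phi>. (G \<phi>)\<^sup>2)" "G \<in> borel_measurable (configs M)" for F G :: "('d, 'm) marked set \<Rightarrow> real" and k
  proof -
    note [measurable] = that(2,4)
    show ?thesis by (rule integrable_mult_square[OF _ _ that(1) sq\<tau>[OF that(3,4)]]) measurable
  qed
  note ints = int[OF J2 Xm J2 Xm] int[OF J2 Xm Y_square_integrable Y_measurable]
    int[OF Y_square_integrable Y_measurable J2 Xm] int[OF Y_square_integrable Y_measurable Y_square_integrable Y_measurable]
  have quad: "0 \<le> e ?X ?X - s * (e ?X ?Y + e ?Y ?X) + s\<^sup>2 * e ?Y ?Y" for s
  proof -
    define W where "W \<phi> = ?X \<phi> - s * ?Y \<phi>" for \<phi>
    have Wm [measurable]: "W \<in> borel_measurable (configs M)" unfolding W_def[abs_def] by measurable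
    have W2: "integrable P (\<lambda>\<phi>. (W \<phi>)\<^sup>2)"
    proof -
      have "(W \<phi>)\<^sup>2 = (?X \<phi>)\<^sup>2 - 2 * s * (?X \<phi> * ?Y \<phi>) + s\<^sup>2 * (?Y \<phi>)\<^sup>2" for \<phi>
        by (simp add: W_def power2_eq_square algebra_simps)
      then show ?thesis
        using J2 Y_square_integrable ints(2)[of n 0] by simp
    qed
    have Wl: "local_fun W"
      using J_local[of c] Y_local[of n] unfolding local_fun_def W_def by metis
    have "0 \<le> (\<Sum>k\<in>?U. LINT \<phi>|P. W \<phi> * W (\<tau> k \<phi>))"
    proof (rule field_sum_nonneg[OF Wm W2])
      \<comment> \<open>Outside the neighbours the shifted field is an exterior functional, and both
        parts of W are orthogonal to those. So the finite range holds for every s.\<close>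
      fix k :: "int ^ 'd" assume "k \<notin> ?U"
      then have ext: "exterior_fun (\<lambda>\<phi>. W (\<tau> k \<phi>))" by (rule exterior_\<tau>[OF Wl])
      have m: "(\<lambda>\<phi>. W (\<tau> k \<phi>)) \<in> borel_measurable (configs M)" by measurable
      have i: "integrable P (\<lambda>\<phi>. W (\<tau> k \<phi>))"
        using integrable_mult_square[OF _ _ sq\<tau>[OF W2 Wm, of k], of "\<lambda>_. 1"] by simp
      have "(LINT \<phi>|P. W \<phi> * W (\<tau> k \<phi>)) = (LINT \<phi>|P. ?X \<phi> * W (\<tau> k \<phi>) - s * (?Y \<phi> * W (\<tau> k \<phi>)))"
        by (simp add: W_def algebra_simps)
      also have "\<dots> = 0"
        using J_exterior[OF c(2) m i ext] Y_exterior[OF m i ext, of n] by simp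
      finally show "(LINT \<phi>|P. W \<phi> * W (\<tau> k \<phi>)) = 0" .
    qed
    also have "\<dots> = (\<Sum>k\<in>?U. (LINT \<phi>|P. ?X \<phi> * ?X (\<tau> k \<phi>)) - s * (LINT \<phi>|P. ?X \<phi> * ?Y (\<tau> k \<phi>))
        - s * (LINT \<phi>|P. ?Y \<phi> * ?X (\<tau> k \<phi>)) + s\<^sup>2 * (LINT \<phi>|P. ?Y \<phi> * ?Y (\<tau> k \<phi>)))"
    proof (rule sum.cong[OF refl])
      fix k
      have "W \<phi> * W (\<tau> k \<phi>) = ?X \<phi> * ?X (\<tau> k \<phi>) - s * (?X \<phi> * ?Y (\<tau> k \<phi>)) - s * (?Y \<phi> * ?X (\<tau> k \<phi>)) + s\<^sup>2 * (?Y \<phi> * ?Y (\<tau> k \<phi>))" for \<phi>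
        by (simp add: W_def power2_eq_square algebra_simps)
      then show "(LINT \<phi>|P. W \<phi> * W (\<tau> k \<phi>)) = (LINT \<phi>|P. ?X \<phi> * ?X (\<tau> k \<phi>)) - s * (LINT \<phi>|P. ?X \<phi> * ?Y (\<tau> k \<phi>))
        - s * (LINT \<phi>|P. ?Y \<phi> * ?X (\<tau> k \<phi>)) + s\<^sup>2 * (LINT \<phi>|P. ?Y \<phi> * ?Y (\<tau> k \<phi>))"
        using ints by simp
    qed
    also have "\<dots> = e ?X ?X - s * (e ?X ?Y + e ?Y ?X) + s\<^sup>2 * e ?Y ?Y"
      by (simp add: e_def sum.distrib sum_subtractf sum_distrib_left[symmetric] algebra_simps)
    finally show ?thesis .
  qed
  have neg: "- k \<in> ?U \<longleftrightarrow> k \<in> ?U" for k by (simp add: unit_neighbours_iff)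
  \<comment> \<open>Shifting by - k exchanges the two factors, and the set of neighbours is
    symmetric.\<close>
  have sym: "e ?X ?Y = e ?Y ?X"
  proof -
    have "(LINT \<phi>|P. ?X \<phi> * ?Y (\<tau> k \<phi>)) = (LINT \<phi>|P. ?Y \<phi> * ?X (\<tau> (- k) \<phi>))" for k
    proof -
      have "(\<lambda>\<phi>. ?X \<phi> * ?Y (\<tau> k \<phi>)) \<in> borel_measurable (configs M)" by measurable
      from integral_\<tau>(1)[OF this, of "- k"] show ?thesis by (simp add: \<tau>_\<tau> mult.commute)
    qed
    then have "e ?X ?Y = (\<Sum>k\<in>?U. LINT \<phi>|P. ?Y \<phi> * ?X (\<tau> (- k) \<phi>))" by (simp add: e_def)
    also have "\<dots> = e ?Y ?X"
      unfolding e_def by (rule sum.reindex_bij_witness[of _ uminus uminus]) (auto simp: neg)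
    finally show ?thesis .
  qed
  have T: "0 < e ?Y ?X"
  proof -
    let ?al = "enn2real (\<alpha> 0)"
    have al: "0 < ?al" using \<alpha>_0_pos \<alpha>_finite[of 0] by (simp add: enn2real_positive_iff)
    have "e ?Y ?X = (LINT \<phi>|P. (\<Sum>k\<in>?U. ?Y \<phi> * ?X (\<tau> k \<phi>)))"
      using ints by (simp add: e_def)
    \<comment> \<open>The comparison is pointwise: on \<open>E n\<close> the value -
      \<open>\<alpha> 0\<close> of \<open>Y\<close> meets a sum of at most -1, on \<open>E 0\<close>
      both factors are nonnegative, and elsewhere \<open>Y\<close> is zero.\<close>
    also have "\<dots> \<ge> (LINT \<phi>|P. ?al * indicator (E n) \<phi>)"
    proof (rule integral_mono)
      show "integrable P (\<lambda>\<phi>. ?al * indicator (E n) \<phi>)"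
        by (intro integrable_mult_right integrable_real_indicator) (auto simp: sets_P P.emeasure_eq_measure)
      show "integrable P (\<lambda>\<phi>. \<Sum>k\<in>?U. ?Y \<phi> * ?X (\<tau> k \<phi>))" using ints by simp
      fix \<phi> assume "\<phi> \<in> space P"
      then have \<phi>: "\<phi> \<in> space (configs M)" by (simp add: space_P)
      have eq: "(\<Sum>k\<in>?U. ?Y \<phi> * ?X (\<tau> k \<phi>)) = ?Y \<phi> * (\<Sum>k\<in>?U. J c (cube D k) \<phi>)"
        by (simp add: sum_distrib_left J_cube[OF \<phi>])
      have disj: "\<not> (\<phi> \<in> E 0 \<and> \<phi> \<in> E n)" using n(2) unfolding E_def by force
      consider "\<phi> \<in> E 0" "\<phi> \<notin> E n" | "\<phi> \<in> E n" "\<phi> \<notin> E 0" | "\<phi> \<notin> E 0" "\<phi> \<notin> E n"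
        using disj by blast
      then show "?al * indicator (E n) \<phi> \<le> (\<Sum>k\<in>?U. ?Y \<phi> * ?X (\<tau> k \<phi>))"
      proof cases
        case 1
        then show ?thesis
          unfolding eq by (auto simp: Y_def intro!: mult_nonneg_nonneg sum_nonneg J_nonneg_on_empty)
      next
        case 2
        \<comment> \<open>The central cube is split off because its points supply the negative term;
          the innovations of the other cubes are bounded above by their compensators.\<close>
        have 0: "0 \<in> ?U" by (simp add: unit_neighbours_iff)
        have "(\<Sum>k\<in>?U. J c (cube D k) \<phi>) = J c \<Delta> \<phi> + (\<Sum>k\<in>?U - {0}. J c (cube D k) \<phi>)"
          by (rule sum.remove[OF finite_unit_neighbours 0])
        also have "\<dots> \<le> (a c \<Delta> - S c \<Delta> \<phi>) + (\<Sum>k\<in>?U - {0}. a c (cube D k))"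
          using A_le[OF cube_bounded_borel \<phi> c(2), of D 0] J_le[OF \<phi> c(2)]
          by (intro add_mono sum_mono) (auto simp: J_def)
        also have "\<dots> = b - S c \<Delta> \<phi>"
          by (simp add: b_def sum.remove[OF finite_unit_neighbours 0])
        also have "\<dots> \<le> - 1"
          using S_ge[OF \<phi> c(1)] n(1) 2(1) by (simp add: E_def)
        finally have "1 \<le> - (\<Sum>k\<in>?U. J c (cube D k) \<phi>)" by simp
        then have "?al * 1 \<le> ?al * - (\<Sum>k\<in>?U. J c (cube D k) \<phi>)"
          using al by (intro mult_left_mono) auto
        then show ?thesis unfolding eq using 2 by (simp add: Y_def)
      next
        case 3
        then show ?thesis unfolding eq by (simp add: Y_def)
      qed
    qed
    moreover have "(LINT \<phi>|P. ?al * indicator (E n) \<phi>) = ?al * measure P (E n)"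
      by (simp add: sets_P)
    ultimately show ?thesis using al P_E_pos[of n] by (smt (verit) mult_pos_pos)
  qed
  have "0 < e ?X ?X"
  proof (rule ccontr)
    assume np: "\<not> 0 < e ?X ?X"
    \<comment> \<open>Of the order of the minimiser of the quadratic. The denominator is never zero,
      and the quadratic term takes back at most half of the linear gain.\<close>
    let ?s = "e ?Y ?X / (\<bar>e ?Y ?Y\<bar> + 1)"
    have s: "0 < ?s" using T by simp
    have "?s * e ?Y ?Y \<le> ?s * (\<bar>e ?Y ?Y\<bar> + 1)" using s by (intro mult_left_mono) auto
    also have "\<dots> = e ?Y ?X" by simp
    finally have "?s * (?s * e ?Y ?Y) \<le> ?s * e ?Y ?X" using s by (intro mult_left_mono) auto
    then have "?s\<^sup>2 * e ?Y ?Y \<le> ?s * e ?Y ?X" by (simp add: power2_eq_square mult.assoc)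
    moreover have "0 < ?s * e ?Y ?X" using s T by simp
    moreover have "0 \<le> e ?X ?X - ?s * (e ?Y ?X + e ?Y ?X) + ?s\<^sup>2 * e ?Y ?Y" using quad[of ?s] sym by simp
    ultimately show False using np by (simp add: distrib_left)
  qed
  then show ?thesis by (simp add: e_def)
qed

subsection \<open>The asymptotic variance\<close>

lemma AE_innovation_product:
  "AE \<phi> in P. innovation_product M v D (power_test v c) \<theta>s k \<phi> = J c \<Delta> \<phi> * J c (cube D k) \<phi>"
  using AE_innovation[OF cube_bounded_borel, of c D 0] AE_innovation[OF cube_bounded_borel, of c D k]
  by eventually_elim (simp add: innovation_product_def)

text \<open>Makes each extended expectation meaningful: none of them is a difference of two
  infinities or equals minus infinity.\<close>

lemma innovation_product_negative_part:
  assumes "c \<le> 1"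
  shows "(\<integral>\<^sup>+\<phi>. ennreal (- innovation_product M v D (power_test v c) \<theta>s k \<phi>) \<partial>P) < \<infinity>"
proof -
  have "(\<integral>\<^sup>+\<phi>. ennreal (- innovation_product M v D (power_test v c) \<theta>s k \<phi>) \<partial>P)
    = (\<integral>\<^sup>+\<phi>. ennreal (- (J c \<Delta> \<phi> * J c (cube D k) \<phi>)) \<partial>P)"
    using AE_innovation_product[of c k] by (intro nn_integral_cong_AE, eventually_elim) simp
  with negative_part[OF cube_bounded_borel cube_bounded_borel assms] show ?thesis by simp
qed

lemma ext_expectation_J:
  "ext_expectation P (innovation_product M v D (power_test v c) \<theta>s k) = ext_expectation P (\<lambda>\<phi>. J c \<Delta> \<phi> * J c \<Delta> (\<tau> k \<phi>))"
proof -
  have ae: "AE \<phi> in P. innovation_product M v D (power_test v c) \<theta>s k \<phi> = J c \<Delta> \<phi> * J c \<Delta> (\<tau> k \<phi>)"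
    using AE_innovation_product[of c k] AE_space by eventually_elim (simp add: J_cube[where k=k] space_P)
  have "(\<integral>\<^sup>+\<phi>. ennreal (innovation_product M v D (power_test v c) \<theta>s k \<phi>) \<partial>P) = (\<integral>\<^sup>+\<phi>. ennreal (J c \<Delta> \<phi> * J c \<Delta> (\<tau> k \<phi>)) \<partial>P)"
    "(\<integral>\<^sup>+\<phi>. ennreal (- innovation_product M v D (power_test v c) \<theta>s k \<phi>) \<partial>P) = (\<integral>\<^sup>+\<phi>. ennreal (- (J c \<Delta> \<phi> * J c \<Delta> (\<tau> k \<phi>))) \<partial>P)"
    using ae by (intro nn_integral_cong_AE, eventually_elim, simp)+
  then show ?thesis by (simp add: ext_expectation_def)
qed

lemma lambda_Inn_square_integrable:
  assumes c: "0 \<le> c" "c \<le> 1" and J2: "integrable P (\<lambda>\<phi>. (J c \<Delta> \<phi>)\<^sup>2)"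
  shows "0 < lambda_Inn M v D P (power_test v c) \<theta>s" "lambda_Inn M v D P (power_test v c) \<theta>s < \<infinity>"
proof -
  have m [measurable]: "J c \<Delta> \<in> borel_measurable (configs M)" by (rule J_measurable[OF cube_bounded_borel])
  have "integrable P (\<lambda>\<phi>. (J c \<Delta> (\<tau> k \<phi>))\<^sup>2)" for k
    using integral_\<tau>(2)[of "\<lambda>\<phi>. (J c \<Delta> \<phi>)\<^sup>2" k] J2 by simp
  then have "integrable P (\<lambda>\<phi>. J c \<Delta> \<phi> * J c \<Delta> (\<tau> k \<phi>))" for k
    by (intro integrable_mult_square J2) measurable
  then have "ext_expectation P (innovation_product M v D (power_test v c) \<theta>s k)
      = ereal (LINT \<phi>|P. J c \<Delta> \<phi> * J c \<Delta> (\<tau> k \<phi>))" for k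
    by (simp add: ext_expectation_J ext_expectation_eq_integral)
  then have eq: "lambda_Inn M v D P (power_test v c) \<theta>s
      = ereal (1 / D ^ CARD('d) * (\<Sum>k\<in>unit_neighbours. LINT \<phi>|P. J c \<Delta> \<phi> * J c \<Delta> (\<tau> k \<phi>)))"
    by (simp add: lambda_Inn_def)
  show "0 < lambda_Inn M v D P (power_test v c) \<theta>s" "lambda_Inn M v D P (power_test v c) \<theta>s < \<infinity>"
    unfolding eq using sum_correlation_pos[OF c J2] D_pos by simp_all
qed

text \<open>The diagonal term is the integral of a square, hence infinite. Since no other term is
  minus infinity, by \<open>innovation_product_negative_part\<close>, the infinite sum does not rest
  on a convention for adding opposite infinities.\<close>

lemma lambda_Inn_not_square_integrable:
  assumes c: "c \<le> 1" and J2: "\<not> integrable P (\<lambda>\<phi>. (J c \<Delta> \<phi>)\<^sup>2)"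
  shows "0 < lambda_Inn M v D P (power_test v c) \<theta>s"
proof -
  have [measurable]: "J c \<Delta> \<in> borel_measurable (configs M)" by (rule J_measurable[OF cube_bounded_borel])
  have "(\<integral>\<^sup>+\<phi>. ennreal ((J c \<Delta> \<phi>)\<^sup>2) \<partial>P) = \<infinity>"
  proof (rule ccontr)
    assume "(\<integral>\<^sup>+\<phi>. ennreal ((J c \<Delta> \<phi>)\<^sup>2) \<partial>P) \<noteq> \<infinity>"
    then have "integrable P (\<lambda>\<phi>. (J c \<Delta> \<phi>)\<^sup>2)"
      by (intro integrableI_nonneg) (auto simp: less_top)
    with J2 show False by simp
  qed
  then have "ext_expectation P (innovation_product M v D (power_test v c) \<theta>s 0) = \<infinity>"
    unfolding ext_expectation_J by (simp add: ext_expectation_def power2_eq_square ennreal_neg)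
  moreover have "0 \<in> (unit_neighbours :: (int ^ 'd) set)" by (simp add: unit_neighbours_iff)
  ultimately have "(\<Sum>k\<in>unit_neighbours. ext_expectation P (innovation_product M v D (power_test v c) \<theta>s k)) = \<infinity>"
    unfolding sum_Pinfty using finite_unit_neighbours by blast
  then show ?thesis using D_pos by (simp add: lambda_Inn_def)
qed

lemma lambda_Inn_pos: "0 \<le> c \<Longrightarrow> c \<le> 1 \<Longrightarrow> 0 < lambda_Inn M v D P (power_test v c) \<theta>s"
  using lambda_Inn_square_integrable(1) lambda_Inn_not_square_integrable by blast

lemma lambda_Inn_finite: "0 \<le> c \<Longrightarrow> c \<le> 1 / 2 \<Longrightarrow> lambda_Inn M v D P (power_test v c) \<theta>s < \<infinity>"
  using lambda_Inn_square_integrable(2) J_square_integrable[OF cube_bounded_borel] by simp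

end

text \<open>The integrability clauses guard the extended-real reading: positivity is asserted for
  well-defined expectations, and for exponents up to 1/2 the value is an ordinary positive
  number.\<close>

theorem proposition16:
  fixes M :: "'m measure"
    and \<Theta> :: "(real ^ 'p::finite) set" and \<theta>s :: "real ^ 'p"
    and v :: "('d::finite, 'm, 'p) stat"
    and Q P :: "('d, 'm) marked set measure"
    and D :: real
  assumes marks: "prob_space M"
    and poisson: "poisson_process M Q"
    and family: "exponential_family M \<Theta> v"
    and true_parameter: "\<theta>s \<in> interior \<Theta>"
    and gibbs: "gibbs_measure M Q v \<theta>s P"
    and stat: "stationary M P"
    and D_pos: "D > 0"
    and Exp: "exp_condition M \<Theta> v D"
  shows "(\<forall>h \<in> {raw_test, pearson_test v, inverse_test v}.
            (\<forall>k \<in> unit_neighbours.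
               (\<integral>\<^sup>+ \<phi>. ennreal (- innovation_product M v D h \<theta>s k \<phi>) \<partial>P) < \<infinity>) \<and>
            lambda_Inn M v D P h \<theta>s > 0) \<and>
         (\<forall>h \<in> {raw_test, pearson_test v}. lambda_Inn M v D P h \<theta>s < \<infinity>)"
proof -
  interpret gibbs_model M Q \<Theta> \<theta>s v P D
    using assms by (intro gibbs_model.intro poisson.intro gibbs_model_axioms.intro)
  have "(\<forall>k\<in>unit_neighbours. (\<integral>\<^sup>+ \<phi>. ennreal (- innovation_product M v D (power_test v c) \<theta>s k \<phi>) \<partial>P) < \<infinity>) \<and>
      0 < lambda_Inn M v D P (power_test v c) \<theta>s" if "0 \<le> c" "c \<le> 1" for c
    using innovation_product_negative_part lambda_Inn_pos that by blast
  moreover have "lambda_Inn M v D P (power_test v c) \<theta>s < \<infinity>" if "0 \<le> c" "c \<le> 1 / 2" for c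
    using lambda_Inn_finite that by blast
  ultimately show ?thesis
    by (simp add: raw_test_eq[of v] pearson_test_eq inverse_test_eq)
qed

end
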